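(* In the regression setup described in the context, assume that $(X_i,\varepsilon_i)_{i\ge1}$ is ergodic (in addition to stationary), that $\mathbb{E}\|U_1\|^2<\infty$, that $h_n\to0$, $nh_n\to\infty$ and $nh_n\,\lambda_{\max}(\operatorname{Cov}(\overline U_n))\to0$, where $\overline U_n=\frac1n\sum_{i=1}^nU_i$, that $c_2(K)=\int K^2(u)\,du<\infty$, and that $\mu\in\mathcal{D}$. Then $$\sqrt{nh_n}\,(\widehat\beta_n-\beta)\Rightarrow\mathcal{N}(0,\Sigma_\beta),\qquad \Sigma_\beta=\nabla g(\mu)\,\Sigma_\mu\,\nabla g(\mu)^\top,\qquad \Sigma_\mu=\frac{c_2(K)}{f(0)}\,\mathbb{E}[U_1U_1^\top].$$ If in addition $\mathbb{E}\|X_1\|^4<\infty$, $0<\mathbb{E}[\varepsilon_1^2\mid X_1]<\infty$ almost surely, and the support of $X_1$ has nonempty interior in $\mathbb{R}^p$, then $\Sigma_\beta$ is positive definite and, for every $\alpha\in(0,1)$, the set $$\mathcal{C}^{\beta}_{1-\alpha}(n)=\Big\{b\in\mathbb{R}^{p+1}:\ nh_n\,(\widehat\beta_n-b)^\top\widehat\Sigma_{\beta,n}^{-1}(\widehat\beta_n-b)\le\chi^2_{p+1,1-\alpha}\Big\}$$ is an asymptotic $(1-\alpha)100\%$ confidence region for $\beta$, i.e. $\mathbb{P}(\beta\in\mathcal{C}^{\beta}_{1-\alpha}(n))\to1-\alpha$, where $$\widehat\Sigma_{\mu,n}=\frac{c_2(K)}{f(0)}\cdot\frac1n\sum_{i=1}^nU_iU_i^\top,\qquad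 \widehat\Sigma_{\beta,n}=\nabla g(\widehat\mu_n)\,\widehat\Sigma_{\mu,n}\,\nabla g(\widehat\mu_n)^\top,$$ and $\chi^2_{p+1,1-\alpha}$ is the $(1-\alpha)$-quantile of the chi-squared distribution with $p+1$ degrees of freedom.
   Context: Regression setup. Let $p\ge1$, $m=p+1$, $q_1=m(m+1)/2$, $q=q_1+m$. $(X_i,\varepsilon_i)_{i\ge1}$ is a stationary sequence with $X_i=(X_{i,1},\dots,X_{i,p})^\top\in\mathbb{R}^p$, $\varepsilon_i\in\mathbb{R}$, $\mathbb{E}[\varepsilon_1\mid X_1]=0$, $\mathbb{E}\|X_1\|^2<\infty$, and $Y_i=\beta_0+\beta_1X_{i,1}+\cdots+\beta_pX_{i,p}+\varepsilon_i$. Put $\widetilde X_i=(1,X_i^\top)^\top\in\mathbb{R}^{m}$, $\beta=(\beta_0,\dots,\beta_p)^\top$, $\Sigma=\mathbb{E}[\widetilde X_1\widetilde X_1^\top]$, $\Gamma=\mathbb{E}[\widetilde X_1Y_1]$, $\mu=(\operatorname{Vech}(\Sigma)^\top,\Gamma^\top)^\top\in\mathbb{R}^q$, where $\operatorname{Vech}$ stacks the lower-triangular entries of a symmetric matrix. For $\mathbf{x}\in\mathbb{R}^q$, let $\Sigma(\mathbf{x})$ (symmetric $m\times m$) and $\Gamma(\mathbf{x})\in\mathbb{R}^m$ be determined by $\mathbf{x}=(\operatorname{Vech}(\Sigma(\mathbf{x}))^\top,\Gamma(\mathbf{x})^\top)^\top$; let $\Delta(\mathbf{x})=\det\Sigma(\mathbf{x})$,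 $\mathcal{D}=\{\mathbf{x}\in\mathbb{R}^q:\Delta(\mathbf{x})>0\}$, and $g:\mathcal{D}\to\mathbb{R}^{p+1}$, $g(\mathbf{x})=\Sigma(\mathbf{x})^{-1}\Gamma(\mathbf{x})$; $\nabla g$ is its $(p+1)\times q$ Jacobian. If $\mu\in\mathcal{D}$ then $\beta=g(\mu)$. Let $U_i=(\operatorname{Vech}(\widetilde X_i\widetilde X_i^\top)^\top,(\widetilde X_iY_i)^\top)^\top\in\mathbb{R}^q$, so $\mathbb{E}[U_1]=\mu$. Smoothing. $(V_i)_{i\ge1}$ is i.i.d., real, independent of $(U_i)_{i\ge1}$, with bounded density $f$ continuous at $0$ and $f(0)>0$; $K$ is a symmetric bounded probability density on $\mathbb{R}$; $(h_n)$ are positive bandwidths. Define $$\widehat\mu_n=\frac{1}{n\,\mathbb{E}[K(V_1/h_n)]}\sum_{i=1}^nU_i\,K(V_i/h_n),\qquad \widehat\beta_n=g(\widehat\mu_n)\ \text{ whenever }\widehat\mu_n\in\mathcal{D}.$$ Quantities such as $\widehat\beta_n$ and inverse matrices are defined arbitrarily (measurably) on the events where the formulas make no sense; these events have probability tending to $0$. $\lambda_{\max}$ is the largest eigenvalue and $\Rightarrow$ is convergence in distribution. *)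

theory Defs
  imports "HOL-Probability.Probability" "HOL-Library.Option_ord"
begin

section \<open>Half-vectorization\<close>

text \<open>Positions \<open>(row, column)\<close> on or below the diagonal of a matrix indexed by \<open>'m\<close>.\<close>

typedef (overloaded) ('m::linorder) ltri = "{(i::'m, j). j \<le> i}"
  morphisms position Ltri
  by auto

instance ltri :: ("{finite,linorder}") finite
proof
  have "(UNIV :: 'a ltri set) = Ltri ` {(i, j). j \<le> i}"
    by (metis type_definition.Abs_image type_definition_ltri)
  then show "finite (UNIV :: 'a ltri set)"
    by (metis finite finite_imageI)
qed

text \<open>With \<open>m = CARD('m)\<close>, the type \<open>'m stacked\<close> is \<open>\<real>\<^sup>q\<close> for \<open>q = m(m+1)/2 + m\<close>; coordinates
  are labelled by the entry they come from instead of being numbered.\<close>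

type_synonym 'm stacked = "real ^ ('m ltri + 'm)"

definition vech :: "real ^ ('m::{finite,linorder}) ^ ('m::{finite,linorder}) \<Rightarrow> real ^ 'm ltri" where
  "vech A = (\<chi> k. A $ fst (position k) $ snd (position k))"

definition stack :: "real ^ 'm ltri \<Rightarrow> real ^ ('m::{finite,linorder}) \<Rightarrow> 'm stacked" where
  "stack a b = (\<chi> k. case k of Inl i \<Rightarrow> a $ i | Inr j \<Rightarrow> b $ j)"

definition Sigma_of :: "'m stacked \<Rightarrow> real ^ ('m::{finite,linorder}) ^ ('m::{finite,linorder})" where
  "Sigma_of x = (\<chi> i j. x $ Inl (Ltri (max i j, min i j)))"

definition Gamma_of :: "'m stacked \<Rightarrow> real ^ ('m::{finite,linorder})" where
  "Gamma_of x = (\<chi> i. x $ Inr i)"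

lemma card_ltri: "CARD(('m::{finite,linorder}) ltri) = CARD('m) * (CARD('m) + 1) div 2"
proof -
  let ?L = "{(i::'m, j). j \<le> i}" and ?G = "{(i::'m, j). i \<le> j}" and ?D = "{(i::'m, j). i = j}"
  have "CARD('m ltri) = card ?L"
    by (rule type_definition.card[OF type_definition_ltri])
  moreover have "card ?G = card ?L"
    by (rule bij_betw_same_card[of prod.swap]) (auto intro!: bij_betwI[of _ _ _ prod.swap])
  moreover have "card (?L \<union> ?G) + card (?L \<inter> ?G) = card ?L + card ?G"
    by (rule card_Un_Int[symmetric]) auto
  moreover have "?L \<union> ?G = UNIV" "?L \<inter> ?G = ?D" by auto
  moreover have "card ?D = CARD('m)"
    by (rule bij_betw_same_card[of fst]) (auto intro!: bij_betwI[of _ _ _ "\<lambda>i. (i, i)"])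
  moreover have "CARD('m \<times> 'm) = CARD('m) * CARD('m)" by simp
  ultimately have "2 * CARD('m ltri) = CARD('m) * (CARD('m) + 1)" by simp
  then show ?thesis by simp
qed

lemma stack_Sigma_of_Gamma_of: "stack (vech (Sigma_of x)) (Gamma_of x) = x"
proof -
  have "Ltri (max i j, min i j) = k" if "position k = (i, j)" for k :: "'a ltri" and i j
    using position[of k] position_inverse[of k] that by (auto simp: max_absorb1 min_absorb2)
  then have "Ltri (max (fst (position k)) (snd (position k)),
      min (fst (position k)) (snd (position k))) = k" for k :: "'a ltri"
    by (metis prod.collapse)
  then show ?thesis
    by (simp add: vec_eq_iff stack_def vech_def Sigma_of_def Gamma_of_def split: sum.split)
qed

lemma Sigma_of_symmetric: "transpose (Sigma_of x) = Sigma_of x"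
  by (simp add: vec_eq_iff transpose_def Sigma_of_def max.commute min.commute)

lemma Sigma_of_stack:
  assumes "transpose S = S"
  shows "Sigma_of (stack (vech S) c) = S"
proof -
  have sym: "S $ i $ j = S $ j $ i" for i j
    using assms by (metis transpose_def vec_lambda_beta)
  have "position (Ltri (max i j, min i j)) = (max i j, min i j)" for i j :: 'a
    by (rule Ltri_inverse) (auto simp: min_le_iff_disj le_max_iff_disj)
  then show ?thesis
    using sym by (auto simp: vec_eq_iff stack_def vech_def Sigma_of_def max_def min_def)
qed

lemma Gamma_of_stack: "Gamma_of (stack a c) = c"
  by (simp add: vec_eq_iff stack_def Gamma_of_def)


section \<open>Matrices\<close>

definition outer :: "real ^ 'n \<Rightarrow> real ^ 'k \<Rightarrow> real ^ 'k ^ 'n" where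
  "outer v w = (\<chi> i j. v $ i * w $ j)"

definition pos_definite :: "real ^ 'n ^ 'n \<Rightarrow> bool" where
  "pos_definite A \<longleftrightarrow> transpose A = A \<and> (\<forall>v. v \<noteq> 0 \<longrightarrow> v \<bullet> (A *v v) > 0)"

text \<open>Used for covariance matrices only; a symmetric matrix has finitely many, and at least one,
  real eigenvalues.\<close>

definition lambda_max :: "real ^ 'n ^ 'n \<Rightarrow> real" where
  "lambda_max A = Max {l. \<exists>v. v \<noteq> 0 \<and> A *v v = l *\<^sub>R v}"


section \<open>Probability\<close>

definition cov_matrix :: "'w measure \<Rightarrow> ('w \<Rightarrow> real ^ 'n) \<Rightarrow> real ^ 'n ^ 'n" where
  "cov_matrix M Z = (LINT w|M. outer (Z w - (LINT w'|M. Z w')) (Z w - (LINT w'|M. Z w')))"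

definition stationary :: "'w measure \<Rightarrow> 'a measure \<Rightarrow> (nat \<Rightarrow> 'w \<Rightarrow> 'a) \<Rightarrow> bool" where
  "stationary M N Z \<longleftrightarrow> (\<forall>i. Z i \<in> measurable M N) \<and>
     distr M (PiM UNIV (\<lambda>_. N)) (\<lambda>w i. Z (Suc i) w) = distr M (PiM UNIV (\<lambda>_. N)) (\<lambda>w i. Z i w)"

definition ergodic :: "'w measure \<Rightarrow> 'a measure \<Rightarrow> (nat \<Rightarrow> 'w \<Rightarrow> 'a) \<Rightarrow> bool" where
  "ergodic M N Z \<longleftrightarrow>
     (\<forall>A \<in> sets (PiM UNIV (\<lambda>_. N)).
        (\<lambda>z i. z (Suc i)) -` A \<inter> space (PiM UNIV (\<lambda>_. N)) = A \<longrightarrow>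
        measure (distr M (PiM UNIV (\<lambda>_. N)) (\<lambda>w i. Z i w)) A \<in> {0, 1})"

definition generated_by :: "'w measure \<Rightarrow> 'a measure \<Rightarrow> ('w \<Rightarrow> 'a) \<Rightarrow> 'w measure" where
  "generated_by M N Z = vimage_algebra (space M) Z N"

text \<open>The library's \<open>indep_var\<close> requires both variables to take values in the same type.\<close>

definition indep_rv ::
  "'w measure \<Rightarrow> 'a measure \<Rightarrow> ('w \<Rightarrow> 'a) \<Rightarrow> 'b measure \<Rightarrow> ('w \<Rightarrow> 'b) \<Rightarrow> bool" where
  "indep_rv M N Z N' Z' \<longleftrightarrow> Z \<in> measurable M N \<and> Z' \<in> measurable M N' \<and>
     prob_space.indep_set M (sets (generated_by M N Z)) (sets (generated_by M N' Z'))"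

definition law_support :: "'a::topological_space measure \<Rightarrow> 'a set" where
  "law_support N = {x. \<forall>G. open G \<longrightarrow> x \<in> G \<longrightarrow> emeasure N G > 0}"

definition weakly_converges :: "(nat \<Rightarrow> 'a::topological_space measure) \<Rightarrow> 'a measure \<Rightarrow> bool" where
  "weakly_converges Ns N \<longleftrightarrow>
     (\<forall>\<phi>::'a \<Rightarrow> real. continuous_on UNIV \<phi> \<longrightarrow> bounded (range \<phi>) \<longrightarrow>
        (\<lambda>n. LINT x|Ns n. \<phi> x) \<longlonglongrightarrow> (LINT x|N. \<phi> x))"

definition std_normal :: "real measure" where
  "std_normal = density lborel std_normal_density"

definition std_normal_vec :: "(real ^ 'n) measure" where
  "std_normal_vec = distr (PiM UNIV (\<lambda>_::'n. std_normal)) borel (\<lambda>z. \<chi> i. z i)"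

text \<open>The law of \<open>c + A Z\<close> for standard normal \<open>Z\<close> and \<open>A A\<^sup>T = S\<close>. Such a matrix \<open>A\<close> exists for
  every positive semidefinite \<open>S\<close>, singular ones included, and the law does not depend on its choice.\<close>

definition mv_normal :: "real ^ 'n \<Rightarrow> real ^ 'n ^ 'n \<Rightarrow> (real ^ 'n) measure" where
  "mv_normal c S =
     distr std_normal_vec borel (\<lambda>z. c + (SOME A :: real ^ 'n ^ 'n. A ** transpose A = S) *v z)"

definition chi_squared :: "nat \<Rightarrow> real measure" where
  "chi_squared k = distr (PiM {..<k} (\<lambda>_. std_normal)) borel (\<lambda>z. \<Sum>i<k. (z i)\<^sup>2)"

definition quantile :: "real measure \<Rightarrow> real \<Rightarrow> real" where
  "quantile N u = Inf {x. u \<le> cdf N x}"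


section \<open>Regression and smoothing\<close>

text \<open>Covariates live in \<open>real ^ 'p\<close>. Coefficients and augmented covariates live in
  \<open>real ^ 'p option\<close>, the component \<open>None\<close> being the one of the intercept. Sequences
  of observations are indexed from 0, so that the sample of size \<open>n\<close> has the indices \<open>i < n\<close>.\<close>

definition augment :: "real ^ 'p \<Rightarrow> real ^ 'p option" where
  "augment x = (\<chi> k. case k of None \<Rightarrow> 1 | Some j \<Rightarrow> x $ j)"

definition moment_vec :: "real ^ ('p::{finite,linorder}) \<Rightarrow> real \<Rightarrow> 'p option stacked" where
  "moment_vec x y = stack (vech (outer (augment x) (augment x))) (y *\<^sub>R augment x)"

definition domD :: "('m::{finite,linorder}) stacked set" where
  "domD = {x. det (Sigma_of x) > 0}"

text \<open>Relevant on the open set \<open>domD\<close> only.\<close>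

definition g :: "'m stacked \<Rightarrow> real ^ ('m::{finite,linorder})" where
  "g x = matrix_inv (Sigma_of x) *v Gamma_of x"

definition grad_g :: "'m stacked \<Rightarrow> real ^ ('m ltri + 'm) ^ ('m::{finite,linorder})" where
  "grad_g x = jacobian g (at x)"

definition c2 :: "(real \<Rightarrow> real) \<Rightarrow> real" where
  "c2 K = (LINT u|lborel. (K u)\<^sup>2)"

definition sample_mean :: "(nat \<Rightarrow> 'w \<Rightarrow> 'a::real_vector) \<Rightarrow> nat \<Rightarrow> 'w \<Rightarrow> 'a" where
  "sample_mean Z n w = (1 / real n) *\<^sub>R (\<Sum>i<n. Z i w)"

definition mu_hat ::
  "'w measure \<Rightarrow> (nat \<Rightarrow> 'w \<Rightarrow> 'a::real_vector) \<Rightarrow> (nat \<Rightarrow> 'w \<Rightarrow> real) \<Rightarrow>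
   (real \<Rightarrow> real) \<Rightarrow> (nat \<Rightarrow> real) \<Rightarrow> nat \<Rightarrow> 'w \<Rightarrow> 'a" where
  "mu_hat M U V K h n w =
     (1 / (real n * (LINT w'|M. K (V 0 w' / h n)))) *\<^sub>R (\<Sum>i<n. K (V i w / h n) *\<^sub>R U i w)"

definition Sigma_mu ::
  "'w measure \<Rightarrow> (nat \<Rightarrow> 'w \<Rightarrow> real ^ 'n) \<Rightarrow> (real \<Rightarrow> real) \<Rightarrow> (real \<Rightarrow> real) \<Rightarrow> real ^ 'n ^ 'n" where
  "Sigma_mu M U K f = (c2 K / f 0) *\<^sub>R (LINT w|M. outer (U 0 w) (U 0 w))"

definition Sigma_mu_hat ::
  "(nat \<Rightarrow> 'w \<Rightarrow> real ^ 'n) \<Rightarrow> (real \<Rightarrow> real) \<Rightarrow> (real \<Rightarrow> real) \<Rightarrow> nat \<Rightarrow> 'w \<Rightarrow> real ^ 'n ^ 'n" where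
  "Sigma_mu_hat U K f n w = (c2 K / f 0) *\<^sub>R sample_mean (\<lambda>i w. outer (U i w) (U i w)) n w"

definition sandwich ::
  "'m stacked \<Rightarrow> real ^ ('m ltri + 'm) ^ ('m ltri + 'm) \<Rightarrow> real ^ ('m::{finite,linorder}) ^ ('m::{finite,linorder})" where
  "sandwich x S = grad_g x ** S ** transpose (grad_g x)"

text \<open>\<open>b\<close> is the point estimate, \<open>P\<close> stands for the inverse of the estimated asymptotic
  covariance, and \<open>r\<close> is the rate \<open>n h\<^sub>n\<close>.\<close>

definition conf_region :: "real \<Rightarrow> real ^ 'm \<Rightarrow> real ^ 'm ^ 'm \<Rightarrow> real \<Rightarrow> (real ^ 'm) set" where
  "conf_region r b P \<alpha> =
     {b'. r * ((b - b') \<bullet> (P *v (b - b'))) \<le> quantile (chi_squared CARD('m)) (1 - \<alpha>)}"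

end

theory Submission
  imports Defs
begin

text \<open>The scaled error of the smoothed moments splits as
  \<open>\<surd>(n h\<^sub>n) (\<mu>\<^sub>n - \<mu>) = \<Sum>\<^sub>i e\<^sub>n(V\<^sub>i) U\<^sub>i + \<surd>(n h\<^sub>n) (m\<^sub>n - \<mu>)\<close> with
  \<open>e\<^sub>n(v) = \<surd>(h\<^sub>n/n) (K(v/h\<^sub>n) / E K(V/h\<^sub>n) - 1)\<close>, where \<open>m\<^sub>n\<close> is the sample mean. The second summand
  vanishes in \<open>L\<^sup>2\<close>, because the trace of a covariance matrix is at most its dimension times its largest
  eigenvalue. Given the \<open>U\<^sub>i\<close>, the first one is a sum of independent centred terms whose weights are
  uniformly of order \<open>1/\<surd>(n h\<^sub>n)\<close>; by independence its characteristic function at \<open>c\<close> is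
  \<open>E \<Prod>\<^sub>i \<phi>\<^sub>n(c \<bullet> U\<^sub>i)\<close>, and a second-order expansion of \<open>\<phi>\<^sub>n\<close> together with the ergodic theorem for
  \<open>(c \<bullet> U\<^sub>i)\<^sup>2\<close> gives the Gaussian limit.

  No delta method is needed: with \<open>L d = \<Gamma>(d) - \<Sigma>(d) \<beta>\<close> one has, exactly,
  \<open>g x - g \<mu> = \<Sigma>(x)\<^sup>-\<^sup>1 L (x - \<mu>)\<close>, and \<open>\<nabla>g(\<mu>) = \<Sigma>(\<mu>)\<^sup>-\<^sup>1 L\<close>, so Slutsky's argument suffices. Since
  \<open>L U\<^sub>i = \<epsilon>\<^sub>i X\<^sub>i\<close> (augmented covariates), a null vector of \<open>\<Sigma>\<^sub>\<beta>\<close> would confine \<open>X\<^sub>1\<close> to a hyperplane.\<close>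

section \<open>Matrices\<close>

text \<open>The \<open>U_i\<close> are merely ergodic, so no central limit theorem is available for
  their partial sums. Centring the kernel factor moves the Gaussian fluctuation to the independent
  \<open>V_i\<close>; the dependence among the \<open>U_i\<close> enters only through laws of large
  numbers and through the assumed decay of the covariance of their mean. This is why the limit
  contains the second moment \<open>E[U_1 U_1^T]\<close> and not a covariance. The constant comes
  from \<open>n E[e_n(V)^2] = (E[K(V/h_n)^2] / h_n) / (E[K(V/h_n)] / h_n)^2 - h_n\<close>, whose
  limit is \<open>f(0) c_2(K) / f(0)^2\<close>. The first claim allows a singular limit law, so weak
  convergence is derived from characteristic functions rather than densities, and normal laws are
  treated for positive semidefinite matrices. The estimators are prescribed only on events of
  probability tending to 1; convergence in probability is therefore phrased through exceptional
  events, and an estimator is replaced by its formula only where the smoothed moments lie close to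
  their limit.\<close>

definition pos_semidefinite :: "real ^ 'n ^ 'n \<Rightarrow> bool" where
  "pos_semidefinite A \<longleftrightarrow> transpose A = A \<and> (\<forall>v. v \<bullet> (A *v v) \<ge> 0)"

lemma tendsto_matrix_vector_mult:
  fixes A :: "real ^ 'n ^ 'm"
  assumes "(f \<longlongrightarrow> A) F" "(b \<longlongrightarrow> c) F"
  shows "((\<lambda>x. f x *v b x) \<longlongrightarrow> A *v c) F"
  unfolding matrix_vector_mult_def by (intro tendsto_intros assms)

lemma bounded_bilinear_matrix_vector_mult:
  "bounded_bilinear (\<lambda>(A :: real ^ 'n ^ 'm) (x :: real ^ 'n). A *v x)"
  by (subst bilinear_conv_bounded_bilinear[symmetric])
     (auto simp: bilinear_def intro!: linearI
       simp: matrix_vector_right_distrib matrix_vector_mult_add_rdistrib matrix_vector_mult_scaleR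
         scaleR_matrix_vector_assoc)

lemma pos_semidefinite_scaleR:
  "pos_semidefinite S \<Longrightarrow> c \<ge> 0 \<Longrightarrow> pos_semidefinite (c *\<^sub>R S)"
  by (auto simp: pos_semidefinite_def scaleR_matrix_vector_assoc[symmetric] vec_eq_iff transpose_def)

lemma inner_symmetric_matrix:
  fixes A :: "real ^ 'n ^ 'n"
  assumes "transpose A = A"
  shows "x \<bullet> (A *v y) = y \<bullet> (A *v x)"
  by (metis assms dot_lmul_matrix inner_commute transpose_matrix_vector)

lemma quadratic_diff:
  fixes A :: "real ^ 'n ^ 'n"
  assumes "transpose A = A"
  shows "(v - t *\<^sub>R w) \<bullet> (A *v (v - t *\<^sub>R w)) = v \<bullet> (A *v v) - 2 * t * (v \<bullet> (A *v w)) + t\<^sup>2 * (w \<bullet> (A *v w))"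
  using inner_symmetric_matrix[OF assms, of v w]
  by (simp add: matrix_vector_mult_diff_distrib inner_diff_left inner_diff_right matrix_vector_mult_scaleR
      power2_eq_square algebra_simps)

text \<open>Moving from \<open>v\<close> against the direction \<open>A v\<close> changes the form
  at first order by \<open>-2 t |A v|^2\<close>, so a zero of a nonnegative form must satisfy
  \<open>A v = 0\<close>.\<close>

lemma pos_semidefinite_null:
  fixes A :: "real ^ 'n ^ 'n"
  assumes A: "pos_semidefinite A" and v: "v \<bullet> (A *v v) = 0"
  shows "A *v v = 0"
proof (rule ccontr)
  define w where "w = A *v v"
  define a where "a = w \<bullet> w"
  define q where "q = w \<bullet> (A *v w)"
  assume "A *v v \<noteq> 0"
  then have a: "a > 0" by (simp add: a_def w_def)
  have q: "q \<ge> 0" using A by (simp add: q_def pos_semidefinite_def)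
  have "v \<bullet> (A *v w) = a"
    using A unfolding a_def w_def pos_semidefinite_def by (metis inner_symmetric_matrix)
  then have "(v - t *\<^sub>R w) \<bullet> (A *v (v - t *\<^sub>R w)) = t * (t * q - 2 * a)" for t
    using quadratic_diff[of A v t w] A v
    by (simp add: pos_semidefinite_def q_def power2_eq_square algebra_simps)
  \<comment> \<open>The choice \<open>t = a / (q + 1)\<close> gives \<open>t * q \<le> a\<close>,
    hence the value is at most \<open>- t * a\<close>; the added 1 keeps the denominator positive
    when \<open>q = 0\<close>.\<close>
  then have "0 \<le> a / (q + 1) * (a / (q + 1) * q - 2 * a)"
    using A unfolding pos_semidefinite_def by metis
  moreover have "a / (q + 1) * q \<le> a" using a q by (simp add: field_simps)
  moreover have "a / (q + 1) > 0" using a q by simp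
  ultimately show False using a by (smt (verit) mult_pos_neg)
qed

text \<open>A maximizer \<open>v\<close> of the form on the unit sphere, with maximum
  \<open>l\<close>, is a zero of the positive semidefinite form of \<open>l I - A\<close>, hence in
  the kernel of \<open>l I - A\<close>.\<close>

lemma symmetric_matrix_max_eigenvector:
  fixes A :: "real ^ 'n ^ 'n"
  assumes A: "transpose A = A"
  obtains v l where "v \<noteq> 0" "A *v v = l *\<^sub>R v" "\<And>x. x \<bullet> (A *v x) \<le> l * (x \<bullet> x)"
proof -
  let ?S = "sphere 0 1 :: (real ^ 'n) set"
  have "\<exists>v\<in>?S. \<forall>y\<in>?S. y \<bullet> (A *v y) \<le> v \<bullet> (A *v v)"
    by (rule continuous_attains_sup)
       (auto intro!: tendsto_intros tendsto_matrix_vector_mult simp: continuous_on_def)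
  then obtain v where v: "norm v = 1" and max: "\<And>y. norm y = 1 \<Longrightarrow> y \<bullet> (A *v y) \<le> v \<bullet> (A *v v)"
    by auto
  define l where "l = v \<bullet> (A *v v)"
  have bound: "x \<bullet> (A *v x) \<le> l * (x \<bullet> x)" for x
  proof (cases "x = 0")
    case False
    let ?y = "x /\<^sub>R norm x"
    have "?y \<bullet> (A *v ?y) \<le> l" unfolding l_def by (rule max) (use False in simp)
    then have "(x \<bullet> (A *v x)) / (norm x)\<^sup>2 \<le> l"
      by (simp add: matrix_vector_mult_scaleR power2_eq_square divide_inverse mult_ac)
    then show ?thesis using False by (simp add: field_simps power2_norm_eq_inner)
  qed simp
  let ?B = "l *\<^sub>R mat 1 - A"
  have B: "?B *v x = l *\<^sub>R x - A *v x" for x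
    by (simp add: matrix_vector_mult_diff_rdistrib scaleR_matrix_vector_assoc[symmetric])
  have "transpose ?B = ?B"
    using A by (simp add: vec_eq_iff transpose_def mat_def)
  then have "pos_semidefinite ?B"
    using bound by (simp add: pos_semidefinite_def B inner_diff_right)
  moreover have "v \<bullet> (?B *v v) = 0"
    unfolding B inner_diff_right using v by (simp add: l_def dot_square_norm)
  ultimately have "?B *v v = 0" by (rule pos_semidefinite_null)
  then have "A *v v = l *\<^sub>R v" using B[of v] by simp
  moreover have "v \<noteq> 0" using v by auto
  ultimately show ?thesis using that[of v l] bound by blast
qed

text \<open>Eigenvectors to distinct eigenvalues are orthogonal, hence independent. Finiteness is
  needed because \<open>lambda_max\<close> is a \<open>Max\<close>.\<close>

lemma finite_eigenvalues_symmetric: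
  fixes A :: "real ^ 'n ^ 'n"
  assumes A: "transpose A = A"
  shows "finite {l. \<exists>v. v \<noteq> 0 \<and> A *v v = l *\<^sub>R v}" (is "finite ?E")
proof -
  have "\<forall>l\<in>?E. \<exists>v. v \<noteq> 0 \<and> A *v v = l *\<^sub>R v" by blast
  then obtain e where e: "\<And>l. l \<in> ?E \<Longrightarrow> e l \<noteq> 0 \<and> A *v e l = l *\<^sub>R e l"
    by (metis (no_types, lifting))
  have orth: "e l \<bullet> e m = 0" if "l \<in> ?E" "m \<in> ?E" "l \<noteq> m" for l m
  proof -
    have "m * (e l \<bullet> e m) = l * (e l \<bullet> e m)"
      using inner_symmetric_matrix[OF A, of "e l" "e m"] e that by (simp add: inner_commute)
    then show ?thesis using that by simp
  qed
  have inj: "inj_on e ?E"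
  proof (rule inj_onI, rule ccontr)
    fix l m assume "l \<in> ?E" "m \<in> ?E" "e l = e m" "l \<noteq> m"
    then show False using orth[of l m] e[of l] by simp
  qed
  have "pairwise orthogonal (e ` ?E)"
    using orth by (auto simp: pairwise_def orthogonal_def)
  moreover have "0 \<notin> e ` ?E" using e by fastforce
  ultimately have "finite (e ` ?E)"
    by (intro independent_imp_finite pairwise_orthogonal_independent)
  then show ?thesis using inj by (rule finite_imageD)
qed

lemma quadratic_le_lambda_max:
  fixes A :: "real ^ 'n ^ 'n"
  assumes A: "transpose A = A"
  shows "x \<bullet> (A *v x) \<le> lambda_max A * (x \<bullet> x)"
proof -
  obtain v l where v: "v \<noteq> 0" "A *v v = l *\<^sub>R v" and l: "\<And>x. x \<bullet> (A *v x) \<le> l * (x \<bullet> x)"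
    using symmetric_matrix_max_eigenvector[OF A] by metis
  have "l \<le> lambda_max A"
    unfolding lambda_max_def by (rule Max_ge) (use v finite_eigenvalues_symmetric[OF A] in auto)
  then show ?thesis
    using l[of x] by (meson inner_ge_zero mult_right_mono order_trans)
qed

lemma matrix_vector_axis:
  fixes A :: "real ^ 'n ^ 'm"
  shows "(A *v axis j 1) $ i = A $ i $ j"
  by (simp add: matrix_vector_mul_component inner_axis)

lemma inner_axis_matrix:
  fixes A :: "real ^ 'n ^ 'm"
  shows "axis i 1 \<bullet> (A *v axis j 1) = A $ i $ j"
  by (simp add: inner_axis' matrix_vector_mul_component inner_axis)

lemma quadratic_sum:
  fixes A :: "real ^ 'n ^ 'n"
  shows "v \<bullet> (A *v v) = (\<Sum>i\<in>UNIV. \<Sum>j\<in>UNIV. A $ i $ j * v $ i * v $ j)"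
  by (simp add: inner_vec_def matrix_vector_mult_def sum_distrib_left mult_ac)

text \<open>Cholesky factorization, by induction on a set of indices outside of which the matrix
  vanishes; the induction step passes to a Schur complement.\<close>

lemma pos_semidefinite_Gram_on:
  fixes S :: "real ^ 'n ^ 'n"
  assumes "finite I" "pos_semidefinite S" "\<And>i j. i \<notin> I \<Longrightarrow> S $ i $ j = 0"
  shows "\<exists>a. \<forall>i j. S $ i $ j = (\<Sum>k\<in>I. a k i * a k j)"
  using assms
proof (induction I arbitrary: S rule: finite_induct)
  case empty
  then show ?case by simp
next
  case (insert k I)
  let ?e = "axis k 1 :: real ^ 'n"
  have S: "transpose S = S" "\<And>v. v \<bullet> (S *v v) \<ge> 0"
    using insert.prems by (auto simp: pos_semidefinite_def)
  have sym: "S $ i $ j = S $ j $ i" for i j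
    by (metis S(1) transpose_def vec_lambda_beta)
  define d where "d = S $ k $ k"
  have d: "d = ?e \<bullet> (S *v ?e)" by (simp add: d_def inner_axis_matrix)
  show ?case
  proof (cases "d = 0")
    case True
    \<comment> \<open>A zero pivot forces the whole column \<open>k\<close> to vanish, so
      \<open>S\<close> already vanishes outside \<open>I\<close> and the new vector can be taken to
      be zero.\<close>
    then have "S *v ?e = 0" using insert.prems d by (intro pos_semidefinite_null) auto
    then have row: "S $ i $ k = 0" for i
      using inner_axis_matrix[of i S k] by simp
    have "S $ i $ j = 0" if "i \<notin> I" for i j
      using that insert.prems(2)[of i j] row[of j] sym[of k j] by (cases "i = k") auto
    then obtain a where a: "\<And>i j. S $ i $ j = (\<Sum>k\<in>I. a k i * a k j)"
      using insert.IH[OF insert.prems(1)] by blast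
    have "S $ i $ j = (\<Sum>l\<in>insert k I. (a(k := \<lambda>_. 0)) l i * (a(k := \<lambda>_. 0)) l j)" for i j
      unfolding a using insert.hyps by (auto intro!: sum.cong)
    then show ?thesis by blast
  next
    case False
    then have pos: "d > 0" using S(2)[of ?e] d by simp
    define S' where "S' = (\<chi> i j. S $ i $ j - S $ i $ k * S $ j $ k / d)"
    have quad: "v \<bullet> (S' *v v) = v \<bullet> (S *v v) - (v \<bullet> (S *v ?e))\<^sup>2 / d" for v
    proof -
      have "v \<bullet> (S *v ?e) = (\<Sum>i\<in>UNIV. S $ i $ k * v $ i)"
        by (simp add: inner_vec_def matrix_vector_axis mult.commute)
      then have sq: "(v \<bullet> (S *v ?e))\<^sup>2 / d
          = (\<Sum>i\<in>UNIV. \<Sum>j\<in>UNIV. S $ i $ k * S $ j $ k / d * v $ i * v $ j)"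
        by (simp add: power2_eq_square sum_product sum_divide_distrib mult_ac)
      show ?thesis
        unfolding sq quadratic_sum by (simp add: S'_def left_diff_distrib sum_subtractf)
    qed
    have "0 \<le> v \<bullet> (S *v v) - (v \<bullet> (S *v ?e))\<^sup>2 / d" for v
    proof -
      let ?s = "v \<bullet> (S *v ?e)"
      \<comment> \<open>The multiple \<open>?s / d\<close> of \<open>?e\<close> minimizes the form
        along that direction; the minimum is the form of the Schur complement at
        \<open>v\<close>.\<close>
      have "0 \<le> v \<bullet> (S *v v) - 2 * (?s / d) * ?s + (?s / d)\<^sup>2 * d"
        using S(2)[of "v - (?s / d) *\<^sub>R ?e"] unfolding quadratic_diff[OF S(1)] d .
      also have "\<dots> = v \<bullet> (S *v v) - ?s\<^sup>2 / d"
        using pos by (simp add: field_simps power2_eq_square)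
      finally show ?thesis .
    qed
    then have "pos_semidefinite S'"
      by (simp add: pos_semidefinite_def quad) (simp add: S'_def vec_eq_iff transpose_def sym mult.commute)
    moreover have "S' $ i $ j = 0" if "i \<notin> I" for i j
      using that insert.prems(2)[of i] sym[of k j] pos by (cases "i = k") (auto simp: S'_def d_def)
    ultimately obtain a where a: "\<And>i j. S' $ i $ j = (\<Sum>k\<in>I. a k i * a k j)"
      using insert.IH[of S'] by blast
    let ?a = "a(k := \<lambda>i. S $ i $ k / sqrt d)"
    have "S $ i $ j = (\<Sum>l\<in>insert k I. ?a l i * ?a l j)" for i j
    proof -
      have "(\<Sum>l\<in>I. ?a l i * ?a l j) = (\<Sum>l\<in>I. a l i * a l j)"
        using insert.hyps by (intro sum.cong) auto
      then show ?thesis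
        using insert.hyps a[of i j] pos by (simp add: S'_def)
    qed
    then show ?thesis by blast
  qed
qed

text \<open>Supplies the witness for the choice operator in \<open>mv_normal\<close>.\<close>

lemma pos_semidefinite_factor:
  fixes S :: "real ^ 'n ^ 'n"
  assumes "pos_semidefinite S"
  obtains A :: "real ^ 'n ^ 'n" where "A ** transpose A = S"
proof -
  have "\<exists>a. \<forall>i j. S $ i $ j = (\<Sum>k\<in>(UNIV :: 'n set). a k i * a k j)"
    by (rule pos_semidefinite_Gram_on) (use assms in auto)
  then obtain a where "\<And>i j. S $ i $ j = (\<Sum>k\<in>(UNIV :: 'n set). a k i * a k j)" by blast
  then have "(\<chi> i k. a k i) ** transpose (\<chi> i k. a k i) = S"
    by (simp add: vec_eq_iff matrix_matrix_mult_def transpose_def)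
  then show ?thesis by (rule that)
qed

section \<open>Inverse matrices and their continuity\<close>

lemma matrix_inv_mult:
  fixes A :: "real ^ 'n ^ 'n"
  assumes "det A \<noteq> 0"
  shows "A ** matrix_inv A = mat 1" "matrix_inv A ** A = mat 1"
proof -
  have "\<exists>B. A ** B = mat 1 \<and> B ** A = mat 1"
    using assms by (simp add: invertible_det_nz[symmetric] invertible_def)
  then have "A ** matrix_inv A = mat 1 \<and> matrix_inv A ** A = mat 1"
    unfolding matrix_inv_def by (rule someI_ex)
  then show "A ** matrix_inv A = mat 1" "matrix_inv A ** A = mat 1" by auto
qed

lemma matrix_inv_vector:
  fixes A :: "real ^ 'n ^ 'n"
  assumes "det A \<noteq> 0"
  shows "A *v (matrix_inv A *v x) = x" "matrix_inv A *v (A *v x) = x"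
  using matrix_inv_mult[OF assms] by (simp_all add: matrix_vector_mul_assoc)

lemma tendsto_det:
  fixes A :: "real ^ 'n ^ 'n"
  assumes "(f \<longlongrightarrow> A) F"
  shows "((\<lambda>x. det (f x)) \<longlongrightarrow> det A) F"
  unfolding det_def by (intro tendsto_intros assms)

lemma tendsto_matrix_mult:
  fixes A :: "real ^ 'n ^ 'm" and B :: "real ^ 'k ^ 'n"
  assumes "(f \<longlongrightarrow> A) F" "(b \<longlongrightarrow> B) F"
  shows "((\<lambda>x. f x ** b x) \<longlongrightarrow> A ** B) F"
  unfolding matrix_matrix_mult_def by (intro tendsto_intros assms)

lemma tendsto_transpose:
  fixes A :: "real ^ 'n ^ 'm"
  assumes "(f \<longlongrightarrow> A) F"
  shows "((\<lambda>x. transpose (f x)) \<longlongrightarrow> transpose A) F"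
  unfolding transpose_def by (intro tendsto_intros assms)

text \<open>By Cramer's rule every entry of the inverse is a quotient of two determinants, and
  determinants are continuous.\<close>

lemma tendsto_matrix_inv:
  fixes A :: "real ^ 'n ^ 'n"
  assumes f: "(f \<longlongrightarrow> A) F" and A: "det A \<noteq> 0"
  shows "((\<lambda>x. matrix_inv (f x)) \<longlongrightarrow> matrix_inv A) F"
proof -
  \<comment> \<open>Numerator in Cramer's rule: column \<open>k\<close> of \<open>B\<close> is
    replaced by the unit vector number \<open>j\<close>.\<close>
  let ?N = "\<lambda>B j k. det (\<chi> i l. if l = k then (axis j 1 :: real ^ 'n) $ i else B $ i $ l)"
  have cr: "matrix_inv B $ k $ j = ?N B j k / det B" if "det B \<noteq> 0" for B :: "real ^ 'n ^ 'n" and j k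
  proof -
    have "matrix_inv B *v axis j 1 = (\<chi> k. ?N B j k / det B)"
      using cramer[OF that] matrix_inv_vector(1)[OF that] by blast
    then show ?thesis
      using matrix_vector_axis[of "matrix_inv B" j k] by simp
  qed
  have ev: "\<forall>\<^sub>F x in F. det (f x) \<noteq> 0"
    by (rule tendsto_imp_eventually_ne[OF tendsto_det[OF f] A])
  show ?thesis
  proof (intro vec_tendstoI)
    fix k j
    have "((\<lambda>x. (\<chi> i l. if l = k then (axis j 1 :: real ^ 'n) $ i else f x $ i $ l)) \<longlongrightarrow>
        (\<chi> i l. if l = k then (axis j 1 :: real ^ 'n) $ i else A $ i $ l)) F"
      by (intro tendsto_vec_lambda) (auto intro!: tendsto_intros f)
    then have "((\<lambda>x. ?N (f x) j k / det (f x)) \<longlongrightarrow> ?N A j k / det A) F"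
      by (intro tendsto_divide tendsto_det f A)
    then show "((\<lambda>x. matrix_inv (f x) $ k $ j) \<longlongrightarrow> matrix_inv A $ k $ j) F"
      unfolding cr[OF A] by (rule tendsto_cong[THEN iffD1, rotated]) (use ev in eventually_elim, simp add: cr)
  qed
qed

lemma pos_definite_imp_det_nz:
  fixes A :: "real ^ 'n ^ 'n"
  assumes "pos_definite A"
  shows "det A \<noteq> 0"
proof
  assume "det A = 0"
  then obtain v where "v \<noteq> 0" "A *v v = 0"
    by (metis invertible_det_nz matrix_left_invertible_ker invertible_left_inverse)
  then show False using assms by (metis inner_zero_right order_less_irrefl pos_definite_def)
qed

section \<open>The map \<open>g\<close> and its derivative\<close>

lemma linear_Sigma_of: "linear Sigma_of"
  by (rule linearI) (simp_all add: Sigma_of_def vec_eq_iff)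

lemma linear_Gamma_of: "linear Gamma_of"
  by (rule linearI) (simp_all add: Gamma_of_def vec_eq_iff)

lemma Sigma_of_diff: "Sigma_of (x - y) = Sigma_of x - Sigma_of y"
  by (rule linear_diff[OF linear_Sigma_of])

lemma Gamma_of_diff: "Gamma_of (x - y) = Gamma_of x - Gamma_of y"
  by (rule linear_diff[OF linear_Gamma_of])

lemma tendsto_Sigma_of: "(f \<longlongrightarrow> x) F \<Longrightarrow> ((\<lambda>z. Sigma_of (f z)) \<longlongrightarrow> Sigma_of x) F"
  unfolding Sigma_of_def by (intro tendsto_intros)

lemma tendsto_Gamma_of: "(f \<longlongrightarrow> x) F \<Longrightarrow> ((\<lambda>z. Gamma_of (f z)) \<longlongrightarrow> Gamma_of x) F"
  unfolding Gamma_of_def by (intro tendsto_intros)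

lemma open_domD: "open (domD :: ('m::{finite,linorder}) stacked set)"
proof -
  have "continuous_on UNIV (\<lambda>x :: 'm stacked. det (Sigma_of x))"
    unfolding continuous_on_def by (auto intro!: tendsto_det tendsto_Sigma_of tendsto_intros)
  then have "open ((\<lambda>x :: 'm stacked. det (Sigma_of x)) -` {0<..})"
    by (intro open_vimage) auto
  then show ?thesis by (simp add: domD_def vimage_def)
qed

text \<open>For \<open>b\<close> equal to the coefficient vector this is the map \<open>L\<close> of
  the overview. It measures by how much \<open>b\<close> fails the normal equations encoded in
  \<open>x\<close>, and it is linear in \<open>x\<close>.\<close>

definition normal_eq_defect :: "real ^ ('m::{finite,linorder}) \<Rightarrow> 'm stacked \<Rightarrow> real ^ ('m::{finite,linorder})" where
  "normal_eq_defect b x = Gamma_of x - Sigma_of x *v b"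

lemma linear_normal_eq_defect: "linear (normal_eq_defect b)"
  unfolding normal_eq_defect_def
  by (rule linearI)
     (simp_all add: linear_add[OF linear_Sigma_of] linear_add[OF linear_Gamma_of]
       linear_scale[OF linear_Sigma_of] linear_scale[OF linear_Gamma_of]
       matrix_vector_mult_add_rdistrib scaleR_matrix_vector_assoc[symmetric] scaleR_diff_right)

text \<open>Since \<open>g x\<close> solves the normal equations of \<open>x\<close>, its defect at
  \<open>y - x\<close> equals its defect at \<open>y\<close>; solving with \<open>Sigma_of y\<close>
  gives the difference without remainder.\<close>

lemma g_diff:
  assumes "det (Sigma_of x) \<noteq> 0" "det (Sigma_of y) \<noteq> 0"
  shows "g y - g x = matrix_inv (Sigma_of y) *v normal_eq_defect (g x) (y - x)"
proof -
  have "Sigma_of x *v g x = Gamma_of x" unfolding g_def using assms by (simp add: matrix_inv_vector)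
  then have "normal_eq_defect (g x) (y - x) = Gamma_of y - Sigma_of y *v g x"
    by (simp add: normal_eq_defect_def Sigma_of_diff Gamma_of_diff matrix_vector_mult_diff_rdistrib)
  then show ?thesis
    using assms by (simp add: matrix_vector_mult_diff_distrib matrix_inv_vector g_def[of y])
qed

lemma isCont_g:
  assumes "x \<in> domD"
  shows "isCont g x"
  unfolding isCont_def g_def
  by (intro tendsto_matrix_vector_mult tendsto_matrix_inv tendsto_Sigma_of tendsto_Gamma_of tendsto_ident_at)
     (use assms in \<open>simp add: domD_def\<close>)

text \<open>By \<open>g_diff\<close> the error of the linear approximation is
  \<open>(?I y - ?I x) *v ?L (y - x)\<close>: a factor vanishing by continuity of the inverse times
  a factor of order \<open>norm (y - x)\<close>.\<close>

lemma has_derivative_g: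
  fixes x :: "('m::{finite,linorder}) stacked"
  assumes x: "x \<in> domD"
  shows "(g has_derivative (\<lambda>d. matrix_inv (Sigma_of x) *v normal_eq_defect (g x) d)) (at x)"
proof -
  let ?L = "normal_eq_defect (g x)" and ?I = "\<lambda>y. matrix_inv (Sigma_of y)"
  interpret mv: bounded_bilinear "\<lambda>(A :: real ^ ('m::{finite,linorder}) ^ ('m::{finite,linorder})) (x :: real ^ ('m::{finite,linorder})). A *v x"
    by (rule bounded_bilinear_matrix_vector_mult)
  have bl: "bounded_linear ?L" using linear_normal_eq_defect linear_conv_bounded_linear by blast
  then obtain C where C: "\<And>d. norm (?L d) \<le> norm d * C" "C > 0"
    using bounded_linear.pos_bounded by blast
  obtain K where K: "\<And>(A :: real ^ ('m::{finite,linorder}) ^ ('m::{finite,linorder})) b. norm (A *v b) \<le> norm A * norm b * K" "K > 0"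
    using mv.pos_bounded by blast
  have "((\<lambda>y. norm (?I y - ?I x) * (C * K)) \<longlongrightarrow> norm (?I x - ?I x) * (C * K)) (at x)"
    by (intro tendsto_intros tendsto_matrix_inv tendsto_Sigma_of) (use x in \<open>simp add: domD_def\<close>)
  then have lim: "((\<lambda>y. norm (?I y - ?I x) * (C * K)) \<longlongrightarrow> 0) (at x)" by simp
  have ev: "\<forall>\<^sub>F y in at x. y \<in> domD"
    by (rule topological_tendstoD[OF tendsto_ident_at open_domD x])
  have bound: "norm (g y - g x - ?I x *v ?L (y - x)) / norm (y - x) \<le> norm (?I y - ?I x) * (C * K)"
    if "y \<in> domD" for y
  proof -
    have "g y - g x - ?I x *v ?L (y - x) = (?I y - ?I x) *v ?L (y - x)"
      using g_diff[of x y] that x by (simp add: domD_def mv.diff_left)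
    also have "norm \<dots> \<le> norm (?I y - ?I x) * norm (?L (y - x)) * K" by (rule K)
    also have "\<dots> \<le> norm (?I y - ?I x) * (norm (y - x) * C) * K"
      using K(2) by (intro mult_right_mono mult_left_mono C) auto
    finally show ?thesis
      by (cases "y = x") (use C(2) K(2) in \<open>auto simp: field_simps\<close>)
  qed
  have "((\<lambda>y. norm (g y - g x - ?I x *v ?L (y - x)) / norm (y - x)) \<longlongrightarrow> 0) (at x)"
    by (rule Lim_null_comparison[OF _ lim]) (use ev in eventually_elim, use bound in simp)
  then show ?thesis
    using bounded_linear_compose[OF mv.bounded_linear_right bl]
    by (simp add: has_derivative_iff_norm)
qed

lemma grad_g_mult:
  assumes "x \<in> domD"
  shows "grad_g x *v d = matrix_inv (Sigma_of x) *v normal_eq_defect (g x) d"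
proof -
  have "g differentiable (at x)"
    using has_derivative_g[OF assms] differentiable_def by blast
  then have "(g has_derivative (\<lambda>d. grad_g x *v d)) (at x)"
    unfolding grad_g_def by (simp add: jacobian_works)
  from has_derivative_unique[OF this has_derivative_g[OF assms]] show ?thesis by metis
qed

text \<open>Entries are read off from the action on unit vectors, where the explicit formula of
  \<open>grad_g_mult\<close> holds throughout the open set \<open>domD\<close> and is visibly
  continuous.\<close>

lemma isCont_grad_g:
  assumes x: "x \<in> domD"
  shows "isCont grad_g x"
  unfolding isCont_def
proof (intro vec_tendstoI)
  fix i k
  have "((\<lambda>y. matrix_inv (Sigma_of y) *v normal_eq_defect (g y) (axis k 1)) \<longlongrightarrow>
      matrix_inv (Sigma_of x) *v normal_eq_defect (g x) (axis k 1)) (at x)"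
    unfolding normal_eq_defect_def
    by (intro tendsto_intros tendsto_matrix_vector_mult tendsto_matrix_inv tendsto_Sigma_of
        isCont_g[OF x, unfolded isCont_def])
       (use x in \<open>simp add: domD_def\<close>)
  moreover have "\<forall>\<^sub>F y in at x. y \<in> domD"
    by (rule topological_tendstoD[OF tendsto_ident_at open_domD x])
  then have "\<forall>\<^sub>F y in at x. matrix_inv (Sigma_of y) *v normal_eq_defect (g y) (axis k 1) = grad_g y *v axis k 1"
    by eventually_elim (simp add: grad_g_mult)
  ultimately have "((\<lambda>y. grad_g y *v axis k 1) \<longlongrightarrow> grad_g x *v axis k 1) (at x)"
    unfolding grad_g_mult[OF x] by (rule Lim_transform_eventually)
  then have "((\<lambda>y. (grad_g y *v axis k 1) $ i) \<longlongrightarrow> (grad_g x *v axis k 1) $ i) (at x)"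
    by (rule tendsto_vec_nth)
  then show "((\<lambda>y. grad_g y $ i $ k) \<longlongrightarrow> grad_g x $ i $ k) (at x)"
    by (simp add: matrix_vector_axis)
qed

lemma tendsto_sandwich_matrix:
  assumes "x \<in> domD" "(a \<longlongrightarrow> x) F" "(S \<longlongrightarrow> S0) F"
  shows "((\<lambda>n. sandwich (a n) (S n)) \<longlongrightarrow> sandwich x S0) F"
  unfolding sandwich_def
  by (intro tendsto_matrix_mult tendsto_transpose assms isCont_tendsto_compose[OF isCont_grad_g])

lemma quadratic_sandwich:
  "v \<bullet> (sandwich x S *v v) = (transpose (grad_g x) *v v) \<bullet> (S *v (transpose (grad_g x) *v v))"
  unfolding sandwich_def
  by (simp add: matrix_vector_mul_assoc[symmetric] dot_lmul_matrix)

lemma transpose_sandwich: "transpose S = S \<Longrightarrow> transpose (sandwich x S) = sandwich x S"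
  by (simp add: sandwich_def matrix_transpose_mul matrix_mul_assoc)

section \<open>The pointwise ergodic theorem\<close>

text \<open>The maximum of the first \<open>n + 1\<close> nonempty partial sums of \<open>f\<close>
  along the orbit of \<open>x\<close>. The recursive form makes the comparison between
  \<open>x\<close> and \<open>T x\<close> immediate.\<close>

primrec maxsum :: "('a \<Rightarrow> 'a) \<Rightarrow> ('a \<Rightarrow> real) \<Rightarrow> nat \<Rightarrow> 'a \<Rightarrow> real" where
  "maxsum T f 0 x = f x"
| "maxsum T f (Suc n) x = f x + max 0 (maxsum T f n (T x))"

lemma sum_iterates_Suc:
  "(\<Sum>i<Suc n. f ((T ^^ i) x)) = f x + (\<Sum>i<n. f ((T ^^ i) (T x)))" for f :: "'a \<Rightarrow> real"
  by (subst sum.lessThan_Suc_shift) (simp add: funpow_swap1)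

lemma sum_le_maxsum: "k \<le> n \<Longrightarrow> (\<Sum>i<Suc k. f ((T ^^ i) x)) \<le> maxsum T f n x"
proof (induction n arbitrary: k x)
  case (Suc n)
  show ?case
  proof (cases k)
    case (Suc l)
    then show ?thesis
      using Suc.IH[of l "T x"] Suc.prems by (subst sum_iterates_Suc) (simp add: Suc)
  qed simp
qed simp

lemma maxsum_Suc_mono: "maxsum T f n x \<le> maxsum T f (Suc n) x"
proof (induction n arbitrary: x)
  case (Suc n)
  show ?case using Suc.IH[of "T x"] by (simp add: max_def split: if_splits) 
qed simp

lemma maxsum_mono: "m \<le> n \<Longrightarrow> maxsum T f m x \<le> maxsum T f n x"
  by (rule lift_Suc_mono_le[of "\<lambda>n. maxsum T f n x", OF maxsum_Suc_mono])

locale ergodic_map = prob_space N for N :: "'a measure" +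
  fixes T :: "'a \<Rightarrow> 'a"
  assumes T_meas [measurable]: "T \<in> measurable N N"
    and T_preserves: "distr N N T = N"
    and T_ergodic: "\<And>A. A \<in> sets N \<Longrightarrow> T -` A \<inter> space N = A \<Longrightarrow> prob A \<in> {0, 1}"
begin

lemma integrable_comp: "integrable N f \<Longrightarrow> integrable N (\<lambda>x. f (T x))" for f :: "'a \<Rightarrow> real"
  using T_preserves integrable_distr[OF T_meas, of f] by simp

lemma integral_comp:
  fixes f :: "'a \<Rightarrow> real"
  assumes [measurable]: "f \<in> borel_measurable N"
  shows "(LINT x|N. f (T x)) = (LINT x|N. f x)"
  using integral_distr[OF T_meas, of f] T_preserves by simp

lemma maxsum_integrable: "integrable N f \<Longrightarrow> integrable N (maxsum T f n)"
proof (induction n)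
  case 0
  then show ?case by (simp add: fun_eq_iff[symmetric])
next
  case (Suc n)
  then show ?case
    using integrable_comp[OF Suc.IH]
    by (subst maxsum.simps(2)[abs_def]) (auto intro!: Bochner_Integration.integrable_add integrable_max)
qed

text \<open>On the invariant set \<open>A\<close> where the maximal sums are unbounded, the difference
  \<open>G (n + 1) - G n \<circ> T\<close> of maximal sums \<open>G\<close> converges to \<open>f\<close>, while its integral over \<open>A\<close> is nonnegative
  because \<open>G n\<close> increases with \<open>n\<close>.\<close>

lemma AE_maxsum_bounded:
  assumes f: "integrable N f" and neg: "(LINT x|N. f x) < 0"
  shows "AE x in N. \<exists>c. \<forall>n. maxsum T f n x \<le> c"
proof -
  note [measurable] = borel_measurable_integrable[OF f] borel_measurable_integrable[OF maxsum_integrable[OF f]]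
  let ?G = "maxsum T f"
  define A where "A = {x \<in> space N. \<forall>k::nat. \<exists>n. ?G n x > real k}"
  have A[measurable]: "A \<in> sets N" unfolding A_def by measurable
  have T_space: "x \<in> space N \<Longrightarrow> T x \<in> space N" for x using measurable_space[OF T_meas] .
  \<comment> \<open>\<open>T_ergodic\<close> asks for exact invariance. Maximal sums at
    \<open>x\<close> and at \<open>T x\<close> differ by the finite amount \<open>f x\<close> once
    they are positive, so they are unbounded simultaneously.\<close>
  have inv: "T x \<in> A \<longleftrightarrow> x \<in> A" if "x \<in> space N" for x
  proof
    assume "T x \<in> A"
    have "\<exists>n. ?G n x > real k" for k
    proof -
      obtain n where "?G n (T x) > real (nat \<lceil>real k - f x\<rceil>)" using \<open>T x \<in> A\<close> A_def by blast
      then have "?G (Suc n) x > real k" by simp linarith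
      then show ?thesis ..
    qed
    then show "x \<in> A" using that by (auto simp: A_def)
  next
    assume "x \<in> A"
    have "\<exists>n. ?G n (T x) > real k" for k
    proof -
      obtain n where n: "?G n x > real (nat \<lceil>real k + \<bar>f x\<bar>\<rceil>)" using \<open>x \<in> A\<close> A_def by blast
      also have "?G n x \<le> ?G (Suc n) x" by (rule maxsum_Suc_mono)
      finally have "?G n (T x) > real k" by (simp add: max_def split: if_splits) linarith+
      then show ?thesis ..
    qed
    then show "T x \<in> A" using T_space[OF that] by (auto simp: A_def)
  qed
  have "prob A \<in> {0, 1}"
    using A inv by (intro T_ergodic) (auto simp: A_def)
  moreover have "prob A \<noteq> 1"
  proof
    assume "prob A = 1"
    then have AE: "AE x in N. x \<in> A" using A prob_eq_1 by simp
    \<comment> \<open>The first two terms form \<open>?G (Suc n) x\<close>; since \<open>T\<close>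
      preserves the measure, the integral is that of \<open>?G (Suc n) - ?G n\<close>.\<close>
    have nonneg: "0 \<le> (LINT x|N. f x + max 0 (?G n (T x)) - ?G n (T x))" for n
    proof -
      have "(LINT x|N. ?G n (T x)) = (LINT x|N. ?G n x)" by (rule integral_comp) simp
      moreover have "(LINT x|N. ?G n x) \<le> (LINT x|N. ?G (Suc n) x)"
        by (intro integral_mono maxsum_integrable f maxsum_Suc_mono)
      moreover have "(LINT x|N. ?G (Suc n) x - ?G n (T x)) = (LINT x|N. ?G (Suc n) x) - (LINT x|N. ?G n (T x))"
        by (intro Bochner_Integration.integral_diff maxsum_integrable integrable_comp f)
      ultimately show ?thesis by simp
    qed
    have "(\<lambda>n. LINT x|N. f x + max 0 (?G n (T x)) - ?G n (T x)) \<longlonglongrightarrow> (LINT x|N. f x)"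
    proof (rule integral_dominated_convergence)
      \<comment> \<open>The integrand is \<open>f x + max 0 (- ?G n (T x))\<close>, and
        \<open>?G n (T x)\<close> is bounded below by \<open>f (T x)\<close>, uniformly in
        \<open>n\<close>.\<close>
      show "integrable N (\<lambda>x. \<bar>f x\<bar> + \<bar>f (T x)\<bar>)"
        using f integrable_comp[OF f] by auto
      show "AE x in N. (\<lambda>n. f x + max 0 (?G n (T x)) - ?G n (T x)) \<longlonglongrightarrow> f x"
        using AE AE_space
      proof eventually_elim
        case (elim x)
        then have "T x \<in> A" using inv by simp
        then obtain n0 where "?G n0 (T x) > real 0" unfolding A_def by blast
        then have "\<forall>n\<ge>n0. f x + max 0 (?G n (T x)) - ?G n (T x) = f x"
          using maxsum_mono[of n0 _ T f "T x"] by (fastforce simp: max_def)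
        then show ?case by (intro tendsto_eventually) (auto simp: eventually_sequentially)
      qed
      show "AE x in N. norm (f x + max 0 (?G n (T x)) - ?G n (T x)) \<le> \<bar>f x\<bar> + \<bar>f (T x)\<bar>" for n
      proof (rule AE_I2)
        fix x
        have "?G n (T x) \<ge> f (T x)" using maxsum_mono[of 0 n T f "T x"] by simp
        then show "norm (f x + max 0 (?G n (T x)) - ?G n (T x)) \<le> \<bar>f x\<bar> + \<bar>f (T x)\<bar>"
          by (auto simp: max_def)
      qed
    qed simp_all
    then have "0 \<le> (LINT x|N. f x)" by (rule LIMSEQ_le_const) (use nonneg in auto)
    with neg show False by simp
  qed
  ultimately have "prob A = 0" by auto
  then have "AE x in N. x \<notin> A" by (simp add: A AE_iff_measurable[OF _ refl] prob_eq_0)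
  then show ?thesis
    using AE_space by eventually_elim (auto simp: A_def not_less)
qed

text \<open>Subtracting the mean plus \<open>e / 2\<close> makes the integral negative, so the
  partial sums of the shifted function are bounded above almost everywhere; dividing by
  \<open>n\<close> absorbs the bound into the other \<open>e / 2\<close>.\<close>

lemma AE_average_eventually_le:
  assumes f: "integrable N f" and e: "e > 0"
  shows "AE x in N. \<forall>\<^sub>F n in sequentially. (\<Sum>i<n. f ((T ^^ i) x)) / n \<le> (LINT x|N. f x) + e"
proof -
  let ?m = "LINT x|N. f x"
  let ?f = "\<lambda>x. f x - (?m + e / 2)"
  have "AE x in N. \<exists>c. \<forall>n. maxsum T ?f n x \<le> c"
    by (rule AE_maxsum_bounded) (use f e prob_space in auto)
  then show ?thesis
  proof eventually_elim
    case (elim x)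
    then obtain c where c: "\<And>n. maxsum T ?f n x \<le> c" by blast
    have "\<forall>\<^sub>F n in sequentially. c / real n < e / 2"
      by (rule order_tendstoD(2)[OF lim_const_over_n]) (use e in simp)
    with eventually_gt_at_top[of 0] show ?case
    proof eventually_elim
      case (elim n)
      then obtain k where k: "n = Suc k" by (cases n) auto
      have "(\<Sum>i<n. f ((T ^^ i) x)) - n * (?m + e / 2) \<le> c"
        using sum_le_maxsum[of k k ?f T x] c[of k] unfolding k sum_subtractf by simp
      then show ?case using elim by (simp add: field_simps)
    qed
  qed
qed

text \<open>The upper bound for \<open>f\<close> and for \<open>- f\<close>, along the countably
  many tolerances \<open>1 / Suc k\<close>, gives one null set for all of them.\<close>

theorem birkhoff:
  assumes f: "integrable N f"
  shows "AE x in N. (\<lambda>n. (\<Sum>i<n. f ((T ^^ i) x)) / n) \<longlonglongrightarrow> (LINT x|N. f x)"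
proof -
  let ?m = "LINT x|N. f x"
  have "AE x in N. \<forall>k::nat. (\<forall>\<^sub>F n in sequentially. (\<Sum>i<n. f ((T ^^ i) x)) / n \<le> ?m + 1 / Suc k)
      \<and> (\<forall>\<^sub>F n in sequentially. (\<Sum>i<n. - f ((T ^^ i) x)) / n \<le> - ?m + 1 / Suc k)"
    using AE_average_eventually_le[OF f] AE_average_eventually_le[of "\<lambda>x. - f x"] f
    by (auto simp: AE_all_countable)
  then show ?thesis
  proof eventually_elim
    case (elim x)
    show ?case
    proof (rule tendstoI)
      fix e :: real assume "e > 0"
      then obtain k :: nat where k: "1 / Suc k < e"
        by (metis nat_approx_posE)
      from elim have "\<forall>\<^sub>F n in sequentially. (\<Sum>i<n. f ((T ^^ i) x)) / n \<le> ?m + 1 / Suc k"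
        "\<forall>\<^sub>F n in sequentially. (\<Sum>i<n. - f ((T ^^ i) x)) / n \<le> - ?m + 1 / Suc k" by blast+
      then show "\<forall>\<^sub>F n in sequentially. dist ((\<Sum>i<n. f ((T ^^ i) x)) / n) ?m < e"
      proof eventually_elim
        case (elim n)
        then show ?case using k by (simp add: dist_real_def sum_negf)
      qed
    qed
  qed
qed

end

text \<open>On path space with the law of the process the shift is an ergodic map, and the
  observations are the values of the first coordinate along its orbit; the almost sure statement is
  then pulled back.\<close>

lemma ergodic_average:
  fixes Z :: "nat \<Rightarrow> 'w \<Rightarrow> 'a" and \<psi> :: "'a \<Rightarrow> real"
  assumes "prob_space M" and st: "stationary M N Z" and er: "ergodic M N Z"
    and [measurable]: "\<psi> \<in> borel_measurable N" and int: "integrable M (\<lambda>w. \<psi> (Z 0 w))"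
  shows "AE w in M. (\<lambda>n. (\<Sum>i<n. \<psi> (Z i w)) / n) \<longlonglongrightarrow> (LINT w|M. \<psi> (Z 0 w))"
proof -
  interpret prob_space M by fact
  let ?P = "PiM UNIV (\<lambda>_::nat. N)" and ?Z = "\<lambda>w i. Z i w"
  let ?T = "\<lambda>z i. z (Suc i) :: 'a"
  let ?D = "distr M ?P ?Z"
  have Z[measurable]: "Z i \<in> measurable M N" for i using st by (simp add: stationary_def)
  have Zm[measurable]: "?Z \<in> measurable M ?P"
    by (rule measurable_PiM_single') (auto simp: space_PiM PiE_iff measurable_space[OF Z])
  have T[measurable]: "?T \<in> measurable ?P ?P"
    by (rule measurable_PiM_single') (auto simp: space_PiM PiE_iff intro!: measurable_component_singleton)
  interpret D: ergodic_map ?D ?T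
  proof -
    interpret D: prob_space ?D by (rule prob_space_distr) measurable
    show "ergodic_map ?D ?T"
    proof
      show "?T \<in> measurable ?D ?D" by simp
      have "distr ?D ?D ?T = distr ?D ?P ?T" by (rule distr_cong) auto
      also have "\<dots> = distr M ?P (\<lambda>w i. Z (Suc i) w)"
        by (subst distr_distr) (auto simp: comp_def)
      finally show "distr ?D ?D ?T = ?D" using st by (simp add: stationary_def)
      show "measure ?D A \<in> {0, 1}" if "A \<in> sets ?D" "?T -` A \<inter> space ?D = A" for A
        using er that unfolding ergodic_def by simp
    qed
  qed
  have pow: "(?T ^^ i) z = (\<lambda>k. z (k + i))" for i z by (induction i) auto
  have int': "integrable ?D (\<lambda>z. \<psi> (z 0))"
    using int by (subst integrable_distr_eq) auto
  have "AE z in ?D. (\<lambda>n. (\<Sum>i<n. \<psi> ((?T ^^ i) z 0)) / n) \<longlonglongrightarrow> (LINT z|?D. \<psi> (z 0))"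
    by (rule D.birkhoff[OF int'])
  then have "AE z in ?D. (\<lambda>n. (\<Sum>i<n. \<psi> (z i)) / n) \<longlonglongrightarrow> (LINT z|?D. \<psi> (z 0))"
    by (simp add: pow)
  then have "AE w in M. (\<lambda>n. (\<Sum>i<n. \<psi> (Z i w)) / n) \<longlonglongrightarrow> (LINT z|?D. \<psi> (z 0))"
    by (rule AE_distrD[OF Zm])
  moreover have "(LINT z|?D. \<psi> (z 0)) = (LINT w|M. \<psi> (Z 0 w))"
    by (subst integral_distr) auto
  ultimately show ?thesis by simp
qed

lemma stationary_distr:
  assumes st: "stationary M N Z"
  shows "distr M N (Z i) = distr M N (Z 0)"
proof -
  let ?P = "PiM UNIV (\<lambda>_::nat. N)"
  have Z[measurable]: "Z i \<in> measurable M N" for i using st by (simp add: stationary_def)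
  have Zm[measurable]: "(\<lambda>w i. Z (i + k) w) \<in> measurable M ?P" for k
    by (rule measurable_PiM_single') (auto simp: space_PiM PiE_iff measurable_space[OF Z])
  have "distr M N (Z (Suc i)) = distr M N (Z i)" for i
  proof -
    have "distr (distr M ?P (\<lambda>w k. Z (k + 1) w)) N (\<lambda>z. z i) = distr (distr M ?P (\<lambda>w k. Z (k + 0) w)) N (\<lambda>z. z i)"
      using st by (simp add: stationary_def)
    then show ?thesis using Zm[of 0] Zm[of 1] by (simp add: distr_distr comp_def)
  qed
  then show ?thesis by (induction i) auto
qed

section \<open>Weak convergence of random vectors\<close>

text \<open>The phase \<open>b\<close> lets one constructor cover sines, cosines and constants.
  Integrals of these functions are determined by the characteristic function.\<close>

inductive trig_poly :: "('a::real_inner \<Rightarrow> real) \<Rightarrow> bool" where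
  cos: "trig_poly (\<lambda>x. c * cos (a \<bullet> x + b))"
| add: "trig_poly f \<Longrightarrow> trig_poly f' \<Longrightarrow> trig_poly (\<lambda>x. f x + f' x)"

lemma trig_poly_const: "trig_poly (\<lambda>x. c)"
  using trig_poly.cos[of c 0 0] by simp

lemma trig_poly_sin: "trig_poly (\<lambda>x. c * sin (a \<bullet> x))"
  using trig_poly.cos[of c a "- pi / 2"] by (simp add: cos_diff)

lemma trig_poly_sum: "finite I \<Longrightarrow> (\<And>i. i \<in> I \<Longrightarrow> trig_poly (f i)) \<Longrightarrow> trig_poly (\<lambda>x. \<Sum>i\<in>I. f i x)"
  by (induction I rule: finite_induct) (auto intro: trig_poly_const trig_poly.add)

text \<open>The product-to-sum formula for cosines, extended by distributivity; it makes the
  trigonometric polynomials an algebra.\<close>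

lemma trig_poly_mult: "trig_poly f \<Longrightarrow> trig_poly f' \<Longrightarrow> trig_poly (\<lambda>x. f x * f' x)"
proof (induction f arbitrary: f' rule: trig_poly.induct)
  case (cos c a b)
  from cos show ?case
  proof (induction f' rule: trig_poly.induct)
    case (cos c' a' b')
    have eq: "(c * cos (a \<bullet> x + b)) * (c' * cos (a' \<bullet> x + b'))
        = c * c' / 2 * cos ((a - a') \<bullet> x + (b - b')) + c * c' / 2 * cos ((a + a') \<bullet> x + (b + b'))" for x
    proof -
      have "cos (a \<bullet> x + b) * cos (a' \<bullet> x + b')
          = (cos ((a \<bullet> x + b) - (a' \<bullet> x + b')) + cos ((a \<bullet> x + b) + (a' \<bullet> x + b'))) / 2"
        by (rule cos_times_cos)
      moreover have "(a \<bullet> x + b) - (a' \<bullet> x + b') = (a - a') \<bullet> x + (b - b')"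
        "(a \<bullet> x + b) + (a' \<bullet> x + b') = (a + a') \<bullet> x + (b + b')"
        by (simp_all add: inner_diff_left inner_add_left)
      ultimately show ?thesis by (simp add: field_simps)
    qed
    show ?case unfolding eq by (intro trig_poly.intros)
  next
    case (add f f')
    then show ?case unfolding distrib_left by (intro trig_poly.add) auto
  qed
next
  case (add f1 f2)
  then show ?case unfolding distrib_right by (intro trig_poly.add) auto
qed

lemma trig_poly_polynomial_of_sines:
  fixes p :: "real ^ 'n \<Rightarrow> real"
  assumes "real_polynomial_function p"
  shows "trig_poly (\<lambda>x. p (\<chi> j. sin (r * x $ j)))"
  using assms
proof (induction rule: real_polynomial_function.induct)
  case (linear f)
  then interpret bounded_linear f .
  have eq: "f (\<chi> j. sin (r * x $ j)) = (\<Sum>j\<in>UNIV. f (axis j 1) * sin (axis j r \<bullet> x))" for x :: "real ^ 'n"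
  proof -
    have "(\<chi> j. sin (r * x $ j)) = (\<Sum>j\<in>UNIV. sin (r * x $ j) *\<^sub>R axis j 1)"
      by (simp add: vec_eq_iff axis_def if_distrib cong: if_cong)
    then show ?thesis by (simp add: sum scale inner_axis' mult.commute)
  qed
  show ?case unfolding eq by (intro trig_poly_sum trig_poly_sin) auto
qed (auto intro: trig_poly_const trig_poly.add trig_poly_mult)

lemma trig_poly_bounded_continuous:
  "trig_poly f \<Longrightarrow> continuous_on UNIV f \<and> bounded (range f)"
proof (induction rule: trig_poly.induct)
  case (cos c a b)
  have "\<bar>c * cos (a \<bullet> x + b)\<bar> \<le> \<bar>c\<bar> * 1" for x
    unfolding abs_mult by (intro mult_left_mono) auto
  then have "bounded (range (\<lambda>x. c * cos (a \<bullet> x + b)))" by (auto intro!: boundedI)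
  then show ?case by (auto intro!: continuous_intros)
next
  case (add f f')
  then show ?case using bounded_plus_comp[of f UNIV f'] by (auto intro!: continuous_intros)
qed

lemma integrable_bounded_continuous:
  fixes \<phi> :: "'a::topological_space \<Rightarrow> real"
  assumes "prob_space M" "sets M = sets borel" "continuous_on UNIV \<phi>" "bounded (range \<phi>)"
  shows "integrable M \<phi>"
proof -
  interpret prob_space M by fact
  obtain B where B: "\<And>x. norm (\<phi> x) \<le> B" using assms(4) by (auto simp: bounded_iff)
  have "\<phi> \<in> borel_measurable M"
    using borel_measurable_continuous_onI[OF assms(3)] assms(2) measurable_cong_sets by blast
  then show ?thesis by (intro integrable_const_bound[where B=B]) (use B in auto)
qed

definition char_vec :: "(real ^ 'n) measure \<Rightarrow> real ^ 'n \<Rightarrow> complex" where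
  "char_vec N t = (CLINT x|N. iexp (t \<bullet> x))"

lemma (in prob_space) integrable_iexp:
  assumes "X \<in> borel_measurable M"
  shows "complex_integrable M (\<lambda>w. iexp (X w))"
  by (rule integrable_const_bound[where B=1]) (use assms in auto)

lemma char_vec_cos:
  assumes "prob_space N" and [measurable_cong]: "sets N = sets borel"
  shows "(LINT x|N. cos (a \<bullet> x + b)) = Re (iexp b * char_vec N a)"
proof -
  interpret prob_space N by fact
  have "(\<lambda>x. a \<bullet> x) \<in> borel_measurable N" by measurable
  from integrable_iexp[OF this] have int: "complex_integrable N (\<lambda>x. iexp b * iexp (a \<bullet> x))"
    by (rule integrable_mult_right)
  have "iexp b * char_vec N a = (CLINT x|N. iexp b * iexp (a \<bullet> x))"
    by (simp add: char_vec_def)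
  then have "Re (iexp b * char_vec N a) = (LINT x|N. Re (iexp b * iexp (a \<bullet> x)))"
    using integral_Re[OF int] by simp
  also have "(\<lambda>x. Re (iexp b * iexp (a \<bullet> x))) = (\<lambda>x. cos (a \<bullet> x + b))"
    by (simp add: exp_add[symmetric] Re_exp fun_eq_iff add.commute)
  finally show ?thesis by simp
qed

lemma trig_poly_integral_tendsto:
  assumes Ns: "\<And>n. prob_space (Ns n)" "\<And>n. sets (Ns n) = sets borel"
    and N: "prob_space N" "sets N = sets borel"
    and conv: "\<And>t. (\<lambda>n. char_vec (Ns n) t) \<longlonglongrightarrow> char_vec N t"
    and f: "trig_poly f"
  shows "(\<lambda>n. LINT x|Ns n. f x) \<longlonglongrightarrow> (LINT x|N. f x)"
  using f
proof (induction rule: trig_poly.induct)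
  case (cos c a b)
  show ?case
    by (simp add: char_vec_cos Ns N) (intro tendsto_intros conv)
next
  case (add f f')
  have int: "integrable (Ns n) f" "integrable (Ns n) f'" "integrable N f" "integrable N f'" for n
    using add trig_poly_bounded_continuous integrable_bounded_continuous Ns N by blast+
  show ?case unfolding Bochner_Integration.integral_add[OF int(1,2)] Bochner_Integration.integral_add[OF int(3,4)]
    by (intro tendsto_add add)
qed

text \<open>A continuous function between the indicators of \<open>[L + 1, \<infinity>)\<close> and
  of \<open>(L, \<infinity>)\<close>, through which weak convergence controls tail
  probabilities.\<close>

definition ramp :: "real \<Rightarrow> real \<Rightarrow> real" where
  "ramp L x = min 1 (max 0 (x - L))"

lemma ramp_bounds: "0 \<le> ramp L x" "ramp L x \<le> 1" "x \<le> L \<Longrightarrow> ramp L x = 0" "L + 1 \<le> x \<Longrightarrow> ramp L x = 1"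
  by (auto simp: ramp_def)

lemma abs_ramp [simp]: "\<bar>ramp L x\<bar> = ramp L x"
  by (simp add: ramp_bounds)

lemma continuous_on_ramp [continuous_intros]:
  "continuous_on S f \<Longrightarrow> continuous_on S (\<lambda>x. ramp L (f x))"
  unfolding ramp_def by (intro continuous_intros)

lemma borel_measurable_ramp [measurable]: "ramp L \<in> borel_measurable borel"
  by (intro borel_measurable_continuous_onI continuous_intros)

lemma bounded_ramp: "bounded (range (\<lambda>x. ramp L (f x)))"
  by (rule boundedI[where B=1]) (auto simp: ramp_bounds)

text \<open>The tail beyond \<open>L + 1\<close> is dominated by the ramp integral at
  \<open>L\<close>, which converges to a limit that is small for large \<open>L\<close> by dominated
  convergence.\<close>

lemma tight_of_ramp:
  fixes Ns :: "nat \<Rightarrow> 'a::{real_normed_vector, second_countable_topology} measure" and N :: "'a measure"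
  assumes Ns: "\<And>n. prob_space (Ns n)" "\<And>n. sets (Ns n) = sets borel"
    and N: "prob_space N" "sets N = sets borel"
    and conv: "\<And>L. (\<lambda>n. LINT x|Ns n. ramp L (norm x)) \<longlonglongrightarrow> (LINT x|N. ramp L (norm x))"
    and e: "e > 0"
  obtains L where "L > 0" "measure N {x. norm x > L} < e" "\<forall>\<^sub>F n in sequentially. measure (Ns n) {x. norm x > L} < e"
proof -
  have le: "measure P {x. norm x > L + 1} \<le> (LINT x|P. ramp L (norm x))"
    if "prob_space P" and [measurable_cong]: "sets P = sets borel" for P :: "'a measure" and L
  proof -
    interpret prob_space P by fact
    have "measure P {x. norm x > L + 1} = (LINT x|P. indicat_real {x. norm x > L + 1} x)"
      using sets_eq_imp_space_eq[OF that(2)] by simp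
    also have "\<dots> \<le> (LINT x|P. ramp L (norm x))"
    proof (rule integral_mono)
      show "integrable P (indicat_real {x. norm x > L + 1})"
        by (rule integrable_const_bound[where B=1]) auto
      show "integrable P (\<lambda>x. ramp L (norm x))"
        by (rule integrable_const_bound[where B=1]) (auto simp: ramp_bounds)
    qed (auto simp: indicator_def ramp_bounds)
    finally show ?thesis .
  qed
  interpret N: prob_space N by fact
  note [measurable_cong] = N(2)
  have "(\<lambda>k. LINT x|N. ramp (real k) (norm x)) \<longlonglongrightarrow> (LINT x|N. 0)"
  proof (rule integral_dominated_convergence[where w="\<lambda>_. 1"])
    show "AE x in N. (\<lambda>k. ramp (real k) (norm x)) \<longlonglongrightarrow> 0"
    proof (rule AE_I2)
      fix x
      have "\<forall>\<^sub>F k in sequentially. ramp (real k) (norm x) = 0"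
        using eventually_ge_at_top[of "nat \<lceil>norm x\<rceil>"]
        by eventually_elim (auto intro!: ramp_bounds)
      then show "(\<lambda>k. ramp (real k) (norm x)) \<longlonglongrightarrow> 0" by (rule tendsto_eventually)
    qed
  qed (auto simp: ramp_bounds)
  then have "\<forall>\<^sub>F k in sequentially. (LINT x|N. ramp (real k) (norm x)) < e"
    using e by (intro order_tendstoD) auto
  then obtain k where k: "(LINT x|N. ramp (real k) (norm x)) < e"
    by (auto simp: eventually_sequentially)
  have "\<forall>\<^sub>F n in sequentially. (LINT x|Ns n. ramp (real k) (norm x)) < e"
    by (rule order_tendstoD(2)[OF conv k])
  then have "\<forall>\<^sub>F n in sequentially. measure (Ns n) {x. norm x > real k + 1} < e"
  proof eventually_elim
    case (elim n)
    then show ?case using le[of "Ns n" "real k"] Ns[of n] by simp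
  qed
  then show ?thesis
    using le[OF N, of "real k"] k by (intro that[of "real k + 1"]) auto
qed

text \<open>Coordinate \<open>j\<close> has the characteristic function \<open>char_vec\<close> at
  \<open>axis j t\<close>, so the one-dimensional continuity theorem makes each coordinate tight
  with an equal share of \<open>e\<close>; the largest of the bounds serves all coordinates.\<close>

lemma tight_char_vec:
  fixes N :: "(real ^ 'n) measure"
  assumes Ns: "\<And>n. prob_space (Ns n)" "\<And>n. sets (Ns n) = sets borel"
    and N: "prob_space N" "sets N = sets borel"
    and conv: "\<And>t. (\<lambda>n. char_vec (Ns n) t) \<longlonglongrightarrow> char_vec N t"
    and e: "e > 0"
  obtains L where "L > 0" "measure N {x. \<exists>j. \<bar>x $ j\<bar> > L} < e"
    "\<forall>\<^sub>F n in sequentially. measure (Ns n) {x. \<exists>j. \<bar>x $ j\<bar> > L} < e"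
proof -
  note [measurable_cong] = N(2) Ns(2)
  let ?C = "real CARD('n)"
  have "\<exists>L>0. measure N {x. \<bar>x $ j\<bar> > L} < e / ?C \<and>
      (\<forall>\<^sub>F n in sequentially. measure (Ns n) {x. \<bar>x $ j\<bar> > L} < e / ?C)" for j
  proof -
    let ?p = "\<lambda>P. distr P borel (\<lambda>x :: real ^ 'n. x $ j)"
    have rd: "real_distribution (?p P)" if "prob_space P" and [measurable_cong]: "sets P = sets borel" for P
      by (rule prob_space.real_distribution_distr) (use that in measurable)
    have ch: "char (?p P) t = char_vec P (axis j t)" if [measurable_cong]: "sets P = sets borel" for P t
      unfolding char_def char_vec_def by (subst integral_distr) (auto simp: inner_axis')
    have "weak_conv_m (\<lambda>n. ?p (Ns n)) (?p N)"
      using conv by (intro levy_continuity rd Ns N) (simp add: ch Ns N)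
    moreover have "continuous_on UNIV (\<lambda>x :: real. ramp L (norm x))" for L
      by (intro continuous_intros)
    ultimately have "(\<lambda>n. LINT x|?p (Ns n). ramp L (norm x)) \<longlonglongrightarrow> (LINT x|?p N. ramp L (norm x))" for L
      by (intro weak_conv_imp_integral_bdd_continuous_conv[where B=1] rd Ns N)
         (auto simp: continuous_on_eq_continuous_at ramp_bounds)
    then obtain L where L: "L > 0" "measure (?p N) {x. norm x > L} < e / ?C"
        "\<forall>\<^sub>F n in sequentially. measure (?p (Ns n)) {x. norm x > L} < e / ?C"
      using tight_of_ramp[of "\<lambda>n. ?p (Ns n)" "?p N" "e / ?C"] rd Ns N e
      unfolding real_distribution_def by (metis divide_pos_pos of_nat_0_less_iff sets_distr zero_less_card_finite)
    have "measure (?p P) {x. norm x > L} = measure P {x. \<bar>x $ j\<bar> > L}" if [measurable_cong]: "sets P = sets borel" for P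
      using sets_eq_imp_space_eq[OF that] by (subst measure_distr) (auto simp: vimage_def)
    then show ?thesis using L Ns N by auto
  qed
  then obtain L where L: "\<And>j. L j > 0" "\<And>j. measure N {x. \<bar>x $ j\<bar> > L j} < e / ?C"
      "\<And>j. \<forall>\<^sub>F n in sequentially. measure (Ns n) {x. \<bar>x $ j\<bar> > L j} < e / ?C"
    by metis
  let ?L = "Max (range L)"
  have Lle: "L j \<le> ?L" for j by simp
  have union: "measure P {x. \<exists>j. \<bar>x $ j\<bar> > ?L} < e"
    if "prob_space P" and [measurable_cong]: "sets P = sets borel"
      and lt: "\<And>j. measure P {x. \<bar>x $ j\<bar> > L j} < e / ?C" for P :: "(real ^ 'n) measure"
  proof -
    interpret prob_space P by fact
    have m: "{x. \<bar>x $ j\<bar> > L j} \<in> sets P" for j by measurable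
    have "measure P {x. \<exists>j. \<bar>x $ j\<bar> > ?L} \<le> measure P (\<Union>j\<in>UNIV. {x. \<bar>x $ j\<bar> > L j})"
      using Lle m by (intro finite_measure_mono) (auto intro: le_less_trans)
    also have "\<dots> \<le> (\<Sum>j\<in>UNIV. measure P {x. \<bar>x $ j\<bar> > L j})"
      using m by (intro finite_measure_subadditive_finite) auto
    also have "\<dots> < (\<Sum>j\<in>(UNIV :: 'n set). e / ?C)"
      by (rule sum_strict_mono) (use lt in auto)
    finally show ?thesis by simp
  qed
  have "\<forall>\<^sub>F n in sequentially. \<forall>j. measure (Ns n) {x. \<bar>x $ j\<bar> > L j} < e / ?C"
    using L(3) by (simp add: eventually_all_finite)
  then have "\<forall>\<^sub>F n in sequentially. measure (Ns n) {x. \<exists>j. \<bar>x $ j\<bar> > ?L} < e"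
    by eventually_elim (use union Ns in blast)
  moreover have "?L > 0" using L(1) Lle by (meson less_le_trans)
  ultimately show ?thesis using union[OF N L(2)] that by blast
qed

text \<open>A polynomial in the coordinates \<open>sin (\<pi> x\<^sub>j / 2L)\<close>, which parametrize the cube, is a trigonometric
  polynomial; being controlled on \<open>[-1, 1]\<^sup>n\<close>, it is bounded on the whole space.\<close>

lemma trig_poly_approx_on_cube:
  fixes \<phi> :: "real ^ 'n \<Rightarrow> real"
  assumes \<phi>: "continuous_on UNIV \<phi>" and B: "\<And>x. \<bar>\<phi> x\<bar> \<le> B" and "L > 0" "e > 0"
  obtains \<psi> where "trig_poly \<psi>" "\<And>x. \<bar>\<psi> x\<bar> \<le> B + e" "\<And>x. (\<And>j. \<bar>x $ j\<bar> \<le> L) \<Longrightarrow> \<bar>\<phi> x - \<psi> x\<bar> \<le> e"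
proof -
  let ?c = "2 * L / pi"
  \<comment> \<open>\<open>arcsin\<close> maps \<open>[-1, 1]\<close> onto
    \<open>[- pi / 2, pi / 2]\<close>, and \<open>?c\<close> stretches this to
    \<open>[- L, L]\<close>.\<close>
  let ?F = "\<lambda>s :: real ^ 'n. \<phi> (\<chi> j. ?c * arcsin (s $ j))"
  let ?Q = "cbox (-1) (1 :: real ^ 'n)"
  have Q: "s \<in> ?Q \<longleftrightarrow> (\<forall>j. -1 \<le> s $ j \<and> s $ j \<le> 1)" for s by (simp add: mem_box_cart)
  have "continuous_on ?Q (\<lambda>s. \<chi> j. ?c * arcsin (s $ j))"
    by (intro continuous_intros) (auto simp: Q)
  then have "continuous_on ?Q ?F"
    by (rule continuous_on_compose2[OF \<phi>]) auto
  then obtain p where p: "real_polynomial_function p" "\<And>s. s \<in> ?Q \<Longrightarrow> \<bar>?F s - p s\<bar> < e"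
    using Stone_Weierstrass_real_polynomial_function[OF compact_cbox _ \<open>e > 0\<close>] by metis
  let ?s = "\<lambda>x :: real ^ 'n. \<chi> j. sin (pi / (2 * L) * x $ j)"
  have sQ: "?s x \<in> ?Q" for x by (simp add: Q)
  show ?thesis
  proof
    show "trig_poly (\<lambda>x. p (?s x))" by (rule trig_poly_polynomial_of_sines[OF p(1)])
    show "\<bar>p (?s x)\<bar> \<le> B + e" for x using p(2)[OF sQ[of x]] B[of "\<chi> j. ?c * arcsin (?s x $ j)"] by linarith
    fix x :: "real ^ 'n" assume x: "\<And>j. \<bar>x $ j\<bar> \<le> L"
    have "?c * arcsin (sin (pi / (2 * L) * x $ j)) = x $ j" for j
    proof -
      have "pi / (2 * L) * \<bar>x $ j\<bar> \<le> pi / (2 * L) * L"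
        using x[of j] \<open>L > 0\<close> by (intro mult_left_mono) auto
      then have "\<bar>pi / (2 * L) * x $ j\<bar> \<le> pi / 2" using \<open>L > 0\<close> by (simp add: abs_mult)
      then have "arcsin (sin (pi / (2 * L) * x $ j)) = pi / (2 * L) * x $ j"
        by (intro arcsin_sin) linarith+
      then show ?thesis using \<open>L > 0\<close> by simp
    qed
    then have "(\<chi> j. ?c * arcsin (?s x $ j)) = x" by (simp add: vec_eq_iff)
    then show "\<bar>\<phi> x - p (?s x)\<bar> \<le> e" using p(2)[OF sQ[of x]] by simp
  qed
qed

text \<open>A test function is compared with a trigonometric polynomial, whose integrals converge by
  assumption. On a large cube the two are close; outside it both are bounded and tightness makes the
  mass small, uniformly for large \<open>n\<close>.\<close>

theorem levy_continuity_vec: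
  fixes N :: "(real ^ 'n) measure"
  assumes Ns: "\<And>n. prob_space (Ns n)" "\<And>n. sets (Ns n) = sets borel"
    and N: "prob_space N" "sets N = sets borel"
    and conv: "\<And>t. (\<lambda>n. char_vec (Ns n) t) \<longlonglongrightarrow> char_vec N t"
  shows "weakly_converges Ns N"
  unfolding weakly_converges_def
proof (intro allI impI)
  fix \<phi> :: "real ^ 'n \<Rightarrow> real" assume \<phi>: "continuous_on UNIV \<phi>" "bounded (range \<phi>)"
  then obtain B where B: "\<And>x. \<bar>\<phi> x\<bar> \<le> B" by (auto simp: bounded_iff)
  have B0: "B \<ge> 0" using B[of 0] by linarith
  show "(\<lambda>n. LINT x|Ns n. \<phi> x) \<longlonglongrightarrow> (LINT x|N. \<phi> x)"
  proof (rule tendstoI)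
    fix e0 :: real assume "e0 > 0"
    \<comment> \<open>Each of the two approximation errors will be at most
      \<open>e + (2 * B + 1) * e\<close> and the trigonometric integrals differ by less than
      \<open>e\<close>, in total \<open>(5 + 4 * B) * e\<close>.\<close>
    define e where "e = e0 / (6 + 4 * B)"
    have e: "e > 0" using \<open>e0 > 0\<close> B0 by (simp add: e_def)
    \<comment> \<open>The cap at 1 bounds the difference of the two functions by
      \<open>2 * B + 1\<close> outside the cube.\<close>
    define e1 where "e1 = min e 1"
    have e1: "e1 > 0" "e1 \<le> e" "e1 \<le> 1" using e by (auto simp: e1_def)
    obtain L where L: "L > 0" "measure N {x. \<exists>j. \<bar>x $ j\<bar> > L} < e"
      "\<forall>\<^sub>F n in sequentially. measure (Ns n) {x. \<exists>j. \<bar>x $ j\<bar> > L} < e"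
      using tight_char_vec[OF Ns N conv e] by blast
    obtain \<psi> where \<psi>: "trig_poly \<psi>" "\<And>x. \<bar>\<psi> x\<bar> \<le> B + e1"
        "\<And>x. (\<And>j. \<bar>x $ j\<bar> \<le> L) \<Longrightarrow> \<bar>\<phi> x - \<psi> x\<bar> \<le> e1"
      using trig_poly_approx_on_cube[OF \<phi>(1) B L(1) e1(1)] by blast
    let ?O = "{x :: real ^ 'n. \<exists>j. \<bar>x $ j\<bar> > L}"
    have close: "\<bar>(LINT x|P. \<phi> x) - (LINT x|P. \<psi> x)\<bar> \<le> e + (2 * B + 1) * measure P ?O"
      if "prob_space P" and [measurable_cong]: "sets P = sets borel" for P
    proof -
      interpret prob_space P by fact
      have O: "?O \<in> sets P" by measurable
      have i: "integrable P \<phi>" "integrable P \<psi>"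
        using \<phi> trig_poly_bounded_continuous[OF \<psi>(1)] integrable_bounded_continuous that by blast+
      have iO: "integrable P (indicat_real ?O)"
        by (rule integrable_const_bound[where B=1]) (use O in auto)
      have "\<bar>(LINT x|P. \<phi> x) - (LINT x|P. \<psi> x)\<bar> = \<bar>LINT x|P. \<phi> x - \<psi> x\<bar>" using i by simp
      also have "\<dots> \<le> (LINT x|P. \<bar>\<phi> x - \<psi> x\<bar>)" by (rule integral_abs_bound)
      also have "\<dots> \<le> (LINT x|P. e + (2 * B + 1) * indicat_real ?O x)"
      proof (rule integral_mono)
        show "\<bar>\<phi> x - \<psi> x\<bar> \<le> e + (2 * B + 1) * indicat_real ?O x" for x
        proof (cases "x \<in> ?O")
          case True
          then show ?thesis using B[of x] \<psi>(2)[of x] e e1 by simp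
        next
          case False
          then show ?thesis using \<psi>(3)[of x] e1 by (auto simp: not_less)
        qed
      qed (use i iO in auto)
      also have "\<dots> = e + (2 * B + 1) * measure P ?O"
        using iO prob_space sets_eq_imp_space_eq[OF that(2)] by simp
      finally show ?thesis .
    qed
    have "\<forall>\<^sub>F n in sequentially. dist (LINT x|Ns n. \<psi> x) (LINT x|N. \<psi> x) < e"
      by (rule tendstoD[OF trig_poly_integral_tendsto[OF Ns N conv \<psi>(1)] e])
    with L(3) show "\<forall>\<^sub>F n in sequentially. dist (LINT x|Ns n. \<phi> x) (LINT x|N. \<phi> x) < e0"
    proof eventually_elim
      case (elim n)
      have "(2 * B + 1) * measure (Ns n) ?O \<le> (2 * B + 1) * e" "(2 * B + 1) * measure N ?O \<le> (2 * B + 1) * e"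
        using elim L(2) B0 by (auto intro!: mult_left_mono)
      then have "dist (LINT x|Ns n. \<phi> x) (LINT x|N. \<phi> x) < 3 * e + 2 * ((2 * B + 1) * e)"
        using close[OF Ns, of n] close[OF N] elim(2) unfolding dist_real_def by linarith
      also have "\<dots> = (5 + 4 * B) * e" by (simp add: algebra_simps)
      also have "\<dots> \<le> (6 + 4 * B) * e" using e by (intro mult_right_mono) auto
      also have "\<dots> = e0" using B0 by (simp add: e_def)
      finally show ?case .
    qed
  qed
qed


lemma char_vec_distr:
  assumes [measurable]: "X \<in> borel_measurable M"
  shows "char_vec (distr M borel X) t = (CLINT w|M. iexp (t \<bullet> X w))"
  unfolding char_vec_def by (subst integral_distr) auto

lemma weakly_converges_tight:
  fixes N :: "(real ^ 'n) measure"
  assumes Ns: "\<And>n. prob_space (Ns n)" "\<And>n. sets (Ns n) = sets borel"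
    and N: "prob_space N" "sets N = sets borel"
    and conv: "weakly_converges Ns N" and e: "e > 0"
  obtains L where "L > 0" "\<forall>\<^sub>F n in sequentially. measure (Ns n) {x. norm x > L} < e"
proof -
  have "(\<lambda>n. LINT x|Ns n. ramp L (norm x)) \<longlonglongrightarrow> (LINT x|N. ramp L (norm x))" for L
    using conv bounded_ramp[of L norm] unfolding weakly_converges_def
    by (auto intro!: continuous_intros)
  from tight_of_ramp[OF Ns N this e] that show ?thesis by metis
qed

section \<open>Normal and chi-squared laws\<close>

lemma prob_space_std_normal: "prob_space std_normal"
  unfolding std_normal_def by (rule prob_space_normal_density) simp

lemma sets_std_normal [measurable_cong, simp]: "sets std_normal = sets borel"
  by (simp add: std_normal_def)

lemma sets_std_normal_vec [measurable_cong, simp]: "sets std_normal_vec = sets borel"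
  by (simp add: std_normal_vec_def)

lemma sets_mv_normal [measurable_cong, simp]: "sets (mv_normal c S) = sets borel"
  by (simp add: mv_normal_def)

lemma measurable_vec_lambda_PiM [measurable]:
  "(\<lambda>z. \<chi> i. z i) \<in> measurable (PiM UNIV (\<lambda>_::'n::finite. std_normal)) (borel :: (real ^ 'n) measure)"
proof -
  have "(\<lambda>z. (\<chi> i. z i) \<bullet> b) \<in> borel_measurable (PiM UNIV (\<lambda>_::'n::finite. std_normal))"
    for b :: "real ^ 'n"
    by (simp add: inner_vec_def)
  then show ?thesis by (subst borel_measurable_euclidean_space) auto
qed

lemma prob_space_std_normal_vec: "prob_space std_normal_vec"
  unfolding std_normal_vec_def
  by (intro prob_space.prob_space_distr prob_space_PiM prob_space_std_normal) measurable

lemma measurable_matrix_vector [measurable]: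
  fixes A :: "real ^ 'n ^ 'm"
  shows "(\<lambda>x. A *v x) \<in> borel_measurable borel"
  by (intro borel_measurable_continuous_onI linear_continuous_on)
     (simp add: linear_conv_bounded_linear[symmetric])

lemma prob_space_mv_normal: "prob_space (mv_normal c S)"
  unfolding mv_normal_def
  by (intro prob_space.prob_space_distr prob_space_std_normal_vec) measurable

lemma char_std_normal: "(CLINT x|std_normal. iexp (t * x)) = of_real (exp (- (t\<^sup>2) / 2))"
  using fun_cong[OF char_std_normal_distribution, of t] by (simp add: char_def std_normal_def)

lemma char_vec_std_normal:
  fixes t :: "real ^ 'n"
  shows "char_vec std_normal_vec t = of_real (exp (- ((norm t)\<^sup>2) / 2))"
proof -
  interpret product_sigma_finite "\<lambda>_::'n. std_normal"
    unfolding product_sigma_finite_def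
    using prob_space_std_normal prob_space_imp_sigma_finite by blast
  interpret prob_space std_normal by (rule prob_space_std_normal)
  have int: "complex_integrable std_normal (\<lambda>x. iexp (s * x))" for s
    by (rule integrable_iexp) measurable
  have "char_vec std_normal_vec t = (CLINT z|PiM UNIV (\<lambda>_::'n. std_normal). iexp (t \<bullet> (\<chi> i. z i)))"
    unfolding std_normal_vec_def by (rule char_vec_distr) measurable
  also have "\<dots> = (CLINT z|PiM UNIV (\<lambda>_::'n. std_normal). (\<Prod>i\<in>UNIV. iexp (t $ i * z i)))"
    by (simp add: inner_vec_def sum_distrib_left exp_sum)
  also have "\<dots> = (\<Prod>i\<in>UNIV. CLINT x|std_normal. iexp (t $ i * x))"
    by (rule product_integral_prod[OF finite int])
  also have "\<dots> = of_real (\<Prod>i\<in>UNIV. exp (- ((t $ i)\<^sup>2) / 2))"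
    unfolding char_std_normal by simp
  also have "(\<Prod>i\<in>UNIV. exp (- ((t $ i)\<^sup>2) / 2)) = exp (- ((norm t)\<^sup>2) / 2)"
    unfolding power2_norm_eq_inner inner_vec_def
    by (simp add: exp_sum[symmetric] power2_eq_square sum_negf sum_divide_distrib)
  finally show ?thesis .
qed

lemma mv_normal_eq_distr:
  fixes S :: "real ^ 'n ^ 'n"
  assumes "pos_semidefinite S"
  obtains A :: "real ^ 'n ^ 'n" where "A ** transpose A = S" "mv_normal c S = distr std_normal_vec borel (\<lambda>z. c + A *v z)"
proof
  let ?A = "SOME A :: real ^ 'n ^ 'n. A ** transpose A = S"
  show "?A ** transpose ?A = S"
  proof (rule someI_ex)
    obtain A :: "real ^ 'n ^ 'n" where "A ** transpose A = S" by (rule pos_semidefinite_factor[OF assms])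
    then show "\<exists>A :: real ^ 'n ^ 'n. A ** transpose A = S" by blast
  qed
qed (simp add: mv_normal_def)

text \<open>The squared norm of \<open>transpose A *v t\<close> is the form of
  \<open>A ** transpose A = S\<close> at \<open>t\<close>, so the chosen factor \<open>A\<close>
  drops out.\<close>

lemma char_vec_mv_normal:
  fixes S :: "real ^ 'n ^ 'n"
  assumes "pos_semidefinite S"
  shows "char_vec (mv_normal 0 S) t = of_real (exp (- (t \<bullet> (S *v t)) / 2))"
proof -
  obtain A :: "real ^ 'n ^ 'n" where A: "A ** transpose A = S"
    and eq: "mv_normal 0 S = distr std_normal_vec borel (\<lambda>z. 0 + A *v z)"
    using mv_normal_eq_distr[OF assms] by metis
  have "char_vec (mv_normal 0 S) t = (CLINT z|std_normal_vec. iexp (t \<bullet> (A *v z)))"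
    unfolding eq by (subst char_vec_distr) auto
  also have "\<dots> = char_vec std_normal_vec (t v* A)"
    by (simp add: char_vec_def dot_lmul_matrix)
  finally show ?thesis
    by (simp add: char_vec_std_normal power2_norm_eq_inner A[symmetric] matrix_vector_mul_assoc[symmetric]
        dot_lmul_matrix)
qed

text \<open>A bijection between the first \<open>CARD('n)\<close> naturals and \<open>'n\<close>
  reindexes the product of normal laws.\<close>

lemma chi_squared_eq_distr:
  "chi_squared CARD('n) = distr std_normal_vec borel (\<lambda>z :: real ^ 'n. (norm z)\<^sup>2)"
proof -
  let ?k = "CARD('n)" and ?P = "PiM (UNIV :: 'n set) (\<lambda>_. std_normal)"
  obtain f :: "nat \<Rightarrow> 'n" where f: "bij_betw f {..<?k} UNIV"
    by (metis atLeast0LessThan ex_bij_betw_nat_finite finite)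
  have r: "distr ?P (PiM {..<?k} (\<lambda>_. std_normal)) (\<lambda>z. \<lambda>i\<in>{..<?k}. z (f i)) = PiM {..<?k} (\<lambda>_. std_normal)"
    using f by (intro distr_PiM_reindex prob_space_std_normal) (auto simp: bij_betw_def)
  have m[measurable]: "(\<lambda>z. \<lambda>i\<in>{..<?k}. z (f i)) \<in> measurable ?P (PiM {..<?k} (\<lambda>_. std_normal))"
    by measurable
  have "chi_squared ?k = distr ?P borel (\<lambda>z. \<Sum>i<?k. (z (f i))\<^sup>2)"
    unfolding chi_squared_def by (subst r[symmetric], subst distr_distr) (auto simp: comp_def)
  also have "\<dots> = distr ?P borel (\<lambda>z. (norm ((\<chi> i. z i) :: real ^ 'n))\<^sup>2)"
    by (intro arg_cong[where f="distr ?P borel"] ext)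
       (unfold power2_norm_eq_inner inner_vec_def, simp add: power2_eq_square
         sum.reindex_bij_betw[OF f, of "\<lambda>i. _ i * _ i"])
  also have "\<dots> = distr std_normal_vec borel (\<lambda>z :: real ^ 'n. (norm z)\<^sup>2)"
    unfolding std_normal_vec_def by (subst distr_distr) (auto simp: comp_def)
  finally show ?thesis .
qed

lemma emeasure_std_normal_finite:
  assumes "finite A"
  shows "emeasure std_normal A = 0"
proof -
  have A: "A \<in> sets borel" using assms by (intro borel_closed finite_imp_closed)
  have "AE x in lborel. x \<notin> A" using assms by (intro AE_not_in finite_imp_null_set_lborel)
  then show ?thesis
    unfolding std_normal_def using A
    by (subst emeasure_density) (auto intro!: nn_integral_0_iff_AE[THEN iffD2] simp: indicator_def)
qed

text \<open>With all coordinates but one fixed, at most two values of the remaining one give the sum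
  \<open>c\<close>, and a normal law gives them no mass; Fubini concludes.\<close>

lemma chi_squared_no_atom:
  assumes "k > 0"
  shows "emeasure (chi_squared k) {c} = 0"
proof -
  interpret product_sigma_finite "\<lambda>_::nat. std_normal"
    unfolding product_sigma_finite_def
    using prob_space_std_normal prob_space_imp_sigma_finite by blast
  let ?I = "{1..<k}" and ?P = "\<lambda>I. PiM I (\<lambda>_::nat. std_normal)"
  have k: "{..<k} = insert 0 ?I" using assms by auto
  let ?B = "{z \<in> space (?P (insert 0 ?I)). (\<Sum>i\<in>insert 0 ?I. (z i)\<^sup>2) = c}"
  have B: "?B \<in> sets (?P (insert 0 ?I))" by measurable
  have "emeasure (chi_squared k) {c} = emeasure (?P (insert 0 ?I)) ?B"
    unfolding chi_squared_def k by (subst emeasure_distr) (auto intro!: arg_cong[where f="emeasure _"])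
  also have "\<dots> = (\<integral>\<^sup>+ z. indicator ?B z \<partial>?P (insert 0 ?I))" using B by simp
  also have "\<dots> = (\<integral>\<^sup>+ x. (\<integral>\<^sup>+ y. indicator ?B (x(0 := y)) \<partial>std_normal) \<partial>?P ?I)"
    by (rule product_nn_integral_insert) (use B in auto)
  also have "\<dots> = (\<integral>\<^sup>+ x. 0 \<partial>?P ?I)"
  proof (rule nn_integral_cong)
    fix x
    let ?c = "c - (\<Sum>i\<in>?I. (x i)\<^sup>2)"
    have "indicator ?B (x(0 := y)) \<le> (indicator {sqrt ?c, - sqrt ?c} y :: ennreal)" for y
    proof (cases "x(0 := y) \<in> ?B")
      case True
      have "(\<Sum>i\<in>?I. ((x(0 := y)) i)\<^sup>2) = (\<Sum>i\<in>?I. (x i)\<^sup>2)" by (rule sum.cong) auto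
      then have "y\<^sup>2 = ?c" using True by auto
      then have "y = sqrt ?c \<or> y = - sqrt ?c" by (metis abs_if minus_minus real_sqrt_abs)
      then show ?thesis by (auto simp: indicator_def)
    qed auto
    then have "(\<integral>\<^sup>+ y. indicator ?B (x(0 := y)) \<partial>std_normal)
        \<le> (\<integral>\<^sup>+ y. indicator {sqrt ?c, - sqrt ?c} y \<partial>std_normal)"
      by (rule nn_integral_mono)
    also have "\<dots> = 0" by (subst nn_integral_indicator) (auto intro!: emeasure_std_normal_finite)
    finally show "(\<integral>\<^sup>+ y. indicator ?B (x(0 := y)) \<partial>std_normal) = 0" by simp
  qed
  finally show ?thesis by simp
qed

lemma real_distribution_chi_squared: "real_distribution (chi_squared k)"
  unfolding chi_squared_def
  by (intro prob_space.real_distribution_distr prob_space_PiM prob_space_std_normal) measurable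

lemma isCont_cdf_chi_squared:
  assumes "k > 0"
  shows "isCont (cdf (chi_squared k)) x"
proof -
  interpret real_distribution "chi_squared k" by (rule real_distribution_chi_squared)
  show ?thesis
    using chi_squared_no_atom[OF assms, of x] by (simp add: isCont_cdf measure_def)
qed

text \<open>Continuity does both halves: the superlevel set is closed, so its infimum belongs to it,
  and the intermediate value theorem provides a point where the level is attained exactly.\<close>

lemma cdf_quantile:
  assumes N: "real_distribution N" and cont: "\<And>x. isCont (cdf N) x" and u: "0 < u" "u < 1"
  shows "cdf N (quantile N u) = u"
proof -
  interpret real_distribution N by fact
  let ?S = "{x. u \<le> cdf N x}"
  have "\<forall>\<^sub>F x in at_bot. cdf N x < u" by (rule order_tendstoD(2)[OF cdf_lim_at_bot u(1)])
  then obtain a where a: "\<And>x. x \<le> a \<Longrightarrow> cdf N x < u" by (auto simp: eventually_at_bot_linorder)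
  have "\<forall>\<^sub>F x in at_top. u < cdf N x" by (rule order_tendstoD(1)[OF cdf_lim_at_top_prob u(2)])
  then obtain b where b: "\<And>x. x \<ge> b \<Longrightarrow> u < cdf N x" by (auto simp: eventually_at_top_linorder)
  have "a \<le> b" using a[of a] b[of a] by force
  then obtain x0 where x0: "cdf N x0 = u"
    using IVT[of "cdf N" a u b] a[of a] b[of b] cont by force
  have bdd: "bdd_below ?S"
    using a by (intro bdd_belowI[where m=a]) (metis linear mem_Collect_eq not_le)
  have "closed ?S"
    by (intro closed_Collect_le continuous_intros) (simp add: continuous_at_imp_continuous_on cont)
  then have "Inf ?S \<in> ?S" using x0 bdd by (intro closed_contains_Inf) auto
  then have "u \<le> cdf N (quantile N u)" by (simp add: quantile_def)
  moreover have "quantile N u \<le> x0" unfolding quantile_def using x0 bdd by (intro cInf_lower) auto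
  then have "cdf N (quantile N u) \<le> u" using cdf_nondecreasing x0 by metis
  ultimately show ?thesis by simp
qed

section \<open>Convergence in probability\<close>

text \<open>Convergence in probability to a constant. The exceptional events are only required to be
  covered by measurable ones, so that no measurability of \<open>Z\<close> is needed. A single \<open>e\<close> bounds both the
  distance and the probability, as in the Ky Fan metric.\<close>

definition tendsto_prob :: "'w measure \<Rightarrow> (nat \<Rightarrow> 'w \<Rightarrow> 'a::metric_space) \<Rightarrow> 'a \<Rightarrow> bool" where
  "tendsto_prob M Z c \<longleftrightarrow> (\<forall>e>0. \<exists>A. (\<forall>n. A n \<in> sets M) \<and>
     (\<forall>n. \<forall>w \<in> space M - A n. dist (Z n w) c < e) \<and> (\<forall>\<^sub>F n in sequentially. measure M (A n) < e))"

lemma tendsto_probE: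
  assumes "tendsto_prob M Z c" "e > 0" "d > 0"
  obtains A where "\<And>n. A n \<in> sets M" "\<And>n w. w \<in> space M \<Longrightarrow> w \<notin> A n \<Longrightarrow> dist (Z n w) c < e"
    "\<forall>\<^sub>F n in sequentially. measure M (A n) < d"
proof -
  have "min e d > 0" using assms by simp
  then obtain A where A: "\<And>n. A n \<in> sets M" "\<And>n. \<forall>w \<in> space M - A n. dist (Z n w) c < min e d"
    "\<forall>\<^sub>F n in sequentially. measure M (A n) < min e d"
    using assms(1) unfolding tendsto_prob_def by meson
  show ?thesis
    by (rule that[of A]) (use A in \<open>auto elim: eventually_mono\<close>)
qed

lemma tendsto_probI:
  assumes "\<And>e. e > 0 \<Longrightarrow> \<exists>A. (\<forall>n. A n \<in> sets M) \<and>
     (\<forall>n. \<forall>w\<in>space M. w \<notin> A n \<longrightarrow> dist (Z n w) c < e) \<and> (\<forall>\<^sub>F n in sequentially. measure M (A n) < e)"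
  shows "tendsto_prob M Z c"
  unfolding tendsto_prob_def using assms by (metis Diff_iff)

lemma (in prob_space) eventually_measure_union_less:
  assumes "\<And>n. A n \<in> sets M" "\<And>n. B n \<in> sets M"
    "\<forall>\<^sub>F n in sequentially. measure M (A n) < e / 2" "\<forall>\<^sub>F n in sequentially. measure M (B n) < e / 2"
  shows "\<forall>\<^sub>F n in sequentially. measure M (A n \<union> B n) < e"
  using assms(3,4)
proof eventually_elim
  case (elim n)
  then show ?case using measure_Un_le[OF assms(1)[of n] assms(2)[of n]] by linarith
qed

lemma tendsto_prob_isCont:
  assumes Z: "tendsto_prob M Z c" and F: "isCont F c"
  shows "tendsto_prob M (\<lambda>n w. F (Z n w)) (F c)"
proof (rule tendsto_probI)
  fix e :: real assume "e > 0"
  then obtain d where d: "d > 0" "\<And>x. dist x c < d \<Longrightarrow> dist (F x) (F c) < e"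
    using F unfolding continuous_at_eps_delta by blast
  obtain A where "\<And>n. A n \<in> sets M" "\<And>n w. w \<in> space M \<Longrightarrow> w \<notin> A n \<Longrightarrow> dist (Z n w) c < d"
    "\<forall>\<^sub>F n in sequentially. measure M (A n) < e" using tendsto_probE[OF Z d(1) \<open>e > 0\<close>] by blast
  then show "\<exists>A. (\<forall>n. A n \<in> sets M) \<and>
     (\<forall>n. \<forall>w\<in>space M. w \<notin> A n \<longrightarrow> dist (F (Z n w)) (F c) < e) \<and> (\<forall>\<^sub>F n in sequentially. measure M (A n) < e)"
    using d(2) by blast
qed

lemma (in prob_space) tendsto_prob_Pair:
  assumes Z: "tendsto_prob M Z c" and W: "tendsto_prob M W d"
  shows "tendsto_prob M (\<lambda>n w. (Z n w, W n w)) (c, d)"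
proof (rule tendsto_probI)
  fix e :: real assume "e > 0"
  then have e: "e / 2 > 0" by simp
  obtain A where A: "\<And>n. A n \<in> sets M" "\<And>n w. w \<in> space M \<Longrightarrow> w \<notin> A n \<Longrightarrow> dist (Z n w) c < e / 2"
    "\<forall>\<^sub>F n in sequentially. measure M (A n) < e / 2" using tendsto_probE[OF Z e e] by blast
  obtain B where B: "\<And>n. B n \<in> sets M" "\<And>n w. w \<in> space M \<Longrightarrow> w \<notin> B n \<Longrightarrow> dist (W n w) d < e / 2"
    "\<forall>\<^sub>F n in sequentially. measure M (B n) < e / 2" using tendsto_probE[OF W e e] by blast
  have "dist (Z n w, W n w) (c, d) < e" if "w \<in> space M" "w \<notin> A n \<union> B n" for n w
  proof -
    have "dist (Z n w, W n w) (c, d) \<le> dist (Z n w) c + dist (W n w) d"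
      unfolding dist_Pair_Pair by (rule sqrt_sum_squares_le_sum) auto
    then show ?thesis using A(2)[of w n] B(2)[of w n] that by auto
  qed
  then show "\<exists>A. (\<forall>n. A n \<in> sets M) \<and>
     (\<forall>n. \<forall>w\<in>space M. w \<notin> A n \<longrightarrow> dist (Z n w, W n w) (c, d) < e) \<and> (\<forall>\<^sub>F n in sequentially. measure M (A n) < e)"
    using eventually_measure_union_less[OF A(1) B(1) A(3) B(3)] A(1) B(1)
    by (intro exI[of _ "\<lambda>n. A n \<union> B n"]) auto
qed

text \<open>Agreement is required only for \<open>n \<ge> n0\<close> and only where \<open>W\<close>
  is near its limit. This is how estimators with arbitrary values outside their domain are replaced
  by formulas.\<close>

lemma (in prob_space) tendsto_prob_transform:
  assumes Z: "tendsto_prob M Z c" and W: "tendsto_prob M W d"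
    and "e > 0" and eq: "\<And>w n. w \<in> space M \<Longrightarrow> n \<ge> n0 \<Longrightarrow> dist (W n w) d < e \<Longrightarrow> Z n w = Z' n w"
  shows "tendsto_prob M Z' c"
proof (rule tendsto_probI)
  fix e' :: real assume e': "e' > 0"
  then have e2: "e' / 2 > 0" by simp
  obtain A where A: "\<And>n. A n \<in> sets M" "\<And>n w. w \<in> space M \<Longrightarrow> w \<notin> A n \<Longrightarrow> dist (Z n w) c < e'"
    "\<forall>\<^sub>F n in sequentially. measure M (A n) < e' / 2" using tendsto_probE[OF Z e' e2] by blast
  obtain B where B: "\<And>n. B n \<in> sets M" "\<And>n w. w \<in> space M \<Longrightarrow> w \<notin> B n \<Longrightarrow> dist (W n w) d < e"
    "\<forall>\<^sub>F n in sequentially. measure M (B n) < e' / 2" using tendsto_probE[OF W \<open>e > 0\<close> e2] by blast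
  \<comment> \<open>The distance clause of \<open>tendsto_prob\<close> concerns every
    \<open>n\<close>, the probability clause only large ones, so for early indices the whole space
    is declared exceptional.\<close>
  let ?C = "\<lambda>n. if n \<ge> n0 then A n \<union> B n else space M"
  have "\<forall>\<^sub>F n in sequentially. measure M (?C n) < e'"
    using eventually_measure_union_less[OF A(1) B(1) A(3) B(3)] eventually_ge_at_top[of n0]
    by eventually_elim auto
  moreover have "?C n \<in> sets M" for n using A(1) B(1) by auto
  moreover have "dist (Z' n w) c < e'" if "w \<in> space M" "w \<notin> ?C n" for n w
    using that A(2)[of w n] B(2)[of w n] eq[of w n] by (auto split: if_splits)
  ultimately show "\<exists>A. (\<forall>n. A n \<in> sets M) \<and>
     (\<forall>n. \<forall>w\<in>space M. w \<notin> A n \<longrightarrow> dist (Z' n w) c < e') \<and> (\<forall>\<^sub>F n in sequentially. measure M (A n) < e')"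
    by (intro exI[of _ ?C]) blast
qed

lemma (in prob_space) tendsto_prob_AE:
  fixes Z :: "nat \<Rightarrow> 'a \<Rightarrow> 'b::{second_countable_topology, metric_space}"
  assumes [measurable]: "\<And>n. Z n \<in> borel_measurable M" and ae: "AE w in M. (\<lambda>n. Z n w) \<longlonglongrightarrow> c"
  shows "tendsto_prob M Z c"
proof (rule tendsto_probI)
  fix e :: real assume e: "e > 0"
  let ?A = "\<lambda>n. {w \<in> space M. e \<le> dist (Z n w) c}"
  have A: "?A n \<in> sets M" for n by measurable
  have "(\<lambda>n. LINT w|M. indicat_real (?A n) w) \<longlonglongrightarrow> (LINT w|M. 0)"
  proof (rule integral_dominated_convergence[where w="\<lambda>_. 1"])
    show "AE w in M. (\<lambda>n. indicat_real (?A n) w) \<longlonglongrightarrow> 0"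
      using ae
    proof eventually_elim
      case (elim w)
      then have "\<forall>\<^sub>F n in sequentially. dist (Z n w) c < e" using e by (rule tendstoD)
      then have "\<forall>\<^sub>F n in sequentially. indicat_real (?A n) w = 0" by eventually_elim (auto simp: indicator_def)
      then show ?case by (rule tendsto_eventually)
    qed
  qed (use A in auto)
  moreover have "(LINT w|M. indicat_real (?A n) w) = measure M (?A n)" for n
    using A[of n] sets.sets_into_space by (simp add: Int_absorb2)
  ultimately have "\<forall>\<^sub>F n in sequentially. measure M (?A n) < e"
    using e by (intro order_tendstoD(2)) auto
  then show "\<exists>A. (\<forall>n. A n \<in> sets M) \<and>
     (\<forall>n. \<forall>w\<in>space M. w \<notin> A n \<longrightarrow> dist (Z n w) c < e) \<and> (\<forall>\<^sub>F n in sequentially. measure M (A n) < e)"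
    using A by (intro exI[of _ ?A]) auto
qed

lemma (in prob_space) tendsto_prob_L2:
  fixes Z :: "nat \<Rightarrow> 'a \<Rightarrow> 'b::real_normed_vector"
  assumes m [measurable]: "\<And>n. (\<lambda>w. (norm (Z n w))\<^sup>2) \<in> borel_measurable M"
    and int: "\<forall>\<^sub>F n in sequentially. integrable M (\<lambda>w. (norm (Z n w))\<^sup>2)"
    and lim: "(\<lambda>n. LINT w|M. (norm (Z n w))\<^sup>2) \<longlonglongrightarrow> 0"
  shows "tendsto_prob M Z 0"
proof (rule tendsto_probI)
  fix e :: real assume e: "e > 0"
  let ?A = "\<lambda>n. {w \<in> space M. e\<^sup>2 \<le> (norm (Z n w))\<^sup>2}"
  have "(\<lambda>n. (LINT w|M. (norm (Z n w))\<^sup>2) / e\<^sup>2) \<longlonglongrightarrow> 0"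
    using tendsto_divide[OF lim tendsto_const[of "e\<^sup>2"]] e by simp
  then have "\<forall>\<^sub>F n in sequentially. (LINT w|M. (norm (Z n w))\<^sup>2) / e\<^sup>2 < e"
    using e by (rule order_tendstoD)
  with int have "\<forall>\<^sub>F n in sequentially. measure M (?A n) < e"
  proof eventually_elim
    case (elim n)
    have "measure M (?A n) \<le> (LINT w|M. (norm (Z n w))\<^sup>2) / e\<^sup>2"
      by (rule integral_Markov_inequality_measure[where A="{}"]) (use e elim(1) in auto)
    then show ?case using elim(2) by linarith
  qed
  moreover have "?A n \<in> sets M" for n by measurable
  moreover have "dist (Z n w) 0 < e" if "w \<in> space M" "w \<notin> ?A n" for n w
    using that e by (auto simp: not_le intro: power_less_imp_less_base)
  ultimately show "\<exists>A. (\<forall>n. A n \<in> sets M) \<and>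
     (\<forall>n. \<forall>w\<in>space M. w \<notin> A n \<longrightarrow> dist (Z n w) 0 < e) \<and> (\<forall>\<^sub>F n in sequentially. measure M (A n) < e)"
    by (intro exI[of _ ?A]) blast
qed

definition tight_rv :: "'w measure \<Rightarrow> (nat \<Rightarrow> 'w \<Rightarrow> 'a::real_normed_vector) \<Rightarrow> bool" where
  "tight_rv M D \<longleftrightarrow> (\<forall>e>0. \<exists>L>0. \<forall>\<^sub>F n in sequentially. measure M {w \<in> space M. norm (D n w) > L} < e)"

lemma tight_rv_weakly_converges:
  fixes D :: "nat \<Rightarrow> 'w \<Rightarrow> real ^ 'n"
  assumes M: "prob_space M" and [measurable]: "\<And>n. D n \<in> borel_measurable M"
    and N: "prob_space N" "sets N = sets borel"
    and conv: "weakly_converges (\<lambda>n. distr M borel (D n)) N"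
  shows "tight_rv M D"
  unfolding tight_rv_def
proof (intro allI impI)
  fix e :: real assume "e > 0"
  have "prob_space (distr M borel (D n))" for n
    by (rule prob_space.prob_space_distr[OF M]) measurable
  then obtain L where L: "L > 0" "\<forall>\<^sub>F n in sequentially. measure (distr M borel (D n)) {x. norm x > L} < e"
    using weakly_converges_tight[OF _ _ N conv \<open>e > 0\<close>] by (metis sets_distr)
  have "measure (distr M borel (D n)) {x. norm x > L} = measure M {w \<in> space M. norm (D n w) > L}" for n
    by (subst measure_distr) (auto simp: vimage_def Int_def conj_commute)
  then show "\<exists>L>0. \<forall>\<^sub>F n in sequentially. measure M {w \<in> space M. norm (D n w) > L} < e"
    using L by auto
qed

text \<open>A factor tending to 0 in probability times a power of a tight sequence. Linear errors
  use \<open>k = 1\<close>, the error in a quadratic form uses \<open>k = 2\<close>.\<close>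

lemma (in prob_space) tendsto_prob_tight_mult:
  fixes D :: "nat \<Rightarrow> 'a \<Rightarrow> 'c::{real_normed_vector, second_countable_topology}"
    and R :: "nat \<Rightarrow> 'a \<Rightarrow> 'e::real_normed_vector"
  assumes A: "tendsto_prob M A a" and D: "tight_rv M D" and [measurable]: "\<And>n. D n \<in> borel_measurable M"
    and bound: "\<And>n w. w \<in> space M \<Longrightarrow> norm (R n w) \<le> K * dist (A n w) a * norm (D n w) ^ k" and K: "K > 0"
  shows "tendsto_prob M R 0"
proof (rule tendsto_probI)
  fix e :: real assume e: "e > 0"
  then have e2: "e / 2 > 0" by simp
  then obtain L where L: "L > 0" "\<forall>\<^sub>F n in sequentially. measure M {w \<in> space M. norm (D n w) > L} < e / 2"
    using D unfolding tight_rv_def by blast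
  have d: "e / (K * L ^ k) > 0" using e K L by simp
  obtain B where B: "\<And>n. B n \<in> sets M" "\<And>n w. w \<in> space M \<Longrightarrow> w \<notin> B n \<Longrightarrow> dist (A n w) a < e / (K * L ^ k)"
    "\<forall>\<^sub>F n in sequentially. measure M (B n) < e / 2" using tendsto_probE[OF A d e2] by blast
  let ?D = "\<lambda>n. {w \<in> space M. norm (D n w) > L}"
  have D: "?D n \<in> sets M" for n by measurable
  have "norm (R n w) < e" if w: "w \<in> space M" "w \<notin> B n \<union> ?D n" for n w
  proof -
    have "norm (R n w) \<le> K * dist (A n w) a * norm (D n w) ^ k" using bound w by blast
    also have "\<dots> \<le> K * dist (A n w) a * L ^ k"
      using w K by (intro mult_left_mono power_mono) auto
    also have "\<dots> < e" using B(2)[of w n] w K L by (auto simp: field_simps)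
    finally show ?thesis .
  qed
  then show "\<exists>A. (\<forall>n. A n \<in> sets M) \<and>
     (\<forall>n. \<forall>w\<in>space M. w \<notin> A n \<longrightarrow> dist (R n w) 0 < e) \<and> (\<forall>\<^sub>F n in sequentially. measure M (A n) < e)"
    using eventually_measure_union_less[OF B(1) D B(3) L(2)] B(1) D
    by (intro exI[of _ "\<lambda>n. B n \<union> ?D n"]) auto
qed

lemma norm_iexp_diff_le: "norm (iexp x - iexp y) \<le> \<bar>x - y\<bar>"
proof -
  have "iexp x - iexp y = iexp y * (iexp (x - y) - 1)"
    by (simp add: algebra_simps exp_add[symmetric])
  then have "norm (iexp x - iexp y) = norm (iexp (x - y) - 1)" by (simp add: norm_mult)
  also have "\<dots> \<le> \<bar>x - y\<bar>" using iexp_approx1[of "x - y" 0] by simp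
  finally show ?thesis .
qed

text \<open>Slutsky's argument for characteristic functions: \<open>iexp\<close> is Lipschitz with
  constant 1 where the difference is small and bounded by 1 on the exceptional event.\<close>

lemma (in prob_space) char_diff_tendsto_0:
  fixes Z W :: "nat \<Rightarrow> 'a \<Rightarrow> 'b::euclidean_space"
  assumes [measurable]: "\<And>n. Z n \<in> borel_measurable M" "\<And>n. W n \<in> borel_measurable M"
    and R: "tendsto_prob M (\<lambda>n w. Z n w - W n w) 0"
  shows "(\<lambda>n. (CLINT w|M. iexp (t \<bullet> Z n w)) - (CLINT w|M. iexp (t \<bullet> W n w))) \<longlonglongrightarrow> 0"
proof (rule tendstoI)
  fix e :: real assume e: "e > 0"
  \<comment> \<open>The added 1 keeps the divisor in \<open>d\<close> positive when
    \<open>t = 0\<close>.\<close>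
  define s where "s = norm t + 1"
  define d where "d = e / (2 * s)"
  have t: "s > 0" "norm t \<le> s" by (simp_all add: s_def add_nonneg_pos)
  have d: "d > 0" "e / 4 > 0" using e t by (simp_all add: d_def)
  obtain A where A: "\<And>n. A n \<in> sets M" "\<And>n w. w \<in> space M \<Longrightarrow> w \<notin> A n \<Longrightarrow> dist (Z n w - W n w) 0 < d"
    "\<forall>\<^sub>F n in sequentially. measure M (A n) < e / 4" using tendsto_probE[OF R d] by blast
  from A(3) show "\<forall>\<^sub>F n in sequentially. dist ((CLINT w|M. iexp (t \<bullet> Z n w)) - (CLINT w|M. iexp (t \<bullet> W n w))) 0 < e"
  proof eventually_elim
    case (elim n)
    have iZ: "complex_integrable M (\<lambda>w. iexp (t \<bullet> Z n w))" by (rule integrable_iexp) measurable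
    have iW: "complex_integrable M (\<lambda>w. iexp (t \<bullet> W n w))" by (rule integrable_iexp) measurable
    have iA: "integrable M (indicat_real (A n))"
      by (rule integrable_const_bound[where B=1]) (use A(1) in auto)
    have "norm ((CLINT w|M. iexp (t \<bullet> Z n w)) - (CLINT w|M. iexp (t \<bullet> W n w)))
        = norm (CLINT w|M. iexp (t \<bullet> Z n w) - iexp (t \<bullet> W n w))"
      using Bochner_Integration.integral_diff[OF iZ iW] by simp
    also have "\<dots> \<le> (LINT w|M. norm (iexp (t \<bullet> Z n w) - iexp (t \<bullet> W n w)))"
      by (rule integral_norm_bound)
    also have "\<dots> \<le> (LINT w|M. e / 2 + 2 * indicat_real (A n) w)"
    proof (rule integral_mono)
      fix w assume w: "w \<in> space M"
      show "norm (iexp (t \<bullet> Z n w) - iexp (t \<bullet> W n w)) \<le> e / 2 + 2 * indicat_real (A n) w"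
      proof (cases "w \<in> A n")
        case True
        have "norm (iexp (t \<bullet> Z n w) - iexp (t \<bullet> W n w)) \<le> 1 + 1"
          by (rule order_trans[OF norm_triangle_ineq4]) simp
        then show ?thesis using True e by simp
      next
        case False
        have "norm (iexp (t \<bullet> Z n w) - iexp (t \<bullet> W n w)) \<le> \<bar>t \<bullet> Z n w - t \<bullet> W n w\<bar>"
          by (rule norm_iexp_diff_le)
        also have "\<dots> = \<bar>t \<bullet> (Z n w - W n w)\<bar>" by (simp add: inner_diff_right)
        also have "\<dots> \<le> norm t * norm (Z n w - W n w)" by (rule Cauchy_Schwarz_ineq2)
        also have "\<dots> \<le> s * d"
          using A(2)[OF w False] t by (intro mult_mono) auto
        also have "\<dots> = e / 2" using t by (simp add: d_def)
        finally show ?thesis using False by simp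
      qed
    qed (use iZ iW iA in auto)
    also have "\<dots> = e / 2 + 2 * measure M (A n)"
      using iA A(1)[of n] sets.sets_into_space by (simp add: prob_space Int_absorb2)
    also have "\<dots> < e" using elim e by simp
    finally show ?case by simp
  qed
qed

text \<open>Preimages of rectangles are intersections of events from the two generated
  sigma-algebras, and rectangles determine a product measure.\<close>

lemma indep_rv_distr:
  assumes M: "prob_space M" and ind: "indep_rv M N Z N' Z'"
  shows "distr M (N \<Otimes>\<^sub>M N') (\<lambda>w. (Z w, Z' w)) = distr M N Z \<Otimes>\<^sub>M distr M N' Z'"
proof -
  interpret prob_space M by fact
  have [measurable]: "Z \<in> measurable M N" "Z' \<in> measurable M N'"
    and i: "indep_set (sets (generated_by M N Z)) (sets (generated_by M N' Z'))"
    using ind by (auto simp: indep_rv_def)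
  interpret Z: prob_space "distr M N Z" by (rule prob_space_distr) measurable
  interpret Z': prob_space "distr M N' Z'" by (rule prob_space_distr) measurable
  show ?thesis
  proof (rule pair_measure_eqI[symmetric])
    show "emeasure (distr M N Z) A * emeasure (distr M N' Z') B = emeasure (distr M (N \<Otimes>\<^sub>M N') (\<lambda>w. (Z w, Z' w))) (A \<times> B)"
      if "A \<in> sets (distr M N Z)" "B \<in> sets (distr M N' Z')" for A B
    proof -
      have [measurable]: "A \<in> sets N" "B \<in> sets N'" using that by auto
      let ?A = "Z -` A \<inter> space M" and ?B = "Z' -` B \<inter> space M"
      have "?A \<in> sets (generated_by M N Z)" "?B \<in> sets (generated_by M N' Z')"
        unfolding generated_by_def by (auto intro!: in_vimage_algebra)
      then have "prob (?A \<inter> ?B) = prob ?A * prob ?B" by (rule indep_setD[OF i])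
      then have "emeasure M (?A \<inter> ?B) = emeasure M ?A * emeasure M ?B"
        by (simp add: emeasure_eq_measure ennreal_mult)
      moreover have "?A \<inter> ?B = (\<lambda>w. (Z w, Z' w)) -` (A \<times> B) \<inter> space M" by auto
      ultimately show ?thesis by (simp add: emeasure_distr)
    qed
    show "sets (distr M N Z \<Otimes>\<^sub>M distr M N' Z') = sets (distr M (N \<Otimes>\<^sub>M N') (\<lambda>w. (Z w, Z' w)))"
      by (simp cong: sets_pair_measure_cong)
  qed (rule Z.sigma_finite_measure Z'.sigma_finite_measure prob_space_imp_sigma_finite; fact?)+
qed

section \<open>Second moments of random vectors\<close>

lemma borel_measurable_vec_nth' [measurable (raw)]:
  fixes F :: "'w \<Rightarrow> 'b::euclidean_space ^ 'n"
  shows "F \<in> borel_measurable M \<Longrightarrow> (\<lambda>w. F w $ k) \<in> borel_measurable M"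
  by (rule borel_measurable_continuous_on[where f="\<lambda>x. x $ k"]) (auto intro: continuous_intros)

lemma bounded_linear_axis: "bounded_linear (axis k :: 'b::euclidean_space \<Rightarrow> 'b ^ 'n)"
proof (rule bounded_linear_intro[where K=1])
  show "norm (axis k x :: 'b ^ 'n) \<le> norm x * 1" for x
    by (simp add: norm_eq_sqrt_inner inner_axis_axis)
qed (auto simp: vec_eq_iff axis_def)

lemma vec_eq_sum_axis: "F = (\<lambda>w. \<Sum>k\<in>UNIV. axis k (F w $ k))" for F :: "'w \<Rightarrow> 'b::euclidean_space ^ 'n"
  by (simp add: fun_eq_iff vec_eq_iff axis_def)

lemma integrable_vec:
  fixes F :: "'w \<Rightarrow> 'b::euclidean_space ^ 'n"
  assumes "\<And>k. integrable M (\<lambda>w. F w $ k)"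
  shows "integrable M F"
  by (subst vec_eq_sum_axis)
     (intro Bochner_Integration.integrable_sum integrable_bounded_linear[OF bounded_linear_axis] assms)

lemma borel_measurable_vec:
  fixes F :: "'w \<Rightarrow> 'b::euclidean_space ^ 'n"
  assumes "\<And>k. (\<lambda>w. F w $ k) \<in> borel_measurable M"
  shows "F \<in> borel_measurable M"
  by (subst vec_eq_sum_axis)
     (intro borel_measurable_sum borel_measurable_continuous_on[OF linear_continuous_on[OF bounded_linear_axis]] assms)

lemma integral_vec_nth:
  fixes F :: "'w \<Rightarrow> 'b::euclidean_space ^ 'n"
  assumes "integrable M F"
  shows "(LINT w|M. F w) $ k = (LINT w|M. F w $ k)"
  using integral_bounded_linear[OF bounded_linear_vec_nth assms] by simp

definition square_integrable :: "'w measure \<Rightarrow> ('w \<Rightarrow> real ^ 'n) \<Rightarrow> bool" where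
  "square_integrable M Z \<longleftrightarrow> Z \<in> borel_measurable M \<and> integrable M (\<lambda>w. (norm (Z w))\<^sup>2)"

lemma square_integrable_measurable: "square_integrable M Z \<Longrightarrow> Z \<in> borel_measurable M"
  by (simp add: square_integrable_def)

lemma square_integrable_add:
  assumes "square_integrable M Z" "square_integrable M W"
  shows "square_integrable M (\<lambda>w. Z w + W w)"
proof -
  have [measurable]: "Z \<in> borel_measurable M" "W \<in> borel_measurable M"
    using assms by (auto simp: square_integrable_def)
  have bound: "(norm (Z w + W w))\<^sup>2 \<le> 2 * (norm (Z w))\<^sup>2 + 2 * (norm (W w))\<^sup>2" for w
  proof -
    have "(norm (Z w + W w))\<^sup>2 \<le> (norm (Z w) + norm (W w))\<^sup>2"
      by (intro power_mono norm_triangle_ineq) simp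
    also have "\<dots> \<le> 2 * (norm (Z w))\<^sup>2 + 2 * (norm (W w))\<^sup>2"
      using zero_le_power2[of "norm (Z w) - norm (W w)"] by (simp add: power2_diff power2_sum)
    finally show ?thesis .
  qed
  have "integrable M (\<lambda>w. (norm (Z w + W w))\<^sup>2)"
  proof (rule Bochner_Integration.integrable_bound[of _ "\<lambda>w. 2 * (norm (Z w))\<^sup>2 + 2 * (norm (W w))\<^sup>2"])
    show "integrable M (\<lambda>w. 2 * (norm (Z w))\<^sup>2 + 2 * (norm (W w))\<^sup>2)"
      using assms by (simp add: square_integrable_def)
    show "AE w in M. norm ((norm (Z w + W w))\<^sup>2) \<le> norm (2 * (norm (Z w))\<^sup>2 + 2 * (norm (W w))\<^sup>2)"
      by (rule AE_I2) (simp add: bound)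
  qed simp
  then show ?thesis by (simp add: square_integrable_def)
qed

lemma square_integrable_scaleR: "square_integrable M Z \<Longrightarrow> square_integrable M (\<lambda>w. c *\<^sub>R Z w)"
  unfolding square_integrable_def by (simp add: power_mult_distrib borel_measurable_scaleR)

lemma square_integrable_const: "prob_space M \<Longrightarrow> square_integrable M (\<lambda>w. c)"
  using prob_space.finite_measure[THEN finite_measure.integrable_const] by (auto simp: square_integrable_def)

lemma square_integrable_sum:
  "prob_space M \<Longrightarrow> (\<And>i. i \<in> I \<Longrightarrow> square_integrable M (Z i)) \<Longrightarrow> square_integrable M (\<lambda>w. \<Sum>i\<in>I. Z i w)"
  by (induction I rule: infinite_finite_induct) (auto intro: square_integrable_const square_integrable_add)

lemma square_integrable_mult:
  assumes "square_integrable M Z"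
  shows "integrable M (\<lambda>w. Z w $ i * Z w $ j)"
proof (rule Bochner_Integration.integrable_bound)
  have [measurable]: "Z \<in> borel_measurable M" using assms by (auto simp: square_integrable_def)
  show "(\<lambda>w. Z w $ i * Z w $ j) \<in> borel_measurable M" by measurable
  show "AE w in M. norm (Z w $ i * Z w $ j) \<le> norm ((norm (Z w))\<^sup>2)"
    by (rule AE_I2) (simp add: abs_mult power2_eq_square mult_mono component_le_norm_cart)
qed (use assms in \<open>simp add: square_integrable_def\<close>)

lemma square_integrable_inner:
  assumes "square_integrable M Z"
  shows "integrable M (\<lambda>w. (c \<bullet> Z w)\<^sup>2)"
proof (rule Bochner_Integration.integrable_bound)
  have [measurable]: "Z \<in> borel_measurable M" using assms by (rule square_integrable_measurable)
  show "integrable M (\<lambda>w. (norm c)\<^sup>2 * (norm (Z w))\<^sup>2)" using assms by (simp add: square_integrable_def)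
  show "AE w in M. norm ((c \<bullet> Z w)\<^sup>2) \<le> norm ((norm c)\<^sup>2 * (norm (Z w))\<^sup>2)"
    by (rule AE_I2) (simp add: power_mult_distrib[symmetric] abs_le_square_iff[symmetric] Cauchy_Schwarz_ineq2)
  show "(\<lambda>w. (c \<bullet> Z w)\<^sup>2) \<in> borel_measurable M" by measurable
qed

lemma square_integrable_integrable:
  assumes M: "prob_space M" and Z: "square_integrable M Z"
  shows "integrable M Z"
proof -
  interpret prob_space M by fact
  have [measurable]: "Z \<in> borel_measurable M" using Z by (auto simp: square_integrable_def)
  show ?thesis
  proof (rule Bochner_Integration.integrable_bound)
    show "integrable M (\<lambda>w. 1 + (norm (Z w))\<^sup>2)" using Z by (simp add: square_integrable_def)
    show "AE w in M. norm (Z w) \<le> norm (1 + (norm (Z w))\<^sup>2)"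
    proof (rule AE_I2)
      fix w
      have "norm (Z w) \<le> 1 + (norm (Z w))\<^sup>2"
      proof -
        have "2 * norm (Z w) \<le> (norm (Z w))\<^sup>2 + 1"
          using zero_le_power2[of "norm (Z w) - 1"] by (simp add: power2_diff)
        then show ?thesis using norm_ge_zero[of "Z w"] by linarith
      qed
      then show "norm (Z w) \<le> norm (1 + (norm (Z w))\<^sup>2)" by simp
    qed
  qed simp
qed

lemma integrable_outer:
  assumes "square_integrable M Z"
  shows "integrable M (\<lambda>w. outer (Z w) (Z w))"
  by (intro integrable_vec) (simp add: outer_def square_integrable_mult[OF assms])

lemma integral_outer_nth:
  assumes "square_integrable M Z"
  shows "(LINT w|M. outer (Z w) (Z w)) $ i $ j = (LINT w|M. Z w $ i * Z w $ j)"
proof -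
  have i: "integrable M (\<lambda>w. outer (Z w) (Z w) $ i)"
    by (intro integrable_vec) (simp add: outer_def square_integrable_mult[OF assms])
  show ?thesis
    unfolding integral_vec_nth[OF integrable_outer[OF assms]] integral_vec_nth[OF i] by (simp add: outer_def)
qed

lemma outer_mult: "outer v w *v x = (w \<bullet> x) *\<^sub>R v"
  by (simp add: vec_eq_iff outer_def matrix_vector_mult_def inner_vec_def sum_distrib_left mult_ac)

lemma quadratic_integral_outer:
  assumes "square_integrable M Z"
  shows "c \<bullet> ((LINT w|M. outer (Z w) (Z w)) *v d) = (LINT w|M. (c \<bullet> Z w) * (d \<bullet> Z w))"
proof -
  interpret mv: bounded_bilinear "\<lambda>(A :: real ^ 'b ^ 'b) (x :: real ^ 'b). A *v x"
    by (rule bounded_bilinear_matrix_vector_mult)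
  have bl: "bounded_linear (\<lambda>A :: real ^ 'b ^ 'b. c \<bullet> (A *v d))"
    by (intro bounded_linear_inner_right_comp mv.bounded_linear_left)
  have "c \<bullet> ((LINT w|M. outer (Z w) (Z w)) *v d) = (LINT w|M. c \<bullet> (outer (Z w) (Z w) *v d))"
    by (rule integral_bounded_linear[OF bl integrable_outer[OF assms], symmetric])
  then show ?thesis by (simp add: outer_mult inner_commute mult.commute)
qed

lemma pos_semidefinite_integral_outer:
  assumes "square_integrable M Z"
  shows "pos_semidefinite (LINT w|M. outer (Z w) (Z w))"
  by (auto simp: pos_semidefinite_def quadratic_integral_outer[OF assms] vec_eq_iff transpose_def
      integral_outer_nth[OF assms] mult.commute)

section \<open>Sums with random kernel weights\<close>

text \<open>The substitution \<open>v = h n * u\<close> leaves \<open>f (h n * u) * Q u\<close>,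
  which converges by continuity at 0 and is dominated because \<open>f\<close> is bounded. It is
  applied to \<open>Q = K\<close> and to the square of \<open>K\<close>.\<close>

lemma kernel_integral_tendsto:
  fixes f Q :: "real \<Rightarrow> real"
  assumes [measurable]: "f \<in> borel_measurable borel" and f: "\<And>x. \<bar>f x\<bar> \<le> B" "isCont f 0"
    and Q: "integrable lborel Q" and h: "h \<longlonglongrightarrow> 0" "\<And>n. n \<ge> 1 \<Longrightarrow> h n > (0::real)"
  shows "(\<lambda>n. (LINT v|lborel. f v * Q (v / h n)) / h n) \<longlonglongrightarrow> f 0 * (LINT u|lborel. Q u)"
proof -
  have [measurable]: "Q \<in> borel_measurable borel" using borel_measurable_integrable[OF Q] by simp
  have "(\<lambda>n. LINT u|lborel. f (h n * u) * Q u) \<longlonglongrightarrow> (LINT u|lborel. f 0 * Q u)"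
  proof (rule integral_dominated_convergence[where w="\<lambda>u. B * \<bar>Q u\<bar>"])
    show "AE u in lborel. (\<lambda>n. f (h n * u) * Q u) \<longlonglongrightarrow> f 0 * Q u"
    proof (rule AE_I2)
      fix u
      have "(\<lambda>n. h n * u) \<longlonglongrightarrow> 0 * u" by (intro tendsto_intros h)
      then have "(\<lambda>n. f (h n * u)) \<longlonglongrightarrow> f 0" by (intro isCont_tendsto_compose[OF f(2)]) simp
      then show "(\<lambda>n. f (h n * u) * Q u) \<longlonglongrightarrow> f 0 * Q u" by (intro tendsto_intros)
    qed
    show "AE u in lborel. norm (f (h n * u) * Q u) \<le> B * \<bar>Q u\<bar>" for n
      by (intro AE_I2) (auto simp: abs_mult intro!: mult_right_mono f)
  qed (use Q in auto)
  then have "(\<lambda>n. LINT u|lborel. f (h n * u) * Q u) \<longlonglongrightarrow> f 0 * (LINT u|lborel. Q u)" by simp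
  moreover have "\<forall>\<^sub>F n in sequentially. (LINT u|lborel. f (h n * u) * Q u) = (LINT v|lborel. f v * Q (v / h n)) / h n"
    using eventually_ge_at_top[of 1]
  proof eventually_elim
    case (elim n)
    then have hn: "h n > 0" by (rule h)
    then show ?case
      using lborel_integral_real_affine[of "h n" "\<lambda>v. f v * Q (v / h n)" 0] by simp
  qed
  ultimately show ?thesis by (rule Lim_transform_eventually)
qed

text \<open>The bound by \<open>y\<close> matters for large arguments, the bound by its square for
  small ones; their minimum has the shape of the Lindeberg remainder below.\<close>

lemma exp_linear_error:
  fixes y :: real
  assumes "y \<ge> 0"
  shows "\<bar>exp (- y) - (1 - y)\<bar> \<le> y * min 1 y"
proof -
  have "1 - y \<le> exp (- y)" using exp_ge_add_one_self[of "- y"] by simp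
  moreover have "exp (- y) \<le> 1" using assms by simp
  moreover have "exp (- y) \<le> 1 - y + y\<^sup>2"
  proof -
    have "exp (- y) \<le> 1 / (1 + y)"
      using exp_ge_add_one_self[of y] assms by (simp add: exp_minus field_simps)
    \<comment> \<open>The product on the right is \<open>1 + y ^ 3\<close>.\<close>
    also have "1 \<le> (1 - y + y\<^sup>2) * (1 + y)"
      using assms by (simp add: algebra_simps power2_eq_square)
    then have "1 / (1 + y) \<le> 1 - y + y\<^sup>2" using assms by (simp add: divide_le_eq)
    finally show ?thesis .
  qed
  ultimately show ?thesis using assms by (auto simp: min_def abs_le_iff power2_eq_square)
qed

text \<open>The characteristic functions \<open>\<phi> n\<close> of the weights enter only through their expansion at 0;
  the Lindeberg remainder vanishes by dominated convergence.\<close>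

lemma (in prob_space) weighted_char_product_tendsto:
  fixes x :: "nat \<Rightarrow> 'a \<Rightarrow> real" and \<phi> :: "nat \<Rightarrow> real \<Rightarrow> complex" and v \<delta> :: "nat \<Rightarrow> real"
  assumes x: "\<And>i. x i \<in> borel_measurable M" "\<And>i. distr M borel (x i) = distr M borel (x 0)"
    and x2: "integrable M (\<lambda>w. (x 0 w)\<^sup>2)"
    and lln: "AE w in M. (\<lambda>n. (\<Sum>i<n. (x i w)\<^sup>2) / n) \<longlonglongrightarrow> m"
    and \<phi>m: "\<And>n. \<phi> n \<in> borel_measurable borel"
    and \<phi>1: "\<And>n t. norm (\<phi> n t) \<le> 1"
    and \<phi>: "\<forall>\<^sub>F n in sequentially. \<forall>t. norm (\<phi> n t - of_real (1 - t\<^sup>2 * v n / 2)) \<le> t\<^sup>2 * v n * min 1 (\<bar>t\<bar> * \<delta> n)"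
    and v: "\<And>n. v n \<ge> 0" "(\<lambda>n. n * v n) \<longlonglongrightarrow> s"
    and \<delta>: "\<And>n. \<delta> n \<ge> 0" "\<delta> \<longlonglongrightarrow> 0"
  shows "(\<lambda>n. CLINT w|M. (\<Prod>i<n. \<phi> n (x i w))) \<longlonglongrightarrow> of_real (exp (- (s * m) / 2))"
proof -
  note [measurable] = x(1) \<phi>m
  have v0: "v \<longlonglongrightarrow> 0"
  proof -
    have "(\<lambda>n. (n * v n) * (1 / real n)) \<longlonglongrightarrow> s * 0" by (intro tendsto_mult v lim_1_over_n)
    then have "(\<lambda>n. (n * v n) * (1 / real n)) \<longlonglongrightarrow> 0" by simp
    then show ?thesis
      by (rule Lim_transform_eventually)
         (use eventually_gt_at_top[of 0] in eventually_elim, simp)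
  qed
  \<comment> \<open>\<open>v n * G n t\<close> will bound the distance of \<open>\<phi> n t\<close>
    from the Gaussian factor with the same variance: the first minimum is the assumed expansion
    error, the second comes from \<open>exp_linear_error\<close>.\<close>
  define G where "G n t = t\<^sup>2 * (min 1 (\<bar>t\<bar> * \<delta> n) + min 1 (t\<^sup>2 * v n))" for n t
  have [measurable]: "G n \<in> borel_measurable borel" for n unfolding G_def by measurable
  have G: "0 \<le> G n t" "G n t \<le> 2 * t\<^sup>2" for n t
  proof -
    have a: "0 \<le> min 1 (\<bar>t\<bar> * \<delta> n)" "0 \<le> min 1 (t\<^sup>2 * v n)" using \<delta> v by auto
    then show "0 \<le> G n t" by (simp add: G_def)
    have "min 1 (\<bar>t\<bar> * \<delta> n) + min 1 (t\<^sup>2 * v n) \<le> 2" by linarith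
    then have "t\<^sup>2 * (min 1 (\<bar>t\<bar> * \<delta> n) + min 1 (t\<^sup>2 * v n)) \<le> t\<^sup>2 * 2" by (rule mult_left_mono) simp
    then show "G n t \<le> 2 * t\<^sup>2" by (simp add: G_def)
  qed
  have iG0: "integrable M (\<lambda>w. G n (x 0 w))" for n
    by (rule Bochner_Integration.integrable_bound[of _ "\<lambda>w. 2 * (x 0 w)\<^sup>2"]) (use G x2 in auto)
  have iG: "integrable M (\<lambda>w. G n (x i w))" for n i
    using iG0[of n] integrable_distr_eq[of "x i" M borel "G n"] integrable_distr_eq[of "x 0" M borel "G n"] x(2)[of i] by simp
  have EG: "(LINT w|M. G n (x i w)) = (LINT w|M. G n (x 0 w))" for n i
    using integral_distr[of "x i" M borel "G n"] integral_distr[of "x 0" M borel "G n"] x(2)[of i] by simp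
  have EG0: "(\<lambda>n. LINT w|M. G n (x 0 w)) \<longlonglongrightarrow> (LINT w|M. 0)"
  proof (rule integral_dominated_convergence[where w="\<lambda>w. 2 * (x 0 w)\<^sup>2"])
    show "AE w in M. (\<lambda>n. G n (x 0 w)) \<longlonglongrightarrow> 0"
    proof (rule AE_I2)
      fix w
      have "(\<lambda>n. G n (x 0 w)) \<longlonglongrightarrow> (x 0 w)\<^sup>2 * (min 1 (\<bar>x 0 w\<bar> * 0) + min 1 ((x 0 w)\<^sup>2 * 0))"
        unfolding G_def by (intro tendsto_intros \<delta> v0)
      then show "(\<lambda>n. G n (x 0 w)) \<longlonglongrightarrow> 0" by simp
    qed
  qed (use G x2 in auto)
  \<comment> \<open>The product of these Gaussian factors depends on the data only through the sum
    of squares, to which the law of large numbers applies.\<close>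
  define \<psi> where "\<psi> n t = complex_of_real (exp (- (t\<^sup>2 * v n / 2)))" for n t
  have \<psi>1: "norm (\<psi> n t) \<le> 1" for n t using v by (simp add: \<psi>_def)
  have [measurable]: "\<psi> n \<in> borel_measurable borel" for n unfolding \<psi>_def by measurable
  have i1: "complex_integrable M (\<lambda>w. \<Prod>i<n. \<phi> n (x i w))" for n
    by (rule integrable_const_bound[where B=1]) (auto simp: prod_norm[symmetric] intro!: prod_le_1 \<phi>1)
  have i2: "complex_integrable M (\<lambda>w. \<Prod>i<n. \<psi> n (x i w))" for n
    by (rule integrable_const_bound[where B=1]) (auto simp: prod_norm[symmetric] intro!: prod_le_1 \<psi>1)
  \<comment> \<open>Products of numbers in the unit disc differ by at most the sum of the
    differences of their factors. Equality of the laws makes all expectations equal, so the bound is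
    \<open>n * v n\<close>, which converges, times a vanishing integral.\<close>
  have diff: "(\<lambda>n. (CLINT w|M. (\<Prod>i<n. \<phi> n (x i w))) - (CLINT w|M. (\<Prod>i<n. \<psi> n (x i w)))) \<longlonglongrightarrow> 0"
  proof (rule Lim_null_comparison)
    have "(\<lambda>n. n * v n * (LINT w|M. G n (x 0 w))) \<longlonglongrightarrow> s * (LINT w|M. 0)"
      by (intro tendsto_mult v EG0)
    then show "(\<lambda>n. n * v n * (LINT w|M. G n (x 0 w))) \<longlonglongrightarrow> 0" by simp
    show "\<forall>\<^sub>F n in sequentially. norm ((CLINT w|M. (\<Prod>i<n. \<phi> n (x i w))) - (CLINT w|M. (\<Prod>i<n. \<psi> n (x i w))))
        \<le> n * v n * (LINT w|M. G n (x 0 w))"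
      using \<phi>
    proof eventually_elim
      case (elim n)
      have one: "norm (\<phi> n t - \<psi> n t) \<le> v n * G n t" for t
      proof -
        let ?y = "t\<^sup>2 * v n / 2"
        have y: "?y \<ge> 0" using v by simp
        have "norm (\<phi> n t - \<psi> n t) \<le> norm (\<phi> n t - of_real (1 - ?y)) + norm (of_real (1 - ?y) - \<psi> n t)"
          using norm_triangle_ineq[of "\<phi> n t - of_real (1 - ?y)" "of_real (1 - ?y) - \<psi> n t"] by simp
        moreover have "norm (of_real (1 - ?y) - \<psi> n t) \<le> ?y * min 1 ?y"
          unfolding \<psi>_def of_real_diff[symmetric] norm_of_real using exp_linear_error[OF y] by (simp add: abs_minus_commute)
        moreover have "?y * min 1 ?y \<le> (t\<^sup>2 * v n) * min 1 (t\<^sup>2 * v n)"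
          using mult_nonneg_nonneg[OF zero_le_power2[of t] v(1)[of n]]
          by (intro mult_mono) (auto simp: min_def mult.commute)
        ultimately show ?thesis using elim[rule_format, of t] by (simp add: G_def algebra_simps)
      qed
      have "norm ((CLINT w|M. (\<Prod>i<n. \<phi> n (x i w))) - (CLINT w|M. (\<Prod>i<n. \<psi> n (x i w))))
          = norm (CLINT w|M. (\<Prod>i<n. \<phi> n (x i w)) - (\<Prod>i<n. \<psi> n (x i w)))"
        using Bochner_Integration.integral_diff[OF i1 i2] by simp
      also have "\<dots> \<le> (LINT w|M. norm ((\<Prod>i<n. \<phi> n (x i w)) - (\<Prod>i<n. \<psi> n (x i w))))"
        by (rule integral_norm_bound)
      also have "\<dots> \<le> (LINT w|M. (\<Sum>i<n. v n * G n (x i w)))"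
      proof (rule integral_mono)
        fix w
        have "norm ((\<Prod>i<n. \<phi> n (x i w)) - (\<Prod>i<n. \<psi> n (x i w))) \<le> (\<Sum>i<n. norm (\<phi> n (x i w) - \<psi> n (x i w)))"
          by (rule norm_prod_diff) (auto intro: \<phi>1 \<psi>1)
        also have "\<dots> \<le> (\<Sum>i<n. v n * G n (x i w))" by (intro sum_mono one)
        finally show "norm ((\<Prod>i<n. \<phi> n (x i w)) - (\<Prod>i<n. \<psi> n (x i w))) \<le> (\<Sum>i<n. v n * G n (x i w))" .
      qed (use i1 i2 iG in auto)
      also have "\<dots> = (\<Sum>i<n. v n * (LINT w|M. G n (x i w)))"
        using iG by simp
      also have "\<dots> = (\<Sum>i<n. v n * (LINT w|M. G n (x 0 w)))"
        by (intro sum.cong refl arg_cong2[where f="(*)"] EG)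
      also have "\<dots> = n * v n * (LINT w|M. G n (x 0 w))" by simp
      finally show ?case .
    qed
  qed
  have lim: "(\<lambda>n. CLINT w|M. (\<Prod>i<n. \<psi> n (x i w))) \<longlonglongrightarrow> (CLINT w|M. of_real (exp (- (s * m) / 2)))"
  proof (rule integral_dominated_convergence[where w="\<lambda>_. 1"])
    show "AE w in M. (\<lambda>n. \<Prod>i<n. \<psi> n (x i w)) \<longlonglongrightarrow> of_real (exp (- (s * m) / 2))"
      using lln
    proof eventually_elim
      case (elim w)
      have "(\<lambda>n. complex_of_real (exp (- ((n * v n) * ((\<Sum>i<n. (x i w)\<^sup>2) / n)) / 2))) \<longlonglongrightarrow> of_real (exp (- (s * m) / 2))"
        by (intro tendsto_intros v elim) simp
      moreover have "complex_of_real (exp (- ((n * v n) * ((\<Sum>i<n. (x i w)\<^sup>2) / n)) / 2)) = (\<Prod>i<n. \<psi> n (x i w))" for n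
      proof -
        have "(\<Prod>i<n. \<psi> n (x i w)) = of_real (exp (\<Sum>i<n. - ((x i w)\<^sup>2 * v n / 2)))"
          by (simp add: \<psi>_def exp_sum)
        also have "(\<Sum>i<n. - ((x i w)\<^sup>2 * v n / 2)) = - ((\<Sum>i<n. (x i w)\<^sup>2) * v n) / 2"
          by (simp add: sum_negf sum_distrib_right sum_divide_distrib)
        also have "\<dots> = - ((n * v n) * ((\<Sum>i<n. (x i w)\<^sup>2) / n)) / 2"
          by (cases "n = 0") simp_all
        finally show ?thesis by simp
      qed
      ultimately show ?case by simp
    qed
    show "AE w in M. norm (\<Prod>i<n. \<psi> n (x i w)) \<le> 1" for n
      by (auto simp: prod_norm[symmetric] intro!: prod_le_1 \<psi>1)
  qed auto
  show ?thesis
    using tendsto_add[OF diff lim] by (simp add: prob_space)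
qed


text \<open>The joint law of the two paths is a product, so by Fubini the \<open>V\<close> path is
  integrated out first with the \<open>U\<close> path frozen; the inner integral factorizes since
  the \<open>V i\<close> are independent and identically distributed.\<close>

lemma char_weighted_sum:
  fixes U :: "nat \<Rightarrow> 'w \<Rightarrow> real ^ 'n" and V :: "nat \<Rightarrow> 'w \<Rightarrow> real" and e :: "real \<Rightarrow> real"
  assumes M: "prob_space M"
    and V: "prob_space.indep_vars M (\<lambda>_. borel) V UNIV" "\<And>i. distr M borel (V i) = distr M borel (V 0)"
    and UV: "indep_rv M (PiM UNIV (\<lambda>_. borel)) (\<lambda>w i. U i w) (PiM UNIV (\<lambda>_. borel)) (\<lambda>w i. V i w)"
    and e [measurable]: "e \<in> borel_measurable borel"
  shows "(CLINT w|M. iexp (\<Sum>i<n. (c \<bullet> U i w) * e (V i w)))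
    = (CLINT w|M. \<Prod>i<n. char (distr M borel (\<lambda>w. e (V 0 w))) (c \<bullet> U i w))"
proof -
  interpret prob_space M by fact
  let ?PU = "PiM UNIV (\<lambda>_. borel) :: (nat \<Rightarrow> real ^ 'n) measure" and ?PV = "PiM UNIV (\<lambda>_. borel) :: (nat \<Rightarrow> real) measure"
  have [measurable]: "(\<lambda>w i. U i w) \<in> measurable M ?PU" "(\<lambda>w i. V i w) \<in> measurable M ?PV"
    using UV by (auto simp: indep_rv_def)
  have Vm [measurable]: "V i \<in> borel_measurable M" for i
    using V(1) by (auto simp: indep_vars_def)
  let ?DU = "distr M ?PU (\<lambda>w i. U i w)" and ?DV = "distr M ?PV (\<lambda>w i. V i w)"
  interpret DU: prob_space ?DU by (rule prob_space_distr) measurable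
  interpret DV: prob_space ?DV by (rule prob_space_distr) measurable
  interpret D: pair_sigma_finite ?DU ?DV ..
  interpret DD: prob_space "?DU \<Otimes>\<^sub>M ?DV"
    by (rule prob_space_pair[OF DU.prob_space_axioms DV.prob_space_axioms])
  let ?F = "\<lambda>p. iexp (\<Sum>i<n. (c \<bullet> fst p i) * e (snd p i))"
  have F [measurable]: "(\<lambda>p. \<Sum>i<n. (c \<bullet> fst p i) * e (snd p i)) \<in> borel_measurable (?PU \<Otimes>\<^sub>M ?PV)"
    by measurable
  have int: "complex_integrable (?DU \<Otimes>\<^sub>M ?DV) ?F"
    by (rule DD.integrable_iexp) (use F in \<open>simp cong: measurable_cong_sets sets_pair_measure_cong\<close>)
  have inner: "(CLINT v|?DV. iexp (\<Sum>i<n. t i * e (v i))) = (\<Prod>i<n. char (distr M borel (\<lambda>w. e (V 0 w))) (t i))" for t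
  proof -
    have ch: "(CLINT w|M. iexp (t i * e (V i w))) = char (distr M borel (\<lambda>w. e (V 0 w))) (t i)" for i
    proof -
      have "(CLINT w|M. iexp (t i * e (V i w))) = (CLINT v|distr M borel (V i). iexp (t i * e v))"
        by (subst integral_distr) auto
      also have "\<dots> = (CLINT w|M. iexp (t i * e (V 0 w)))"
        unfolding V(2)[of i] by (subst integral_distr) auto
      also have "\<dots> = char (distr M borel (\<lambda>w. e (V 0 w))) (t i)"
        unfolding char_def by (subst integral_distr) auto
      finally show ?thesis .
    qed
    have ind: "indep_vars (\<lambda>_. borel) (\<lambda>i w. iexp (t i * e (V i w))) {..<n}"
      by (rule indep_vars_compose2[OF indep_vars_subset[OF V(1)], where Y="\<lambda>i v. iexp (t i * e v)"]) auto
    have "(CLINT v|?DV. iexp (\<Sum>i<n. t i * e (v i))) = (CLINT w|M. iexp (\<Sum>i<n. t i * e (V i w)))"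
      by (subst integral_distr) auto
    also have "\<dots> = (CLINT w|M. \<Prod>i<n. iexp (t i * e (V i w)))"
      by (simp add: sum_distrib_left exp_sum)
    also have "\<dots> = (\<Prod>i<n. CLINT w|M. iexp (t i * e (V i w)))"
    proof (rule indep_vars_lebesgue_integral[OF _ ind])
      show "complex_integrable M (\<lambda>w. iexp (t i * e (V i w)))" for i
        by (rule integrable_iexp) measurable
    qed simp
    finally show ?thesis by (simp only: ch)
  qed
  have "(CLINT w|M. iexp (\<Sum>i<n. (c \<bullet> U i w) * e (V i w)))
      = (CLINT p|distr M (?PU \<Otimes>\<^sub>M ?PV) (\<lambda>w. (\<lambda>i. U i w, \<lambda>i. V i w)). ?F p)"
    by (subst integral_distr) auto
  also have "\<dots> = (CLINT p|?DU \<Otimes>\<^sub>M ?DV. ?F p)"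
    unfolding indep_rv_distr[OF M UV] ..
  also have "\<dots> = (CLINT u|?DU. CLINT v|?DV. ?F (u, v))"
    by (rule D.integral_fst'[OF int, symmetric])
  also have "\<dots> = (CLINT u|?DU. \<Prod>i<n. char (distr M borel (\<lambda>w. e (V 0 w))) (c \<bullet> u i))"
    using inner by simp
  also have "\<dots> = (CLINT w|M. \<Prod>i<n. char (distr M borel (\<lambda>w. e (V 0 w))) (c \<bullet> U i w))"
  proof -
    have "real_distribution (distr M borel (\<lambda>w. e (V 0 w)))"
      by (rule real_distribution_distr) measurable
    then have [measurable]: "char (distr M borel (\<lambda>w. e (V 0 w))) \<in> borel_measurable borel"
      by (rule real_distribution.char_measurable)
    show ?thesis by (subst integral_distr) auto
  qed
  finally show ?thesis .
qed

definition smoothing_weight :: "'w measure \<Rightarrow> (nat \<Rightarrow> 'w \<Rightarrow> real) \<Rightarrow> (real \<Rightarrow> real) \<Rightarrow> (nat \<Rightarrow> real) \<Rightarrow> nat \<Rightarrow> real \<Rightarrow> real" where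
  "smoothing_weight M V K h n v = sqrt (h n / n) * (K (v / h n) / (LINT w|M. K (V 0 w / h n)) - 1)"

lemma smoothed_sum_char_tendsto:
  fixes U :: "nat \<Rightarrow> 'w \<Rightarrow> real ^ 'n" and V :: "nat \<Rightarrow> 'w \<Rightarrow> real" and f K :: "real \<Rightarrow> real"
  assumes M: "prob_space M"
    and V: "prob_space.indep_vars M (\<lambda>_. borel) V UNIV" "\<And>i. distributed M lborel (V i) (\<lambda>x. ennreal (f x))"
    and UV: "indep_rv M (PiM UNIV (\<lambda>_. borel)) (\<lambda>w i. U i w) (PiM UNIV (\<lambda>_. borel)) (\<lambda>w i. V i w)"
    and f: "\<And>x. f x \<ge> 0" "bounded (range f)" "isCont f 0" "f 0 > 0"
    and K: "K \<in> borel_measurable borel" "integrable lborel K" "(LINT u|lborel. K u) = 1" "bounded (range K)"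
      "integrable lborel (\<lambda>u. (K u)\<^sup>2)"
    and h: "\<And>n. n \<ge> 1 \<Longrightarrow> h n > 0" "h \<longlonglongrightarrow> 0" "filterlim (\<lambda>n. real n * h n) at_top sequentially"
    and U: "\<And>i. U i \<in> borel_measurable M" "\<And>i. distr M borel (U i) = distr M borel (U 0)"
      "integrable M (\<lambda>w. (norm (U 0 w))\<^sup>2)"
    and lln: "AE w in M. (\<lambda>n. (\<Sum>i<n. (c \<bullet> U i w)\<^sup>2) / n) \<longlonglongrightarrow> (LINT w|M. (c \<bullet> U 0 w)\<^sup>2)"
  shows "(\<lambda>n. CLINT w|M. iexp (c \<bullet> (\<Sum>i<n. smoothing_weight M V K h n (V i w) *\<^sub>R U i w)))
    \<longlonglongrightarrow> of_real (exp (- (c2 K / f 0 * (LINT w|M. (c \<bullet> U 0 w)\<^sup>2)) / 2))"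
proof -
  interpret prob_space M by fact
  have Vm [measurable]: "V i \<in> borel_measurable M" for i
    using V(1) by (auto simp: indep_vars_def)
  have [measurable]: "f \<in> borel_measurable borel"
    using distributed_real_measurable[OF f(1) V(2)] by simp
  note [measurable] = K(1) U(1)
  obtain Bf where Bf: "\<And>x. \<bar>f x\<bar> \<le> Bf" using f(2) by (auto simp: bounded_iff)
  obtain B where B: "\<And>x. \<bar>K x\<bar> \<le> B" using K(4) by (auto simp: bounded_iff)
  have B0: "B \<ge> 0" using B[of 0] by linarith
  let ?e = "smoothing_weight M V K h"
  define \<kappa> where "\<kappa> n = (LINT w|M. K (V 0 w / h n))" for n
  define \<kappa>2 where "\<kappa>2 n = (LINT w|M. (K (V 0 w / h n))\<^sup>2)" for n
  have e_def: "?e n v = sqrt (h n / n) * (K (v / h n) / \<kappa> n - 1)" for n v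
    by (simp add: smoothing_weight_def \<kappa>_def)
  have em [measurable]: "?e n \<in> borel_measurable borel" for n unfolding e_def by measurable
  have \<kappa>: "(\<lambda>n. \<kappa> n / h n) \<longlonglongrightarrow> f 0"
  proof -
    have "\<kappa> n = (LINT v|lborel. f v * K (v / h n))" for n
      unfolding \<kappa>_def by (rule distributed_integral[OF V(2), symmetric]) (use f in auto)
    then show ?thesis
      using kernel_integral_tendsto[OF _ Bf f(3) K(2) h(2,1)] by (simp add: K(3))
  qed
  have \<kappa>2: "(\<lambda>n. \<kappa>2 n / h n) \<longlonglongrightarrow> f 0 * c2 K"
  proof -
    have "\<kappa>2 n = (LINT v|lborel. f v * (K (v / h n))\<^sup>2)" for n
      unfolding \<kappa>2_def by (rule distributed_integral[OF V(2), symmetric]) (use f in auto)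
    then show ?thesis
      using kernel_integral_tendsto[OF _ Bf f(3) K(5) h(2,1)] by (simp add: c2_def)
  qed
  \<comment> \<open>The normalizer is positive for large \<open>n\<close> because its quotient by
    \<open>h n\<close> tends to \<open>f 0 > 0\<close>.\<close>
  have ev: "\<forall>\<^sub>F n in sequentially. n \<ge> 1 \<and> h n > 0 \<and> \<kappa> n > 0"
    using eventually_ge_at_top[of 1] order_tendstoD(1)[OF \<kappa> f(4)]
  proof eventually_elim
    case (elim n)
    then show ?case using h(1)[of n] by (simp add: zero_less_divide_iff)
  qed
  \<comment> \<open>A uniform bound for the weights. For large \<open>n\<close> it equals
    \<open>(B / (\<kappa> n / h n) + h n) / sqrt (n * h n)\<close>, so it vanishes because
    \<open>n * h n\<close> diverges.\<close>
  define \<delta> where "\<delta> n = \<bar>sqrt (h n / n)\<bar> * (B / \<bar>\<kappa> n\<bar> + 1)" for n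
  define v where "v n = (LINT w|M. (?e n (V 0 w))\<^sup>2)" for n
  have \<delta>: "\<bar>?e n x\<bar> \<le> \<delta> n" for n x
  proof -
    have "\<bar>K (x / h n) / \<kappa> n - 1\<bar> \<le> \<bar>K (x / h n)\<bar> / \<bar>\<kappa> n\<bar> + 1"
      using abs_triangle_ineq4[of "K (x / h n) / \<kappa> n" 1] by (simp add: abs_divide)
    also have "\<dots> \<le> B / \<bar>\<kappa> n\<bar> + 1" using B by (intro add_right_mono divide_right_mono) auto
    finally show ?thesis by (auto simp: e_def \<delta>_def abs_mult intro!: mult_left_mono)
  qed
  have \<delta>0: "\<delta> n \<ge> 0" for n using order_trans[OF abs_ge_zero \<delta>] .
  have \<delta>_lim: "\<delta> \<longlonglongrightarrow> 0"
  proof -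
    have "filterlim (\<lambda>n. sqrt (real n * h n)) at_top sequentially"
      by (rule filterlim_compose[OF sqrt_at_top h(3)])
    then have "(\<lambda>n. inverse (sqrt (real n * h n))) \<longlonglongrightarrow> 0"
      by (rule tendsto_inverse_0_at_top)
    then have "(\<lambda>n. (B / (\<kappa> n / h n) + h n) * inverse (sqrt (real n * h n))) \<longlonglongrightarrow> (B / f 0 + 0) * 0"
      by (intro tendsto_intros \<kappa> h) (use f in auto)
    then have "(\<lambda>n. (B / (\<kappa> n / h n) + h n) * inverse (sqrt (real n * h n))) \<longlonglongrightarrow> 0" by simp
    moreover have "\<forall>\<^sub>F n in sequentially. (B / (\<kappa> n / h n) + h n) * inverse (sqrt (real n * h n)) = \<delta> n"
      using ev
    proof eventually_elim
      case (elim n)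
      then have "sqrt (h n / n) = h n * inverse (sqrt (real n * h n))"
        by (simp add: real_sqrt_divide real_sqrt_mult field_simps)
      then show ?case using elim by (simp add: \<delta>_def field_simps)
    qed
    ultimately show ?thesis by (rule Lim_transform_eventually)
  qed
  have iK: "integrable M (\<lambda>w. K (V 0 w / h n))" for n
    by (rule integrable_const_bound[where B=B]) (use B in auto)
  have iK2: "integrable M (\<lambda>w. (K (V 0 w / h n))\<^sup>2)" for n
    by (rule integrable_const_bound[where B="B\<^sup>2"]) (use B in \<open>auto simp: abs_le_square_iff[symmetric] B0\<close>)
  have ie: "integrable M (\<lambda>w. ?e n (V 0 w))" for n
    by (rule integrable_const_bound[where B="\<delta> n"]) (use \<delta> in auto)
  have ie2: "integrable M (\<lambda>w. (?e n (V 0 w))\<^sup>2)" for n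
    by (rule integrable_const_bound[where B="(\<delta> n)\<^sup>2"]) (use \<delta> \<delta>0 in \<open>auto simp: abs_le_square_iff[symmetric]\<close>)
  have mean0: "(LINT w|M. ?e n (V 0 w)) = 0" if "\<kappa> n > 0" for n
    using iK that by (simp add: e_def prob_space \<kappa>_def)
  \<comment> \<open>The subtracted 1 in the weight contributes only the term \<open>- h n\<close>,
    which disappears in the limit.\<close>
  have nv: "(\<lambda>n. n * v n) \<longlonglongrightarrow> c2 K / f 0"
  proof -
    have "(\<lambda>n. (\<kappa>2 n / h n) / (\<kappa> n / h n)\<^sup>2 - h n) \<longlonglongrightarrow> f 0 * c2 K / (f 0)\<^sup>2 - 0"
      by (intro tendsto_intros \<kappa> \<kappa>2 h) (use f in auto)
    then have "(\<lambda>n. (\<kappa>2 n / h n) / (\<kappa> n / h n)\<^sup>2 - h n) \<longlonglongrightarrow> c2 K / f 0"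
      using f(4) by (simp add: power2_eq_square)
    moreover have "\<forall>\<^sub>F n in sequentially. (\<kappa>2 n / h n) / (\<kappa> n / h n)\<^sup>2 - h n = n * v n"
      using ev
    proof eventually_elim
      case (elim n)
      have "(?e n x)\<^sup>2 = (h n / n) * ((K (x / h n))\<^sup>2 / (\<kappa> n)\<^sup>2 - 2 / \<kappa> n * K (x / h n) + 1)" for x
        using elim by (simp add: e_def power_mult_distrib power2_diff power_divide)
      then have "v n = (LINT w|M. (h n / n) * ((K (V 0 w / h n))\<^sup>2 / (\<kappa> n)\<^sup>2 - 2 / \<kappa> n * K (V 0 w / h n) + 1))"
        by (simp add: v_def)
      also have "\<dots> = (h n / n) * (\<kappa>2 n / (\<kappa> n)\<^sup>2 - 2 / \<kappa> n * \<kappa> n + 1)"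
        using iK iK2 by (simp add: \<kappa>_def \<kappa>2_def prob_space)
      finally have "v n = (h n / n) * (\<kappa>2 n / (\<kappa> n)\<^sup>2 - 1)" using elim by simp
      then show ?case using elim by (simp add: field_simps power2_eq_square)
    qed
    ultimately show ?thesis by (rule Lim_transform_eventually)
  qed
  define \<phi> where "\<phi> n = char (distr M borel (\<lambda>w. ?e n (V 0 w)))" for n
  have rd: "real_distribution (distr M borel (\<lambda>w. ?e n (V 0 w)))" for n
    by (rule real_distribution_distr) measurable
  have \<phi>: "norm (\<phi> n t - of_real (1 - t\<^sup>2 * v n / 2)) \<le> t\<^sup>2 * v n * min 1 (\<bar>t\<bar> * \<delta> n)" if "\<kappa> n > 0" for n t
  proof -
    let ?X = "\<lambda>w. ?e n (V 0 w)"
    have var: "variance ?X = v n" using mean0[OF that] by (simp add: v_def)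
    have "norm (\<phi> n t - of_real (1 - t\<^sup>2 * v n / 2))
        \<le> (t\<^sup>2 / 6) * expectation (\<lambda>w. min (6 * (?X w)\<^sup>2) (\<bar>t\<bar> * \<bar>?X w\<bar> ^ 3))"
      using char_approx3'[OF _ ie ie2 mean0[OF that] var refl, of t] by (simp add: \<phi>_def)
    \<comment> \<open>Since the weight is at most \<open>\<delta> n\<close> in absolute value, its
      cube is at most \<open>\<delta> n\<close> times its square; the factor 6 cancels the one in
      front.\<close>
    also have "\<dots> \<le> (t\<^sup>2 / 6) * expectation (\<lambda>w. 6 * min 1 (\<bar>t\<bar> * \<delta> n) * (?X w)\<^sup>2)"
    proof (intro mult_left_mono integral_mono)
      fix w
      have "\<bar>t\<bar> * \<bar>?X w\<bar> ^ 3 = \<bar>t\<bar> * \<bar>?X w\<bar> * (?X w)\<^sup>2"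
        by (simp add: power3_eq_cube power2_eq_square mult.assoc abs_mult_self_eq)
      also have "\<dots> \<le> \<bar>t\<bar> * \<delta> n * (?X w)\<^sup>2"
        using \<delta> by (intro mult_right_mono mult_left_mono) auto
      also have "\<dots> \<le> 6 * (\<bar>t\<bar> * \<delta> n * (?X w)\<^sup>2)" using \<delta>0 by simp
      finally show "min (6 * (?X w)\<^sup>2) (\<bar>t\<bar> * \<bar>?X w\<bar> ^ 3) \<le> 6 * min 1 (\<bar>t\<bar> * \<delta> n) * (?X w)\<^sup>2"
        by (auto simp: min_def)
    next
      show "integrable M (\<lambda>w. min (6 * (?X w)\<^sup>2) (\<bar>t\<bar> * \<bar>?X w\<bar> ^ 3))"
        by (rule Bochner_Integration.integrable_bound[of _ "\<lambda>w. 6 * (?X w)\<^sup>2"]) (use ie2 in auto)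
    qed (use ie2 in auto)
    also have "\<dots> = t\<^sup>2 * v n * min 1 (\<bar>t\<bar> * \<delta> n)" by (simp add: v_def)
    finally show ?thesis .
  qed
  have dx: "distr M borel (\<lambda>w. c \<bullet> U i w) = distr M borel (\<lambda>w. c \<bullet> U 0 w)" for i
  proof -
    have "distr (distr M borel (U i)) borel (\<lambda>u. c \<bullet> u) = distr (distr M borel (U 0)) borel (\<lambda>u. c \<bullet> u)"
      unfolding U(2)[of i] ..
    then show ?thesis by (simp add: distr_distr comp_def)
  qed
  have ix: "integrable M (\<lambda>w. (c \<bullet> U 0 w)\<^sup>2)"
    by (rule square_integrable_inner) (use U in \<open>simp add: square_integrable_def\<close>)
  have dV: "distr M borel (V i) = distr M borel (V 0)" for i
  proof -
    have "distr M borel (V i) = distr M lborel (V i)" for i by (rule distr_cong) auto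
    then show ?thesis using distributed_distr_eq_density[OF V(2)] by simp
  qed
  have "(\<lambda>n. CLINT w|M. (\<Prod>i<n. \<phi> n (c \<bullet> U i w)))
      \<longlonglongrightarrow> of_real (exp (- (c2 K / f 0 * (LINT w|M. (c \<bullet> U 0 w)\<^sup>2)) / 2))"
  proof (rule weighted_char_product_tendsto[OF _ dx ix lln _ _ _ _ nv \<delta>0 \<delta>_lim])
    show "\<phi> n \<in> borel_measurable borel" for n
      unfolding \<phi>_def by (rule real_distribution.char_measurable[OF rd])
    show "norm (\<phi> n t) \<le> 1" for n t
      unfolding \<phi>_def by (rule real_distribution.cmod_char_le_1[OF rd])
    show "\<forall>\<^sub>F n in sequentially. \<forall>t. norm (\<phi> n t - of_real (1 - t\<^sup>2 * v n / 2)) \<le> t\<^sup>2 * v n * min 1 (\<bar>t\<bar> * \<delta> n)"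
      using ev by eventually_elim (use \<phi> in blast)
    show "v n \<ge> 0" for n by (simp add: v_def)
  qed measurable
  moreover have "(CLINT w|M. iexp (c \<bullet> (\<Sum>i<n. ?e n (V i w) *\<^sub>R U i w))) = (CLINT w|M. (\<Prod>i<n. \<phi> n (c \<bullet> U i w)))" for n
    using char_weighted_sum[OF M V(1) dV UV em[of n], where n=n and c=c] by (simp add: \<phi>_def inner_sum_right mult.commute)
  ultimately show ?thesis by simp
qed

lemma scaled_mean_error_tendsto_0:
  fixes U :: "nat \<Rightarrow> 'w \<Rightarrow> real ^ 'n"
  assumes M: "prob_space M" and U: "\<And>i. square_integrable M (U i)" "\<And>i. (LINT w|M. U i w) = \<mu>"
    and lim: "(\<lambda>n. r n * lambda_max (cov_matrix M (sample_mean U n))) \<longlonglongrightarrow> 0"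
    and r: "\<And>n. r n \<ge> 0"
  shows "tendsto_prob M (\<lambda>n w. sqrt (r n) *\<^sub>R (sample_mean U n w - \<mu>)) 0"
proof -
  interpret prob_space M by fact
  let ?Z = "\<lambda>n w. sample_mean U n w - \<mu>" and ?C = "real CARD('n)"
  have sq: "square_integrable M (\<lambda>w. ?Z n w)" for n
    using square_integrable_add[OF square_integrable_scaleR[OF square_integrable_sum[OF M U(1)]]
        square_integrable_const[OF M, of "- \<mu>"]]
    by (simp add: sample_mean_def)
  \<comment> \<open>The empty sample has mean 0 instead of \<mu>, whence
    \<open>n \<ge> 1\<close>.\<close>
  have mean: "(LINT w|M. sample_mean U n w) = \<mu>" if "n \<ge> 1" for n
    using that by (simp add: sample_mean_def square_integrable_integrable[OF M U(1)] U(2)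
        sum_constant_scaleR del: sum_constant)
  have bound: "(LINT w|M. (norm (?Z n w))\<^sup>2) \<le> ?C * lambda_max (cov_matrix M (sample_mean U n))" if "n \<ge> 1" for n
  proof -
    let ?S = "cov_matrix M (sample_mean U n)"
    have S: "?S = (LINT w|M. outer (?Z n w) (?Z n w))" by (simp add: cov_matrix_def mean[OF that])
    have sym: "transpose ?S = ?S"
      using pos_semidefinite_integral_outer[OF sq] by (simp add: S pos_semidefinite_def)
    have "(LINT w|M. (norm (?Z n w))\<^sup>2) = (LINT w|M. (\<Sum>k\<in>UNIV. ?Z n w $ k * ?Z n w $ k))"
      by (simp add: power2_norm_eq_inner inner_vec_def)
    also have "\<dots> = (\<Sum>k\<in>UNIV. ?S $ k $ k)"
      unfolding S integral_outer_nth[OF sq]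
      by (rule Bochner_Integration.integral_sum) (rule square_integrable_mult[OF sq])
    also have "\<dots> \<le> (\<Sum>k\<in>(UNIV :: 'n set). lambda_max ?S)"
    proof (rule sum_mono)
      fix k :: 'n
      show "?S $ k $ k \<le> lambda_max ?S"
        using quadratic_le_lambda_max[OF sym, of "axis k 1"]
        by (simp add: inner_axis_matrix inner_axis_axis)
    qed
    finally show ?thesis by simp
  qed
  have eq: "(norm (sqrt (r n) *\<^sub>R ?Z n w))\<^sup>2 = r n * (norm (?Z n w))\<^sup>2" for n w
    using r by (simp add: power_mult_distrib)
  have int: "integrable M (\<lambda>w. (norm (?Z n w))\<^sup>2)" for n using sq by (simp add: square_integrable_def)
  show ?thesis
  proof (rule tendsto_prob_L2)
    show "(\<lambda>w. (norm (sqrt (r n) *\<^sub>R ?Z n w))\<^sup>2) \<in> borel_measurable M" for n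
      unfolding eq using int by (intro borel_measurable_times) auto
    show "\<forall>\<^sub>F n in sequentially. integrable M (\<lambda>w. (norm (sqrt (r n) *\<^sub>R ?Z n w))\<^sup>2)"
      unfolding eq using int by simp
    show "(\<lambda>n. LINT w|M. (norm (sqrt (r n) *\<^sub>R ?Z n w))\<^sup>2) \<longlonglongrightarrow> 0"
    proof (rule Lim_null_comparison)
      show "(\<lambda>n. ?C * (r n * lambda_max (cov_matrix M (sample_mean U n)))) \<longlonglongrightarrow> 0"
        using tendsto_mult[OF tendsto_const[of ?C] lim] by simp
      show "\<forall>\<^sub>F n in sequentially. norm (LINT w|M. (norm (sqrt (r n) *\<^sub>R ?Z n w))\<^sup>2)
          \<le> ?C * (r n * lambda_max (cov_matrix M (sample_mean U n)))"
        using eventually_ge_at_top[of 1]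
      proof eventually_elim
        case (elim n)
        have "norm (LINT w|M. (norm (sqrt (r n) *\<^sub>R ?Z n w))\<^sup>2) = r n * (LINT w|M. (norm (?Z n w))\<^sup>2)"
          unfolding eq using r by simp
        also have "\<dots> \<le> r n * (?C * lambda_max (cov_matrix M (sample_mean U n)))"
          by (intro mult_left_mono bound elim r)
        finally show ?case by (simp add: algebra_simps)
      qed
    qed
  qed
qed

lemma mu_hat_decomposition:
  assumes "n \<ge> 1" "h n > 0"
  shows "sqrt (real n * h n) *\<^sub>R (mu_hat M U V K h n w - \<mu>)
    = (\<Sum>i<n. smoothing_weight M V K h n (V i w) *\<^sub>R U i w) + sqrt (real n * h n) *\<^sub>R (sample_mean U n w - \<mu>)"
proof -
  define \<kappa> where "\<kappa> = (LINT w|M. K (V 0 w / h n))"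
  have s: "sqrt (h n / n) = sqrt (real n * h n) / n"
    using assms by (simp add: real_sqrt_divide real_sqrt_mult field_simps)
  have "smoothing_weight M V K h n (V i w) *\<^sub>R U i w
      = sqrt (real n * h n) *\<^sub>R ((1 / (n * \<kappa>)) *\<^sub>R K (V i w / h n) *\<^sub>R U i w - (1 / n) *\<^sub>R U i w)" for i
    unfolding smoothing_weight_def \<kappa>_def[symmetric] s
    by (simp add: scaleR_diff_right scaleR_diff_left right_diff_distrib)
  then have "(\<Sum>i<n. smoothing_weight M V K h n (V i w) *\<^sub>R U i w)
      = sqrt (real n * h n) *\<^sub>R (mu_hat M U V K h n w - sample_mean U n w)"
    unfolding mu_hat_def sample_mean_def \<kappa>_def[symmetric]
    by (simp only: scaleR_sum_right sum_subtractf scaleR_diff_right)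
  then show ?thesis by (simp add: scaleR_diff_right)
qed

lemma tendsto_prob_sequence:
  assumes "a \<longlonglongrightarrow> c"
  shows "tendsto_prob M (\<lambda>n w. a n) c"
proof (rule tendsto_probI)
  fix e :: real assume e: "e > 0"
  let ?A = "\<lambda>n. if dist (a n) c < e then {} else space M"
  have "\<forall>\<^sub>F n in sequentially. measure M (?A n) < e"
    using tendstoD[OF assms e] by eventually_elim (use e in simp)
  then show "\<exists>A. (\<forall>n. A n \<in> sets M) \<and>
     (\<forall>n. \<forall>w\<in>space M. w \<notin> A n \<longrightarrow> dist (a n) c < e) \<and> (\<forall>\<^sub>F n in sequentially. measure M (A n) < e)"
    by (intro exI[of _ ?A]) auto
qed

lemma borel_measurable_mu_hat:
  fixes U :: "nat \<Rightarrow> 'w \<Rightarrow> real ^ 'n"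
  assumes [measurable]: "\<And>i. U i \<in> borel_measurable M" "\<And>i. V i \<in> borel_measurable M" "K \<in> borel_measurable borel"
  shows "mu_hat M U V K h n \<in> borel_measurable M"
  unfolding mu_hat_def by measurable

lemma smoothed_moments_char_tendsto:
  fixes U :: "nat \<Rightarrow> 'w \<Rightarrow> real ^ 'n" and V :: "nat \<Rightarrow> 'w \<Rightarrow> real" and f K :: "real \<Rightarrow> real"
  assumes M: "prob_space M"
    and V: "prob_space.indep_vars M (\<lambda>_. borel) V UNIV" "\<And>i. distributed M lborel (V i) (\<lambda>x. ennreal (f x))"
    and UV: "indep_rv M (PiM UNIV (\<lambda>_. borel)) (\<lambda>w i. U i w) (PiM UNIV (\<lambda>_. borel)) (\<lambda>w i. V i w)"
    and f: "\<And>x. f x \<ge> 0" "bounded (range f)" "isCont f 0" "f 0 > 0"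
    and K: "K \<in> borel_measurable borel" "integrable lborel K" "(LINT u|lborel. K u) = 1" "bounded (range K)"
      "integrable lborel (\<lambda>u. (K u)\<^sup>2)"
    and h: "\<And>n. n \<ge> 1 \<Longrightarrow> h n > 0" "h \<longlonglongrightarrow> 0" "filterlim (\<lambda>n. real n * h n) at_top sequentially"
    and U: "\<And>i. square_integrable M (U i)" "\<And>i. distr M borel (U i) = distr M borel (U 0)"
      "\<And>i. (LINT w|M. U i w) = \<mu>"
    and lln: "\<And>c. AE w in M. (\<lambda>n. (\<Sum>i<n. (c \<bullet> U i w)\<^sup>2) / n) \<longlonglongrightarrow> (LINT w|M. (c \<bullet> U 0 w)\<^sup>2)"
    and cov: "(\<lambda>n. real n * h n * lambda_max (cov_matrix M (sample_mean U n))) \<longlonglongrightarrow> 0"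
  shows "(\<lambda>n. CLINT w|M. iexp (c \<bullet> (sqrt (real n * h n) *\<^sub>R (mu_hat M U V K h n w - \<mu>))))
    \<longlonglongrightarrow> of_real (exp (- (c \<bullet> (Sigma_mu M U K f *v c)) / 2))"
proof -
  interpret prob_space M by fact
  have [measurable]: "V i \<in> borel_measurable M" for i
    using V(1) by (auto simp: indep_vars_def)
  have [measurable]: "U i \<in> borel_measurable M" for i using U(1) by (rule square_integrable_measurable)
  note [measurable] = K(1)
  let ?D = "\<lambda>n w. sqrt (real n * h n) *\<^sub>R (mu_hat M U V K h n w - \<mu>)"
  let ?T = "\<lambda>n w. \<Sum>i<n. smoothing_weight M V K h n (V i w) *\<^sub>R U i w"
  have [measurable]: "?D n \<in> borel_measurable M" for n
    using borel_measurable_mu_hat[of U M V K h n] by measurable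
  have [measurable]: "smoothing_weight M V K h n \<in> borel_measurable borel" for n
    unfolding smoothing_weight_def[abs_def] by measurable
  have r: "real n * h n \<ge> 0" for n by (cases "n = 0") (use h(1)[of n] in auto)
  have "tendsto_prob M (\<lambda>n w. sqrt (real n * h n) *\<^sub>R (sample_mean U n w - \<mu>)) 0"
    by (rule scaled_mean_error_tendsto_0[OF M U(1,3) cov r])
  \<comment> \<open>The constant sequence \<open>W\<close> carries no condition; the transformation
    merely discards \<open>n = 0\<close>, where the decomposition is not asserted.\<close>
  then have R: "tendsto_prob M (\<lambda>n w. ?D n w - ?T n w) 0"
    by (rule tendsto_prob_transform[where W="\<lambda>n w. 0" and d="0::real" and ?n0.0=1 and e=1])
       (use tendsto_prob_sequence[OF tendsto_const[of "0::real"]] h(1) in \<open>auto simp: mu_hat_decomposition\<close>)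
  have "c \<bullet> (Sigma_mu M U K f *v c) = c2 K / f 0 * (LINT w|M. (c \<bullet> U 0 w)\<^sup>2)"
    using quadratic_integral_outer[OF U(1)[of 0], of c c]
    by (simp add: Sigma_mu_def scaleR_matrix_vector_assoc[symmetric] power2_eq_square)
  moreover have "(\<lambda>n. CLINT w|M. iexp (c \<bullet> ?T n w)) \<longlonglongrightarrow> of_real (exp (- (c2 K / f 0 * (LINT w|M. (c \<bullet> U 0 w)\<^sup>2)) / 2))"
    by (rule smoothed_sum_char_tendsto[OF M V UV f K h _ U(2) _ lln])
       (use U(1) in \<open>auto simp: square_integrable_def\<close>)
  moreover have "(\<lambda>n. (CLINT w|M. iexp (c \<bullet> ?D n w)) - (CLINT w|M. iexp (c \<bullet> ?T n w))) \<longlonglongrightarrow> 0"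
    by (rule char_diff_tendsto_0[OF _ _ R]) measurable
  ultimately show ?thesis
    using tendsto_add[of "\<lambda>n. (CLINT w|M. iexp (c \<bullet> ?D n w)) - (CLINT w|M. iexp (c \<bullet> ?T n w))" 0 sequentially
        "\<lambda>n. CLINT w|M. iexp (c \<bullet> ?T n w)"] by simp
qed

section \<open>From characteristic functions to limit laws\<close>

lemma weakly_converges_mv_normal:
  fixes Z :: "nat \<Rightarrow> 'w \<Rightarrow> real ^ 'n"
  assumes M: "prob_space M" and Z [measurable]: "\<And>n. Z n \<in> borel_measurable M" and S: "pos_semidefinite S"
    and conv: "\<And>t. (\<lambda>n. CLINT w|M. iexp (t \<bullet> Z n w)) \<longlonglongrightarrow> of_real (exp (- (t \<bullet> (S *v t)) / 2))"
  shows "weakly_converges (\<lambda>n. distr M borel (Z n)) (mv_normal 0 S)"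
  by (rule levy_continuity_vec)
     (use conv in \<open>auto intro: prob_space.prob_space_distr[OF M] prob_space_mv_normal
       simp: char_vec_distr[OF Z] char_vec_mv_normal[OF S]\<close>)

text \<open>The error is a tight sequence multiplied by the vanishing number
  \<open>1 / sqrt (r n)\<close>, so consistency follows from the rate.\<close>

lemma tendsto_prob_of_scaled_tight:
  fixes Z :: "nat \<Rightarrow> 'w \<Rightarrow> real ^ 'n"
  assumes M: "prob_space M" and D: "tight_rv M (\<lambda>n w. sqrt (r n) *\<^sub>R (Z n w - \<mu>))"
    and [measurable]: "\<And>n. Z n \<in> borel_measurable M" and r: "\<And>n. n \<ge> 1 \<Longrightarrow> r n > 0" "filterlim r at_top sequentially"
  shows "tendsto_prob M Z \<mu>"
proof -
  interpret prob_space M by fact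
  let ?a = "\<lambda>n. inverse (sqrt (r n))" and ?D = "\<lambda>n w. sqrt (r n) *\<^sub>R (Z n w - \<mu>)"
  have "?a \<longlonglongrightarrow> 0"
    by (rule tendsto_inverse_0_at_top[OF filterlim_compose[OF sqrt_at_top r(2)]])
  then have "tendsto_prob M (\<lambda>n w. ?a n) 0" by (rule tendsto_prob_sequence)
  \<comment> \<open>Positivity of \<open>r\<close> is known only from index 1 on, so the
    cancellation of \<open>sqrt (r n)\<close> may fail at \<open>n = 0\<close>.\<close>
  then have "tendsto_prob M (\<lambda>n w. if n \<ge> 1 then Z n w - \<mu> else 0) 0"
  proof (rule tendsto_prob_tight_mult[OF _ D, where K=1 and k=1])
    fix n w
    show "norm (if n \<ge> 1 then Z n w - \<mu> else 0) \<le> 1 * dist (?a n) 0 * norm (?D n w) ^ 1"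
    proof (cases "n \<ge> 1")
      case True
      have cancel: "dist (inverse s) 0 * norm (s *\<^sub>R x) = norm x" if "s > 0" for s and x :: "real ^ 'n"
        using that by (simp add: mult.assoc[symmetric])
      have "dist (?a n) 0 * norm (?D n w) = norm (Z n w - \<mu>)"
        by (rule cancel) (use True r(1) in simp)
      then show ?thesis using True by (simp only: if_True mult_1_left power_one_right order_refl)
    qed simp
  qed simp_all
  then have "tendsto_prob M (\<lambda>n w. Z n w - \<mu>) 0"
    by (rule tendsto_prob_transform[where W="\<lambda>n w. 0" and d="0::real" and ?n0.0=1 and e=1])
       (use tendsto_prob_sequence[OF tendsto_const[of "0::real"]] in auto)
  then show ?thesis by (simp add: tendsto_prob_def dist_norm)
qed

text \<open>Cosine and sine of \<open>F\<close> are bounded continuous even for an unbounded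
  \<open>F\<close>, such as the quadratic form used later.\<close>

lemma weakly_converges_iexp:
  fixes F :: "real ^ 'n \<Rightarrow> real"
  assumes conv: "weakly_converges Ns N"
    and Ns: "\<And>n. prob_space (Ns n)" "\<And>n. sets (Ns n) = sets borel" and N: "prob_space N" "sets N = sets borel"
    and F: "continuous_on UNIV F"
  shows "(\<lambda>n. CLINT x|Ns n. iexp (F x)) \<longlonglongrightarrow> (CLINT x|N. iexp (F x))"
proof -
  have i: "complex_integrable P (\<lambda>x. iexp (F x))" if "prob_space P" "sets P = sets borel" for P
  proof -
    interpret prob_space P by fact
    have "F \<in> borel_measurable P"
      using borel_measurable_continuous_onI[OF F] that(2) measurable_cong_sets by blast
    then show ?thesis by (rule integrable_iexp)
  qed
  have "(\<lambda>n. LINT x|Ns n. cos (F x)) \<longlonglongrightarrow> (LINT x|N. cos (F x))"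
    "(\<lambda>n. LINT x|Ns n. sin (F x)) \<longlonglongrightarrow> (LINT x|N. sin (F x))"
    using conv unfolding weakly_converges_def
    by (auto intro!: continuous_intros F boundedI[where B=1])
  moreover have "Re (CLINT x|P. iexp (F x)) = (LINT x|P. cos (F x))" "Im (CLINT x|P. iexp (F x)) = (LINT x|P. sin (F x))"
    if "prob_space P" "sets P = sets borel" for P
    using integral_Re[OF i[OF that]] integral_Im[OF i[OF that]] by (simp_all add: Re_exp Im_exp)
  ultimately show ?thesis by (simp add: tendsto_complex_iff Ns N)
qed

text \<open>If \<open>Z = A G\<close> with \<open>A A\<^sup>T = S\<close>, then \<open>Z \<bullet> S\<^sup>-\<^sup>1 Z = G \<bullet> G\<close>.\<close>

lemma distr_mv_normal_quadratic:
  fixes S :: "real ^ 'n ^ 'n"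
  assumes S: "pos_semidefinite S" and det: "det S \<noteq> 0"
  shows "distr (mv_normal 0 S) borel (\<lambda>z. z \<bullet> (matrix_inv S *v z)) = chi_squared CARD('n)"
proof -
  obtain A :: "real ^ 'n ^ 'n" where A: "A ** transpose A = S"
    and eq: "mv_normal 0 S = distr std_normal_vec borel (\<lambda>z. 0 + A *v z)"
    using mv_normal_eq_distr[OF S] by metis
  have dA: "det A \<noteq> 0" using det by (auto simp: A[symmetric] det_mul)
  let ?P = "matrix_inv S"
  \<comment> \<open>\<open>A ** transpose A\<close> is \<open>S\<close> and cancels against its
    inverse; \<open>A\<close>, being invertible, is then cancelled on the left.\<close>
  have "A ** (transpose A ** ?P ** A) = A"
    using matrix_inv_mult(1)[OF det] by (simp add: matrix_mul_assoc A)
  then have I: "transpose A ** ?P ** A = mat 1"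
    by (metis matrix_inv_mult(2)[OF dA] matrix_mul_assoc matrix_mul_lid)
  have q: "(A *v z) \<bullet> (?P *v (A *v z)) = (norm z)\<^sup>2" for z
  proof -
    have "(A *v z) \<bullet> (?P *v (A *v z)) = z \<bullet> ((transpose A ** ?P ** A) *v z)"
      unfolding matrix_vector_mul_assoc[symmetric] transpose_matrix_vector
      by (metis dot_lmul_matrix inner_commute)
    then show ?thesis by (simp add: I power2_norm_eq_inner)
  qed
  have "distr (mv_normal 0 S) borel (\<lambda>z. z \<bullet> (?P *v z)) = distr std_normal_vec borel (\<lambda>z :: real ^ 'n. (norm z)\<^sup>2)"
    unfolding eq by (subst distr_distr) (auto simp: comp_def q)
  then show ?thesis by (simp add: chi_squared_eq_distr)
qed

text \<open>Replacing \<open>P n\<close> by its limit changes the form by at most a vanishing factor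
  times the squared norm of the tight \<open>W n\<close>. The form with a fixed matrix is a
  continuous function of \<open>W n\<close>, and since the chi-squared law has no atom, its
  distribution function is a limit at every point.\<close>

lemma quadratic_form_cdf_tendsto:
  fixes W :: "nat \<Rightarrow> 'w \<Rightarrow> real ^ 'n" and P :: "nat \<Rightarrow> 'w \<Rightarrow> real ^ 'n ^ 'n"
  assumes M: "prob_space M" and W [measurable]: "\<And>n. W n \<in> borel_measurable M" and Pm [measurable]: "\<And>n. P n \<in> borel_measurable M"
    and S: "pos_semidefinite S" "det S \<noteq> 0"
    and conv: "weakly_converges (\<lambda>n. distr M borel (W n)) (mv_normal 0 S)"
    and P: "tendsto_prob M P (matrix_inv S)"
  shows "(\<lambda>n. measure M {w \<in> space M. W n w \<bullet> (P n w *v W n w) \<le> x}) \<longlonglongrightarrow> cdf (chi_squared CARD('n)) x"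
proof -
  interpret prob_space M by fact
  let ?S = "matrix_inv S"
  interpret mv: bounded_bilinear "\<lambda>(A :: real ^ 'n ^ 'n) (x :: real ^ 'n). A *v x"
    by (rule bounded_bilinear_matrix_vector_mult)
  obtain C where C: "\<And>(A :: real ^ 'n ^ 'n) b. norm (A *v b) \<le> norm A * norm b * C" "C > 0"
    using mv.pos_bounded by blast
  let ?Q = "\<lambda>n w. W n w \<bullet> (P n w *v W n w)" and ?Q' = "\<lambda>n w. W n w \<bullet> (?S *v W n w)"
  have Pm' [measurable]: "(\<lambda>w. P n w *v W n w) \<in> borel_measurable M" for n
    unfolding matrix_vector_mult_def
    by (intro borel_measurable_vec, unfold vec_lambda_beta) measurable
  have [measurable]: "?Q n \<in> borel_measurable M" "?Q' n \<in> borel_measurable M" for n by measurable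
  have N: "prob_space (mv_normal 0 S)" "sets (mv_normal 0 S) = sets borel"
    by (auto intro: prob_space_mv_normal)
  have Ns: "prob_space (distr M borel (W n))" for n by (rule prob_space_distr) measurable
  have tight: "tight_rv M W" by (rule tight_rv_weakly_converges[OF M W N conv])
  have "tendsto_prob M (\<lambda>n w. ?Q n w - ?Q' n w) 0"
  proof (rule tendsto_prob_tight_mult[OF P tight W _ C(2), where k=2])
    fix n w
    have "?Q n w - ?Q' n w = W n w \<bullet> ((P n w - ?S) *v W n w)"
      by (simp add: mv.diff_left inner_diff_right)
    also have "norm \<dots> \<le> norm (W n w) * norm ((P n w - ?S) *v W n w)"
      by (simp add: Cauchy_Schwarz_ineq2)
    also have "\<dots> \<le> norm (W n w) * (norm (P n w - ?S) * norm (W n w) * C)"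
      by (intro mult_left_mono C) simp
    finally show "norm (?Q n w - ?Q' n w) \<le> C * dist (P n w) ?S * norm (W n w) ^ 2"
      by (simp add: dist_norm power2_eq_square mult_ac)
  qed
  from char_diff_tendsto_0[OF _ _ this]
  have diff: "(\<lambda>n. (CLINT w|M. iexp (t * ?Q n w)) - (CLINT w|M. iexp (t * ?Q' n w))) \<longlonglongrightarrow> 0" for t
    by simp
  have Q': "(\<lambda>n. CLINT w|M. iexp (t * ?Q' n w)) \<longlonglongrightarrow> char (chi_squared CARD('n)) t" for t
  proof -
    have "continuous_on UNIV (\<lambda>x :: real ^ 'n. t * (x \<bullet> (?S *v x)))"
      by (intro continuous_intros mv.continuous_on)
    from weakly_converges_iexp[OF conv Ns _ N this]
    have "(\<lambda>n. CLINT x|distr M borel (W n). iexp (t * (x \<bullet> (?S *v x))))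
        \<longlonglongrightarrow> (CLINT x|mv_normal 0 S. iexp (t * (x \<bullet> (?S *v x))))" by simp
    moreover have "(CLINT x|distr M borel (W n). iexp (t * (x \<bullet> (?S *v x)))) = (CLINT w|M. iexp (t * ?Q' n w))" for n
      by (subst integral_distr) auto
    moreover have "(CLINT x|mv_normal 0 S. iexp (t * (x \<bullet> (?S *v x)))) = char (chi_squared CARD('n)) t"
      unfolding distr_mv_normal_quadratic[OF S, symmetric] char_def by (subst integral_distr) auto
    ultimately show ?thesis by simp
  qed
  have "weak_conv_m (\<lambda>n. distr M borel (?Q n)) (chi_squared CARD('n))"
  proof (rule levy_continuity)
    show "real_distribution (distr M borel (?Q n))" for n by (rule real_distribution_distr) measurable
    show "(\<lambda>n. char (distr M borel (?Q n)) t) \<longlonglongrightarrow> char (chi_squared CARD('n)) t" for t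
    proof -
      have "char (distr M borel (?Q n)) t = (CLINT w|M. iexp (t * ?Q n w))" for n
        unfolding char_def by (subst integral_distr) auto
      then show ?thesis using tendsto_add[OF diff Q', of t t] by simp
    qed
  qed (rule real_distribution_chi_squared)
  then have "(\<lambda>n. cdf (distr M borel (?Q n)) x) \<longlonglongrightarrow> cdf (chi_squared CARD('n)) x"
    using isCont_cdf_chi_squared[of "CARD('n)" x] by (simp add: weak_conv_m_def weak_conv_def)
  moreover have "cdf (distr M borel (?Q n)) x = measure M {w \<in> space M. ?Q n w \<le> x}" for n
    unfolding cdf_def by (subst measure_distr) (auto intro!: arg_cong[where f="measure M"])
  ultimately show ?thesis by simp
qed

section \<open>Regression\<close>

lemma augment_nth [simp]: "augment x $ None = 1" "augment x $ Some j = x $ j"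
  by (simp_all add: augment_def)

lemma inner_augment: "w \<bullet> augment x = w $ None + (\<Sum>j\<in>UNIV. w $ Some j * x $ j)"
  by (simp add: inner_vec_def UNIV_option_conv sum.reindex)

lemma norm_augment: "(norm (augment x))\<^sup>2 = 1 + (norm x)\<^sup>2"
  by (simp add: power2_norm_eq_inner inner_augment) (simp add: inner_vec_def)

lemma borel_measurable_augment [measurable]: "augment \<in> borel_measurable borel"
proof (rule borel_measurable_vec)
  show "(\<lambda>x. augment x $ k) \<in> borel_measurable borel" for k :: "'a option"
    by (cases k) auto
qed

lemma transpose_outer_self: "transpose (outer v v) = outer v v"
  by (simp add: vec_eq_iff transpose_def outer_def mult.commute)

lemma Sigma_of_moment_vec: "Sigma_of (moment_vec x y) = outer (augment x) (augment x)"
  unfolding moment_vec_def by (rule Sigma_of_stack[OF transpose_outer_self])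

lemma Gamma_of_moment_vec: "Gamma_of (moment_vec x y) = y *\<^sub>R augment x"
  by (simp add: moment_vec_def Gamma_of_stack)

lemma normal_eq_defect_moment_vec:
  "normal_eq_defect b (moment_vec x y) = (y - b \<bullet> augment x) *\<^sub>R augment x"
  by (simp add: normal_eq_defect_def Sigma_of_moment_vec Gamma_of_moment_vec outer_mult
      inner_commute scaleR_diff_left)

lemma moment_vec_nth:
  "moment_vec x y $ k = (case k of Inl l \<Rightarrow> augment x $ fst (position l) * augment x $ snd (position l) | Inr i \<Rightarrow> y * augment x $ i)"
  by (simp add: moment_vec_def stack_def vech_def outer_def split: sum.split)

lemma borel_measurable_moment_vec:
  assumes [measurable]: "X \<in> borel_measurable M" "Y \<in> borel_measurable M"
  shows "(\<lambda>w. moment_vec (X w) (Y w)) \<in> borel_measurable M"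
proof (rule borel_measurable_vec)
  have [measurable]: "(\<lambda>w. augment (X w)) \<in> borel_measurable M" by measurable
  show "(\<lambda>w. moment_vec (X w) (Y w) $ k) \<in> borel_measurable M" for k
    unfolding moment_vec_nth by (cases k) auto
qed

lemma subalgebra_generated_by:
  assumes "Z \<in> measurable M N"
  shows "subalgebra M (generated_by M N Z)"
  unfolding generated_by_def subalgebra_def
  using sets_image_in_sets[OF _ assms] by auto

lemma measurable_generated_by:
  assumes "Z \<in> measurable M N"
  shows "Z \<in> measurable (generated_by M N Z) N"
  unfolding generated_by_def by (rule measurable_vimage_algebra1) (use measurable_space[OF assms] in auto)

text \<open>From the centre one moves inside the ball along the gradient of the affine function; the
  value can stay zero only if the gradient vanishes, and then so does the constant term.\<close>

lemma affine_zero_on_ball: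
  fixes w :: "real ^ ('p::finite) option"
  assumes r: "r > 0" and z: "\<And>x. x \<in> ball x0 r \<Longrightarrow> w \<bullet> augment x = 0"
  shows "w = 0"
proof -
  define u where "u = (\<chi> j. w $ Some j)"
  have eq: "w \<bullet> augment x = w $ None + u \<bullet> x" for x
    unfolding inner_augment u_def by (simp add: inner_vec_def)
  have x0: "w $ None + u \<bullet> x0 = 0" using z[of x0] r by (simp add: eq)
  have u: "u = 0"
  proof (rule ccontr)
    assume "u \<noteq> 0"
    \<comment> \<open>A step of length \<open>r / 2\<close> in the direction of
      \<open>u\<close>.\<close>
    let ?x = "x0 + (r / (2 * norm u)) *\<^sub>R u"
    have "?x \<in> ball x0 r" using r \<open>u \<noteq> 0\<close> by (simp add: dist_norm)
    then have "w $ None + u \<bullet> ?x = 0" using z eq by metis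
    then have "w $ None + (u \<bullet> x0 + (r / (2 * norm u)) * (u \<bullet> u)) = 0"
      by (simp only: inner_add_right inner_scaleR_right)
    then have "(r / (2 * norm u)) * (u \<bullet> u) = 0" using x0 by linarith
    then show False using r \<open>u \<noteq> 0\<close> by simp
  qed
  then have "w $ None = 0" using x0 by simp
  moreover have "w $ Some j = 0" for j using u by (metis u_def vec_lambda_beta zero_index)
  ultimately show ?thesis by (metis (mono_tags) not_None_eq vec_eq_iff zero_index)
qed

text \<open>The set where the affine form is nonzero is open and null, so it misses the support,
  which contains a ball.\<close>

lemma support_interior_imp_zero:
  fixes X :: "'w \<Rightarrow> real ^ ('p::finite)"
  assumes M: "prob_space M" and X [measurable]: "X \<in> borel_measurable M"
    and int: "interior (law_support (distr M borel X)) \<noteq> {}"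
    and ae: "AE w in M. v \<bullet> augment (X w) = 0"
  shows "v = 0"
proof -
  let ?P = "distr M borel X" and ?H = "{x. v \<bullet> augment x \<noteq> 0}"
  obtain x0 r where r: "r > 0" "ball x0 r \<subseteq> law_support ?P"
    using int by (metis all_not_in_conv mem_interior)
  have "continuous_on UNIV (\<lambda>x :: real ^ 'p. v \<bullet> augment x)"
    unfolding inner_augment by (intro continuous_intros)
  then have H: "open ?H" by (intro open_Collect_neq continuous_on_const)
  have null: "emeasure ?P ?H = 0"
  proof -
    have [measurable]: "?H \<in> sets borel" using H by simp
    have "AE x in ?P. x \<notin> ?H"
      using ae by (subst AE_distr_iff) auto
    then show ?thesis by (simp add: AE_iff_measurable[OF _ refl])
  qed
  have "v \<bullet> augment x = 0" if "x \<in> ball x0 r" for x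
  proof (rule ccontr)
    assume "v \<bullet> augment x \<noteq> 0"
    then have "emeasure ?P ?H > 0"
      using r(2) that H unfolding law_support_def by blast
    then show False using null by simp
  qed
  then show ?thesis by (rule affine_zero_on_ball[OF r(1)])
qed

text \<open>The augmented covariates are measurable with respect to the conditioning sigma-algebra,
  so the residual may be replaced by its conditional expectation under the integral.\<close>

lemma centred_residual_moment:
  fixes X :: "'w \<Rightarrow> real ^ ('p::finite)"
  assumes M: "prob_space M" and [measurable]: "X \<in> borel_measurable M" "e \<in> borel_measurable M"
    and centred: "AE w in M. real_cond_exp M (generated_by M borel X) e w = 0"
    and int: "integrable M (\<lambda>w. e w *\<^sub>R augment (X w))"
  shows "(LINT w|M. e w *\<^sub>R augment (X w)) = 0"
proof -
  interpret prob_space M by fact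
  let ?F = "generated_by M borel X"
  have sub: "subalgebra M ?F" by (rule subalgebra_generated_by) measurable
  interpret finite_measure_subalgebra M ?F
    by unfold_locales (rule sub)
  have [measurable]: "X \<in> measurable ?F borel" by (rule measurable_generated_by) measurable
  show ?thesis
  proof (subst vec_eq_iff, rule allI)
    fix k
    have ik: "integrable M (\<lambda>w. augment (X w) $ k * e w)"
      using integrable_bounded_linear[OF bounded_linear_vec_nth int, of k] by (simp add: mult.commute)
    have "(LINT w|M. e w *\<^sub>R augment (X w)) $ k = (LINT w|M. augment (X w) $ k * e w)"
      by (subst integral_vec_nth[OF int]) (simp add: mult.commute)
    also have "\<dots> = (LINT w|M. augment (X w) $ k * real_cond_exp M ?F e w)"
    proof (rule real_cond_exp_intg(2)[OF ik, symmetric])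
      have "(\<lambda>w. augment (X w)) \<in> borel_measurable ?F" by measurable
      then show "(\<lambda>w. augment (X w) $ k) \<in> borel_measurable ?F" by measurable
    qed measurable
    also have "\<dots> = (LINT w|M. 0)"
    proof (rule integral_cong_AE)
      have "(\<lambda>w. augment (X w)) \<in> borel_measurable M" by measurable
      then show "(\<lambda>w. augment (X w) $ k * real_cond_exp M ?F e w) \<in> borel_measurable M" by measurable
      show "AE w in M. augment (X w) $ k * real_cond_exp M ?F e w = 0"
        using centred by eventually_elim simp
    qed simp
    finally show "(LINT w|M. e w *\<^sub>R augment (X w)) $ k = 0 $ k" by simp
  qed
qed

text \<open>Conditioning on the covariates turns the vanishing second moment into the integral of
  the squared linear form times the conditional variance; as the latter is positive, the linear form
  vanishes almost everywhere.\<close>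

lemma residual_moment_nonzero:
  fixes X :: "'w \<Rightarrow> real ^ ('p::finite)"
  assumes M: "prob_space M" and [measurable]: "X \<in> borel_measurable M" "e \<in> borel_measurable M"
    and pos: "AE w in M. 0 < nn_cond_exp M (generated_by M borel X) (\<lambda>w. ennreal ((e w)\<^sup>2)) w"
    and int: "interior (law_support (distr M borel X)) \<noteq> {}"
    and ae: "AE w in M. (v \<bullet> augment (X w)) * e w = 0"
  shows "v = 0"
proof -
  interpret prob_space M by fact
  let ?F = "generated_by M borel X" and ?q = "\<lambda>w. ennreal ((v \<bullet> augment (X w))\<^sup>2)" and ?e = "\<lambda>w. ennreal ((e w)\<^sup>2)"
  have sub: "subalgebra M ?F" by (rule subalgebra_generated_by) measurable
  interpret finite_measure_subalgebra M ?F
    by unfold_locales (rule sub)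
  have [measurable]: "X \<in> measurable ?F borel" by (rule measurable_generated_by) measurable
  have a [measurable]: "(\<lambda>w. augment (X w)) \<in> borel_measurable ?F" "(\<lambda>w. augment (X w)) \<in> borel_measurable M"
    by measurable
  have "(\<integral>\<^sup>+ w. ?q w * nn_cond_exp M ?F ?e w \<partial>M) = (\<integral>\<^sup>+ w. ?q w * ?e w \<partial>M)"
    by (rule nn_cond_exp_intg) measurable
  also have "\<dots> = (\<integral>\<^sup>+ w. 0 \<partial>M)"
    by (rule nn_integral_cong_AE) (use ae in \<open>eventually_elim, auto simp flip: ennreal_mult\<close>)
  finally have "(\<integral>\<^sup>+ w. ?q w * nn_cond_exp M ?F ?e w \<partial>M) = 0" by simp
  then have "AE w in M. ?q w * nn_cond_exp M ?F ?e w = 0"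
    by (subst (asm) nn_integral_0_iff_AE) auto
  then have "AE w in M. v \<bullet> augment (X w) = 0"
    using pos by eventually_elim auto
  from support_interior_imp_zero[OF M _ int this] show ?thesis by measurable
qed

text \<open>A kernel with vanishing square integral would be zero almost everywhere and could not
  integrate to 1.\<close>

lemma c2_pos:
  assumes [measurable]: "K \<in> borel_measurable borel" and "(LINT u|lborel. K u) = 1" and K2: "integrable lborel (\<lambda>u. (K u)\<^sup>2)"
  shows "c2 K > 0"
proof -
  have "c2 K \<noteq> 0"
  proof
    assume "c2 K = 0"
    then have "AE u in lborel. (K u)\<^sup>2 = 0"
      unfolding c2_def by (subst (asm) integral_nonneg_eq_0_iff_AE[OF K2]) auto
    then have ae: "AE u in lborel. K u = 0" by simp
    have "(LINT u|lborel. K u) = (LINT u :: real|lborel. 0)"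
      by (rule integral_cong_AE) (use ae in auto)
    then show False using assms(2) by simp
  qed
  moreover have "c2 K \<ge> 0" by (simp add: c2_def)
  ultimately show ?thesis by simp
qed

theorem theorem3p1:
  fixes M :: "'w measure"
    and X :: "nat \<Rightarrow> 'w \<Rightarrow> real ^ ('p::{finite,linorder})"
    and eps Y V :: "nat \<Rightarrow> 'w \<Rightarrow> real"
    and \<beta> :: "real ^ 'p option"
    and U :: "nat \<Rightarrow> 'w \<Rightarrow> 'p option stacked"
    and \<mu> :: "'p option stacked"
    and f K :: "real \<Rightarrow> real"
    and h :: "nat \<Rightarrow> real"
    and beta_hat :: "nat \<Rightarrow> 'w \<Rightarrow> real ^ 'p option"
    and Sigma_beta_hat_inv :: "nat \<Rightarrow> 'w \<Rightarrow> real ^ 'p option ^ 'p option"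
    and Sigma_beta :: "real ^ 'p option ^ 'p option"
  assumes M: "prob_space M"
    and stationary: "stationary M borel (\<lambda>i w. (X i w, eps i w))"
    and eps_integrable: "integrable M (eps 0)"
    and eps_centred: "AE w in M. real_cond_exp M (generated_by M borel (X 0)) (eps 0) w = 0"
    and X_L2: "integrable M (\<lambda>w. (norm (X 0 w))\<^sup>2)"
    and Y: "\<And>i w. Y i w = \<beta> $ None + (\<Sum>j\<in>UNIV. \<beta> $ Some j * X i w $ j) + eps i w"
    and U: "\<And>i w. U i w = moment_vec (X i w) (Y i w)"
    and \<mu>: "\<mu> = stack (vech (LINT w|M. outer (augment (X 0 w)) (augment (X 0 w))))
                      (LINT w|M. Y 0 w *\<^sub>R augment (X 0 w))"
    and V_indep: "prob_space.indep_vars M (\<lambda>_. borel) V UNIV"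
    and V_density: "\<And>i. distributed M lborel (V i) (\<lambda>x. ennreal (f x))"
    and V_indep_U: "indep_rv M (PiM UNIV (\<lambda>_. borel)) (\<lambda>w i. U i w)
                             (PiM UNIV (\<lambda>_. borel)) (\<lambda>w i. V i w)"
    and f: "\<And>x. f x \<ge> 0" "bounded (range f)" "isCont f 0" "f 0 > 0"
    and K: "K \<in> borel_measurable borel" "\<And>u. K u \<ge> 0" "integrable lborel K"
           "(LINT u|lborel. K u) = 1" "\<And>u. K (- u) = K u" "bounded (range K)"
    and h_pos: "\<And>n. n \<ge> 1 \<Longrightarrow> h n > 0"
    and beta_hat_meas: "\<And>n. beta_hat n \<in> borel_measurable M"
    and beta_hat: "\<And>n w. w \<in> space M \<Longrightarrow> mu_hat M U V K h n w \<in> domD \<Longrightarrow>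
                     beta_hat n w = g (mu_hat M U V K h n w)"
    and Sigma_beta_hat_inv_meas: "\<And>n. Sigma_beta_hat_inv n \<in> borel_measurable M"
    and Sigma_beta_hat_inv: "\<And>n w. w \<in> space M \<Longrightarrow> mu_hat M U V K h n w \<in> domD \<Longrightarrow>
                     invertible (sandwich (mu_hat M U V K h n w) (Sigma_mu_hat U K f n w)) \<Longrightarrow>
                     Sigma_beta_hat_inv n w =
                       matrix_inv (sandwich (mu_hat M U V K h n w) (Sigma_mu_hat U K f n w))"
    and Sigma_beta: "Sigma_beta = sandwich \<mu> (Sigma_mu M U K f)"
    and ergodic: "ergodic M borel (\<lambda>i w. (X i w, eps i w))"
    and U_L2: "integrable M (\<lambda>w. (norm (U 0 w))\<^sup>2)"
    and h_lim: "h \<longlonglongrightarrow> 0"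
    and nh_lim: "filterlim (\<lambda>n. real n * h n) at_top sequentially"
    and cov_lim: "(\<lambda>n. real n * h n * lambda_max (cov_matrix M (sample_mean U n))) \<longlonglongrightarrow> 0"
    and K_L2: "integrable lborel (\<lambda>u. (K u)\<^sup>2)"
    and \<mu>_dom: "\<mu> \<in> domD"
  shows "weakly_converges
           (\<lambda>n. distr M borel (\<lambda>w. sqrt (real n * h n) *\<^sub>R (beta_hat n w - \<beta>)))
           (mv_normal 0 Sigma_beta)
    \<and> (integrable M (\<lambda>w. (norm (X 0 w)) ^ 4) \<longrightarrow>
       (AE w in M. 0 < nn_cond_exp M (generated_by M borel (X 0)) (\<lambda>w. ennreal ((eps 0 w)\<^sup>2)) w
                 \<and> nn_cond_exp M (generated_by M borel (X 0)) (\<lambda>w. ennreal ((eps 0 w)\<^sup>2)) w < \<infinity>) \<longrightarrow>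
       interior (law_support (distr M borel (X 0))) \<noteq> {} \<longrightarrow>
       pos_definite Sigma_beta
       \<and> (\<forall>\<alpha>. 0 < \<alpha> \<and> \<alpha> < 1 \<longrightarrow>
           (\<lambda>n. measure M {w \<in> space M.
                  \<beta> \<in> conf_region (real n * h n) (beta_hat n w) (Sigma_beta_hat_inv n w) \<alpha>})
             \<longlonglongrightarrow> 1 - \<alpha>))"
proof -
  interpret prob_space M by (rule M)

  \<comment> \<open>Moments and laws of the observations\<close>
  let ?Z = "\<lambda>i w. (X i w, eps i w)" and ?A = "\<lambda>i w. augment (X i w)"
  have Zm [measurable]: "?Z i \<in> borel_measurable M" for i using stationary by (simp add: stationary_def)
  have fs [measurable]: "fst \<in> borel_measurable (borel :: ((real ^ ('p::{finite,linorder})) \<times> real) measure)"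
      "snd \<in> borel_measurable (borel :: ((real ^ ('p::{finite,linorder})) \<times> real) measure)"
    by (intro borel_measurable_continuous_onI continuous_intros)+
  have Xm [measurable]: "X i \<in> borel_measurable M" for i
    using measurable_compose[OF Zm[of i] fs(1)] by simp
  have epsm [measurable]: "eps i \<in> borel_measurable M" for i
    using measurable_compose[OF Zm[of i] fs(2)] by simp
  have Vm [measurable]: "V i \<in> borel_measurable M" for i
    using V_indep by (auto simp: indep_vars_def)
  \<comment> \<open>One fixed measurable function turns \<open>(X i, eps i)\<close> into
    \<open>U i\<close>, so stationarity and the ergodic theorem carry over.\<close>
  define \<Phi> where "\<Phi> z = moment_vec (fst z) (\<beta> $ None + (\<Sum>j\<in>UNIV. \<beta> $ Some j * fst z $ j) + snd z)"
    for z :: "(real ^ ('p::{finite,linorder})) \<times> real"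
  have \<Phi>m [measurable]: "\<Phi> \<in> borel_measurable borel"
    unfolding \<Phi>_def[abs_def] by (rule borel_measurable_moment_vec) measurable
  have U\<Phi>: "U i w = \<Phi> (?Z i w)" for i w by (simp add: U Y \<Phi>_def)
  have U\<Phi>': "U i = (\<lambda>w. \<Phi> (?Z i w))" for i by (simp add: fun_eq_iff U\<Phi>)
  have Um [measurable]: "U i \<in> borel_measurable M" for i unfolding U\<Phi>' by measurable
  have dU: "distr M borel (U i) = distr M borel (U 0)" for i
  proof -
    have "distr M borel (U i) = distr (distr M borel (?Z i)) borel \<Phi>" for i
      by (subst distr_distr) (auto simp: comp_def U\<Phi>')
    then show ?thesis using stationary_distr[OF stationary] by metis
  qed
  have sqU: "square_integrable M (U i)" for i
  proof -
    have "integrable (distr M borel (U i)) (\<lambda>u. (norm u)\<^sup>2)"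
      unfolding dU[of i] using U_L2 by (subst integrable_distr_eq) auto
    then show ?thesis unfolding square_integrable_def by (subst (asm) integrable_distr_eq) auto
  qed
  have sqA: "square_integrable M (?A 0)"
    unfolding square_integrable_def using X_L2 by (auto simp: norm_augment)
  have intU: "integrable M (U i)" for i by (rule square_integrable_integrable[OF M sqU])
  have meanU0: "(LINT w|M. U 0 w) = \<mu>"
  proof (subst vec_eq_iff, rule allI)
    fix k :: "'p option ltri + 'p option"
    have iYA: "integrable M (\<lambda>w. Y 0 w *\<^sub>R ?A 0 w)"
    proof (rule integrable_vec)
      show "integrable M (\<lambda>w. (Y 0 w *\<^sub>R ?A 0 w) $ j)" for j
        using integrable_bounded_linear[OF bounded_linear_vec_nth intU[of 0], of "Inr j"]
        by (simp add: U moment_vec_nth)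
    qed
    show "(LINT w|M. U 0 w) $ k = \<mu> $ k"
    proof (cases k)
      case (Inl l)
      then show ?thesis
        unfolding integral_vec_nth[OF intU] by (simp add: U moment_vec_nth \<mu> stack_def vech_def integral_outer_nth[OF sqA])
    next
      case (Inr j)
      then show ?thesis
        unfolding integral_vec_nth[OF intU] by (simp add: U moment_vec_nth \<mu> stack_def integral_vec_nth[OF iYA])
    qed
  qed
  have meanU: "(LINT w|M. U i w) = \<mu>" for i
  proof -
    have "(LINT w|M. U i w) = (LINT u|distr M borel (U i). u)" for i by (subst integral_distr) auto
    then show ?thesis using dU[of i] meanU0 by simp
  qed

  \<comment> \<open>The coefficients solve the population normal equations\<close>
  let ?L = "normal_eq_defect \<beta>"
  have bl: "bounded_linear ?L" using linear_normal_eq_defect linear_conv_bounded_linear by blast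
  have LU: "?L (U i w) = eps i w *\<^sub>R ?A i w" for i w
    unfolding U normal_eq_defect_moment_vec by (simp add: Y inner_augment)
  \<comment> \<open>Centred residuals are orthogonal to the covariates; by linearity the defect at
    \<mu> vanishes, which means \<open>g \<mu> = \<beta>\<close>.\<close>
  have "(LINT w|M. ?L (U 0 w)) = 0"
    unfolding LU
    by (rule centred_residual_moment[OF M _ _ eps_centred])
       (use integrable_bounded_linear[OF bl intU[of 0]] in \<open>simp_all add: LU\<close>)
  then have L\<mu>: "?L \<mu> = 0" by (simp add: integral_bounded_linear[OF bl intU] meanU)
  have detS: "det (Sigma_of \<mu>) \<noteq> 0" using \<mu>_dom by (simp add: domD_def)
  have g\<mu>: "g \<mu> = \<beta>"
    using L\<mu> matrix_inv_vector(2)[OF detS] by (simp add: g_def normal_eq_defect_def)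

  \<comment> \<open>Fluctuations of the smoothed moments\<close>
  let ?r = "\<lambda>n. real n * h n" and ?mu = "mu_hat M U V K h" and ?S = "Sigma_mu M U K f"
  let ?D = "\<lambda>n w. sqrt (?r n) *\<^sub>R (?mu n w - \<mu>)" and ?W = "\<lambda>n w. sqrt (?r n) *\<^sub>R (beta_hat n w - \<beta>)"
  have r_pos: "?r n > 0" if "n \<ge> 1" for n using h_pos[OF that] that by simp
  have r_nonneg: "?r n \<ge> 0" for n by (cases "n = 0") (use r_pos[of n] in auto)
  have mum [measurable]: "?mu n \<in> borel_measurable M" for n
    by (rule borel_measurable_mu_hat[OF Um Vm K(1)])
  have Dm [measurable]: "?D n \<in> borel_measurable M" for n by measurable
  note [measurable] = beta_hat_meas Sigma_beta_hat_inv_meas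
  have Wm [measurable]: "?W n \<in> borel_measurable M" for n by measurable
  have lln: "AE w in M. (\<lambda>n. (\<Sum>i<n. (c \<bullet> U i w)\<^sup>2) / n) \<longlonglongrightarrow> (LINT w|M. (c \<bullet> U 0 w)\<^sup>2)" for c
    using ergodic_average[OF M stationary ergodic, of "\<lambda>z. (c \<bullet> \<Phi> z)\<^sup>2"] square_integrable_inner[OF sqU[of 0], of c]
    by (simp add: U\<Phi>')
  have charD: "(\<lambda>n. CLINT w|M. iexp (c \<bullet> ?D n w)) \<longlonglongrightarrow> of_real (exp (- (c \<bullet> (?S *v c)) / 2))" for c
    by (rule smoothed_moments_char_tendsto[OF M V_indep V_density V_indep_U f K(1,3,4,6) K_L2 h_pos h_lim nh_lim
          sqU dU meanU lln cov_lim])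
  have c2_pos: "c2 K / f 0 > 0" using c2_pos[OF K(1) K(4) K_L2] f(4) by simp
  have psdS: "pos_semidefinite ?S"
    using pos_semidefinite_scaleR[OF pos_semidefinite_integral_outer[OF sqU[of 0]]] c2_pos
    by (simp add: Sigma_mu_def)
  have tightD: "tight_rv M ?D"
    by (rule tight_rv_weakly_converges[OF M Dm prob_space_mv_normal sets_mv_normal
          weakly_converges_mv_normal[OF M Dm psdS charD]])
  have mu_lim: "tendsto_prob M ?mu \<mu>"
    by (rule tendsto_prob_of_scaled_tight[OF M tightD mum r_pos nh_lim])

  \<comment> \<open>Transfer to the estimated coefficients\<close>
  let ?I = "\<lambda>x. matrix_inv (Sigma_of x)" and ?G = "grad_g \<mu>"
  have G: "?G *v d = ?I \<mu> *v ?L d" for d using grad_g_mult[OF \<mu>_dom] by (simp add: g\<mu>)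
  interpret mv: bounded_bilinear "\<lambda>(A :: real ^ 'p option ^ 'p option) (x :: real ^ 'p option). A *v x"
    by (rule bounded_bilinear_matrix_vector_mult)
  obtain C where C: "\<And>(A :: real ^ 'p option ^ 'p option) b. norm (A *v b) \<le> norm A * norm b * C" "C > 0"
    using mv.pos_bounded by blast
  obtain C' where C': "\<And>d. norm (?L d) \<le> norm d * C'" "C' > 0"
    using bounded_linear.pos_bounded[OF bl] by blast
  have "isCont ?I \<mu>"
    unfolding isCont_def by (intro tendsto_matrix_inv tendsto_Sigma_of tendsto_ident_at detS)
  then have I_lim: "tendsto_prob M (\<lambda>n w. ?I (?mu n w)) (?I \<mu>)"
    by (rule tendsto_prob_isCont[OF mu_lim])
  \<comment> \<open>The cost of replacing the random inverse in the exact error formula by its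
    limit.\<close>
  have R: "tendsto_prob M (\<lambda>n w. (?I (?mu n w) - ?I \<mu>) *v ?L (?D n w)) 0"
  proof (rule tendsto_prob_tight_mult[OF I_lim tightD Dm, where k=1 and K="C * C'"])
    fix n w
    have "norm ((?I (?mu n w) - ?I \<mu>) *v ?L (?D n w)) \<le> norm (?I (?mu n w) - ?I \<mu>) * norm (?L (?D n w)) * C"
      by (rule C)
    also have "\<dots> \<le> norm (?I (?mu n w) - ?I \<mu>) * (norm (?D n w) * C') * C"
      using C(2) by (intro mult_right_mono mult_left_mono C') auto
    finally show "norm ((?I (?mu n w) - ?I \<mu>) *v ?L (?D n w))
        \<le> C * C' * dist (?I (?mu n w)) (?I \<mu>) * norm (?D n w) ^ 1"
      by (simp only: dist_norm power_one_right mult_ac)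
  qed (use C C' in simp)
  obtain d where d: "d > 0" "ball \<mu> d \<subseteq> domD"
    using open_domD \<mu>_dom by (meson openE)
  \<comment> \<open>Within distance \<open>d\<close> of \<mu> the smoothed moments lie in
    \<open>domD\<close>, where the estimator is given by \<open>g\<close> and \<open>g_diff\<close>
    makes the linearization error equal to the term in \<open>R\<close>.\<close>
  have R': "tendsto_prob M (\<lambda>n w. ?W n w - ?G *v ?D n w) 0"
  proof (rule tendsto_prob_transform[OF R mu_lim d(1), where ?n0.0=0])
    fix w n assume w: "w \<in> space M" "dist (?mu n w) \<mu> < d"
    then have dom: "?mu n w \<in> domD" using d(2) by (auto simp: dist_commute)
    have "beta_hat n w - \<beta> = ?I (?mu n w) *v ?L (?mu n w - \<mu>)"
      using beta_hat[OF w(1) dom] g_diff[OF detS, of "?mu n w"] dom by (simp add: g\<mu> domD_def)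
    then have "?W n w = ?I (?mu n w) *v ?L (?D n w)"
      by (simp add: linear_scale[OF linear_normal_eq_defect] matrix_vector_mult_scaleR)
    then show "(?I (?mu n w) - ?I \<mu>) *v ?L (?D n w) = ?W n w - ?G *v ?D n w"
      by (simp add: G mv.diff_left)
  qed
  have GDm [measurable]: "(\<lambda>w. ?G *v ?D n w) \<in> borel_measurable M" for n
    using measurable_compose[OF Dm measurable_matrix_vector] .
  have charW: "(\<lambda>n. CLINT w|M. iexp (t \<bullet> ?W n w)) \<longlonglongrightarrow> of_real (exp (- (t \<bullet> (Sigma_beta *v t)) / 2))" for t
  proof -
    \<comment> \<open>Testing the transformed error at \<open>t\<close> amounts to testing the
      moment error at \<open>transpose ?G *v t\<close>, which produces the sandwich form.\<close>
    have "t \<bullet> (?G *v x) = (transpose ?G *v t) \<bullet> x" for x by (simp add: dot_lmul_matrix)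
    then have "(\<lambda>n. CLINT w|M. iexp (t \<bullet> (?G *v ?D n w))) \<longlonglongrightarrow> of_real (exp (- (t \<bullet> (Sigma_beta *v t)) / 2))"
      using charD[of "transpose ?G *v t"] unfolding Sigma_beta quadratic_sandwich by simp
    from tendsto_add[OF char_diff_tendsto_0[OF Wm GDm R', of t] this] show ?thesis by simp
  qed
  have psdB: "pos_semidefinite Sigma_beta"
    using psdS unfolding pos_semidefinite_def Sigma_beta
    by (auto simp: quadratic_sandwich intro: transpose_sandwich)
  have convW: "weakly_converges (\<lambda>n. distr M borel (?W n)) (mv_normal 0 Sigma_beta)"
    by (rule weakly_converges_mv_normal[OF M Wm psdB charW])

  \<comment> \<open>Nondegeneracy of the limit law\<close>
  have "pos_definite Sigma_beta \<and> (\<forall>\<alpha>. 0 < \<alpha> \<and> \<alpha> < 1 \<longrightarrow>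
           (\<lambda>n. measure M {w \<in> space M.
                  \<beta> \<in> conf_region (real n * h n) (beta_hat n w) (Sigma_beta_hat_inv n w) \<alpha>})
             \<longlonglongrightarrow> 1 - \<alpha>)"
    if var: "AE w in M. 0 < nn_cond_exp M (generated_by M borel (X 0)) (\<lambda>w. ennreal ((eps 0 w)\<^sup>2)) w"
      and supp: "interior (law_support (distr M borel (X 0))) \<noteq> {}"
  proof (intro conjI allI impI)
    show pd: "pos_definite Sigma_beta"
      unfolding pos_definite_def
    proof (intro conjI allI impI)
      show "transpose Sigma_beta = Sigma_beta" using psdB by (simp add: pos_semidefinite_def)
      fix v :: "real ^ 'p option" assume "v \<noteq> 0"
      define u where "u = transpose ?G *v v"
      let ?v = "transpose (?I \<mu>) *v v"
      have uU: "u \<bullet> U 0 w = (?v \<bullet> ?A 0 w) * eps 0 w" for w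
      proof -
        have "u \<bullet> U 0 w = v \<bullet> (?G *v U 0 w)" by (simp add: u_def dot_lmul_matrix)
        also have "\<dots> = ?v \<bullet> (eps 0 w *\<^sub>R ?A 0 w)" by (simp add: G LU dot_lmul_matrix matrix_vector_mult_scaleR)
        finally show ?thesis by simp
      qed
      have quad: "v \<bullet> (Sigma_beta *v v) = c2 K / f 0 * (LINT w|M. (u \<bullet> U 0 w)\<^sup>2)"
        unfolding Sigma_beta quadratic_sandwich u_def[symmetric]
        using quadratic_integral_outer[OF sqU[of 0], of u u]
        by (simp add: Sigma_mu_def scaleR_matrix_vector_assoc[symmetric] power2_eq_square)
      have "(LINT w|M. (u \<bullet> U 0 w)\<^sup>2) \<noteq> 0"
      proof
        assume "(LINT w|M. (u \<bullet> U 0 w)\<^sup>2) = 0"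
        then have "AE w in M. (u \<bullet> U 0 w)\<^sup>2 = 0"
          by (subst (asm) integral_nonneg_eq_0_iff_AE[OF square_integrable_inner[OF sqU]]) auto
        then have "AE w in M. (?v \<bullet> ?A 0 w) * eps 0 w = 0" by (simp add: uU)
        then have "?v = 0" by (rule residual_moment_nonzero[OF M Xm epsm var supp])
        then have "v v* ?I \<mu> = 0" by simp
        then have "v v* (?I \<mu> ** Sigma_of \<mu>) = 0" by (simp flip: vector_matrix_mul_assoc)
        then show False using \<open>v \<noteq> 0\<close> by (simp add: matrix_inv_mult[OF detS])
      qed
      moreover have "(LINT w|M. (u \<bullet> U 0 w)\<^sup>2) \<ge> 0" by simp
      ultimately have "(LINT w|M. (u \<bullet> U 0 w)\<^sup>2) > 0" by linarith
      then show "v \<bullet> (Sigma_beta *v v) > 0" unfolding quad by (rule mult_pos_pos[OF c2_pos])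
    qed

    \<comment> \<open>Coverage of the confidence region\<close>
    have detB: "det Sigma_beta \<noteq> 0" by (rule pos_definite_imp_det_nz[OF pd])
    fix \<alpha> :: real assume \<alpha>: "0 < \<alpha> \<and> \<alpha> < 1"
    let ?Sh = "Sigma_mu_hat U K f" and ?q = "quantile (chi_squared CARD('p option)) (1 - \<alpha>)"
    have Sh_nth: "?Sh n w $ i $ j = c2 K / f 0 * ((\<Sum>k<n. U k w $ i * U k w $ j) / n)" for n w i j
      by (simp add: Sigma_mu_hat_def sample_mean_def outer_def)
    \<comment> \<open>The estimator averages without kernel weights, so the ergodic theorem applies
      to each product of entries; the finitely many null sets are combined.\<close>
    have Sh_lim: "tendsto_prob M ?Sh ?S"
    proof (rule tendsto_prob_AE)
      show "?Sh n \<in> borel_measurable M" for n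
        by (intro borel_measurable_vec, unfold Sh_nth) measurable
      have "AE w in M. (\<lambda>n. (\<Sum>k<n. U k w $ i * U k w $ j) / n) \<longlonglongrightarrow> (LINT w|M. U 0 w $ i * U 0 w $ j)" for i j
        using ergodic_average[OF M stationary ergodic, of "\<lambda>z. \<Phi> z $ i * \<Phi> z $ j"] square_integrable_mult[OF sqU[of 0], of i j]
        by (simp add: U\<Phi>')
      then have "AE w in M. \<forall>i j. (\<lambda>n. (\<Sum>k<n. U k w $ i * U k w $ j) / n) \<longlonglongrightarrow> (LINT w|M. U 0 w $ i * U 0 w $ j)"
        by (simp add: AE_all_countable)
      then show "AE w in M. (\<lambda>n. ?Sh n w) \<longlonglongrightarrow> ?S"
      proof eventually_elim
        case (elim w)
        show ?case
        proof (intro vec_tendstoI)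
          fix i j
          have "?S $ i $ j = c2 K / f 0 * (LINT w|M. U 0 w $ i * U 0 w $ j)"
            by (simp add: Sigma_mu_def integral_outer_nth[OF sqU])
          moreover have "(\<lambda>n. c2 K / f 0 * ((\<Sum>k<n. U k w $ i * U k w $ j) / n))
              \<longlonglongrightarrow> c2 K / f 0 * (LINT w|M. U 0 w $ i * U 0 w $ j)"
            by (intro tendsto_mult tendsto_const) (use elim in blast)
          ultimately show "(\<lambda>n. ?Sh n w $ i $ j) \<longlonglongrightarrow> ?S $ i $ j"
            unfolding Sh_nth by (simp only:)
        qed
      qed
    qed
    let ?F = "\<lambda>p. sandwich (fst p) (snd p)"
    have Fc: "(?F \<longlongrightarrow> Sigma_beta) (at (\<mu>, ?S))"
      unfolding Sigma_beta
      by (intro tendsto_sandwich_matrix[OF \<mu>_dom]) (use tendsto_fst[OF tendsto_ident_at] tendsto_snd[OF tendsto_ident_at] in \<open>force+\<close>)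
    have pair: "tendsto_prob M (\<lambda>n w. (?mu n w, ?Sh n w)) (\<mu>, ?S)"
      by (rule tendsto_prob_Pair[OF mu_lim Sh_lim])
    have "isCont (\<lambda>p. matrix_inv (?F p)) (\<mu>, ?S)"
      unfolding isCont_def using tendsto_matrix_inv[OF Fc detB] by (simp add: Sigma_beta)
    from tendsto_prob_isCont[OF pair this]
    have inv: "tendsto_prob M (\<lambda>n w. matrix_inv (sandwich (?mu n w) (?Sh n w))) (matrix_inv Sigma_beta)"
      by (simp add: Sigma_beta)
    have "\<forall>\<^sub>F p in at (\<mu>, ?S). det (?F p) \<noteq> 0"
      by (rule tendsto_imp_eventually_ne[OF tendsto_det[OF Fc] detB])
    \<comment> \<open>The filter excludes the limit point itself, where \<open>detB\<close> takes
      over.\<close>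
    then obtain e where e: "e > 0" "\<And>p. p \<noteq> (\<mu>, ?S) \<Longrightarrow> dist p (\<mu>, ?S) < e \<Longrightarrow> det (?F p) \<noteq> 0"
      unfolding eventually_at by auto
    \<comment> \<open>Distance below \<open>d\<close> ensures the domain condition, distance below
      \<open>e\<close> invertibility; together they make the prescribed formula for the inverse
      valid.\<close>
    have P_lim: "tendsto_prob M Sigma_beta_hat_inv (matrix_inv Sigma_beta)"
    proof (rule tendsto_prob_transform[OF inv pair, where ?n0.0=0])
      show "min e d > 0" using e d by simp
      fix w n assume w: "w \<in> space M" "dist (?mu n w, ?Sh n w) (\<mu>, ?S) < min e d"
      have "dist (?mu n w) \<mu> \<le> dist (?mu n w, ?Sh n w) (\<mu>, ?S)"
        using dist_fst_le[of "(?mu n w, ?Sh n w)" "(\<mu>, ?S)"] by simp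
      then have dom: "?mu n w \<in> domD" using d(2) w by (auto simp: dist_commute)
      have "det (?F (?mu n w, ?Sh n w)) \<noteq> 0"
        using e(2)[of "(?mu n w, ?Sh n w)"] w detB by (cases "(?mu n w, ?Sh n w) = (\<mu>, ?S)") (auto simp: Sigma_beta)
      then show "matrix_inv (sandwich (?mu n w) (?Sh n w)) = Sigma_beta_hat_inv n w"
        using Sigma_beta_hat_inv[OF w(1) dom] by (simp add: invertible_det_nz)
    qed
    have "(\<lambda>n. measure M {w \<in> space M. ?W n w \<bullet> (Sigma_beta_hat_inv n w *v ?W n w) \<le> ?q})
        \<longlonglongrightarrow> cdf (chi_squared CARD('p option)) ?q"
      by (rule quadratic_form_cdf_tendsto[OF M Wm Sigma_beta_hat_inv_meas psdB detB convW P_lim])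
    moreover have "cdf (chi_squared CARD('p option)) ?q = 1 - \<alpha>"
      by (rule cdf_quantile[OF real_distribution_chi_squared isCont_cdf_chi_squared]) (use \<alpha> in auto)
    \<comment> \<open>The rate is absorbed into the form as \<open>sqrt (?r n)\<close> squared,
      which is legitimate for every \<open>n\<close> since \<open>?r n\<close> is nonnegative, and
      zero at \<open>n = 0\<close>.\<close>
    moreover have "?W n w \<bullet> (Sigma_beta_hat_inv n w *v ?W n w) \<le> ?q
        \<longleftrightarrow> \<beta> \<in> conf_region (real n * h n) (beta_hat n w) (Sigma_beta_hat_inv n w) \<alpha>" for n w
    proof -
      have "(s *\<^sub>R x) \<bullet> (P *v (s *\<^sub>R x)) = s * s * (x \<bullet> (P *v x))"
        for s :: real and x and P :: "real ^ 'p option ^ 'p option"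
        by (simp add: matrix_vector_mult_scaleR)
      then have "?W n w \<bullet> (Sigma_beta_hat_inv n w *v ?W n w)
          = ?r n * ((beta_hat n w - \<beta>) \<bullet> (Sigma_beta_hat_inv n w *v (beta_hat n w - \<beta>)))"
        using real_sqrt_mult_self[of "?r n"] abs_of_nonneg[OF r_nonneg[of n]] by metis
      then show ?thesis by (simp only: conf_region_def mem_Collect_eq)
    qed
    ultimately show "(\<lambda>n. measure M {w \<in> space M.
                  \<beta> \<in> conf_region (real n * h n) (beta_hat n w) (Sigma_beta_hat_inv n w) \<alpha>})
             \<longlonglongrightarrow> 1 - \<alpha>"
      by simp
  qed
  with convW show ?thesis by (auto elim: AE_mp)
qed

end
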